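(* Let $\lambda\in\mathbb{C}$ with $\Im(\lambda)>0$ and $|2+\lambda^2|<1$, let $m\in\mathbb{Z}\setminus\{0\}$, and let $f_{\lambda+m\pi}(z)=\lambda+m\pi+z+\tan z$. Then, in addition to the primary Fatou component, $f_{\lambda+m\pi}$ has $|m|$ many wandering domains with pairwise distinct grand orbits. If $W$ is such a wandering domain, then: \begin{enumerate} \item $W$ is escaping, i.e. $f_{\lambda+m\pi}^n(z)\to\infty$ as $n\to\infty$ for all $z\in W$; \item there is a two-sided sequence $\{W_n\}_{n\in\mathbb{Z}}$ of unbounded wandering domains in the grand orbit of $W$ such that $f_{\lambda+m\pi}:W_n\to W_{n+1}$ is a proper map of degree $2$ for every $n$; \item if $W'$ is a wandering domain in the grand orbit of $W$ which is different from all the $W_n$, then $f_{\lambda+m\pi}$ is one-to-one on $W'$; \item $\liminf_{n\to\infty}\operatorname{dist}(f_{\lambda+m\pi}^n(z),\partial W_n)>0$ for all $z\in W$, where $W_n=f^n_{\lambda+m\pi}(W)$ is the Fatou component containing $f^n_{\lambda+m\pi}(W)$. \end{enumerate} Moreover, the Fatou set of $f_{\lambda+m\pi}$ is the union of the primary Fatou component and these $|m|$ grand orbits of wandering domains.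
   Context: For $\mu\in\mathbb{C}$, $f_\mu(z)=\mu+z+\tan z$, a meromorphic function on $\mathbb{C}$. The Fatou set is the set of points having a neighbourhood on which the iterates $\{f^n\}$ are defined and form a normal family; the Julia set is its complement in $\widehat{\mathbb{C}}$; Fatou components are connected components of the Fatou set. A Fatou component $U$ is wandering if $f^m(U)$ and $f^n(U)$ lie in different Fatou components for all distinct $m,n\ge 0$. The grand orbit of a Fatou component $U$ consists of all Fatou components $U'$ such that some forward iterate of $U'$ and some forward iterate of $U$ lie in the same Fatou component. For $\Im(\mu)>0$, $f_\mu$ has a completely invariant Baker domain (a completely invariant Fatou component on which $f^n\to\infty$) containing the upper half-plane; it is called the primary Fatou component. $\operatorname{dist}$ denotes Euclidean distance. *)

theory Defs
  imports "HOL-Complex_Analysis.Complex_Analysis"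
begin

text \<open>The family f_mu(z) = mu + z + tan z. Isabelle's tan is sin/cos (value 0 at poles);
  the poles are the points where cos z = 0, so the domain of holomorphy is tan_domain.\<close>

definition ftan :: "complex \<Rightarrow> complex \<Rightarrow> complex" where
  "ftan \<mu> z = \<mu> + z + tan z"

definition tan_domain :: "complex set" where
  "tan_domain = {z. cos z \<noteq> 0}"

definition normal_family :: "complex set \<Rightarrow> (nat \<Rightarrow> complex \<Rightarrow> complex) \<Rightarrow> bool" where
  "normal_family U F \<longleftrightarrow>
     (\<forall>k :: nat \<Rightarrow> nat. \<exists>r. strict_mono r \<and>
        ((\<exists>g. \<forall>K. compact K \<and> K \<subseteq> U \<longrightarrow> uniform_limit K (\<lambda>j. F (k (r j))) g sequentially)
         \<or> (\<forall>K. compact K \<and> K \<subseteq> U \<longrightarrow>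
              (\<forall>B. eventually (\<lambda>j. \<forall>w\<in>K. B \<le> norm (F (k (r j)) w)) sequentially))))"

definition fatou_set :: "(complex \<Rightarrow> complex) \<Rightarrow> complex set \<Rightarrow> complex set" where
  "fatou_set f D = {z. \<exists>U. open U \<and> z \<in> U \<and> (\<forall>n. \<forall>w\<in>U. (f ^^ n) w \<in> D)
                         \<and> normal_family U (\<lambda>n. f ^^ n)}"

definition fatou_component :: "(complex \<Rightarrow> complex) \<Rightarrow> complex set \<Rightarrow> complex set \<Rightarrow> bool" where
  "fatou_component f D U \<longleftrightarrow>
     (\<exists>z\<in>fatou_set f D. U = connected_component_set (fatou_set f D) z)"

definition comp_of :: "(complex \<Rightarrow> complex) \<Rightarrow> complex set \<Rightarrow> complex \<Rightarrow> complex set" where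
  "comp_of f D w = connected_component_set (fatou_set f D) w"

definition wandering :: "(complex \<Rightarrow> complex) \<Rightarrow> complex set \<Rightarrow> complex set \<Rightarrow> bool" where
  "wandering f D U \<longleftrightarrow> fatou_component f D U \<and>
     (\<forall>m n. m \<noteq> n \<longrightarrow> (\<forall>z\<in>U. \<forall>w\<in>U. comp_of f D ((f ^^ m) z) \<noteq> comp_of f D ((f ^^ n) w)))"

definition grand_orbit :: "(complex \<Rightarrow> complex) \<Rightarrow> complex set \<Rightarrow> complex set \<Rightarrow> complex set set" where
  "grand_orbit f D U = {U'. fatou_component f D U' \<and>
     (\<exists>m n. \<exists>z\<in>U'. \<exists>w\<in>U. comp_of f D ((f ^^ m) z) = comp_of f D ((f ^^ n) w))}"

text \<open>Primary Fatou component (Im mu > 0): the Fatou component containing the upper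
  half-plane, i.e. the component containing the point i.\<close>
definition primary_component :: "complex \<Rightarrow> complex set" where
  "primary_component \<mu> = comp_of (ftan \<mu>) tan_domain \<i>"

definition escaping :: "(complex \<Rightarrow> complex) \<Rightarrow> complex set \<Rightarrow> bool" where
  "escaping f W \<longleftrightarrow> (\<forall>z\<in>W. filterlim (\<lambda>n. (f ^^ n) z) at_infinity sequentially)"

definition proper_cmap :: "(complex \<Rightarrow> complex) \<Rightarrow> complex set \<Rightarrow> complex set \<Rightarrow> bool" where
  "proper_cmap f A B \<longleftrightarrow> f ` A \<subseteq> B \<and>
     (\<forall>K. compact K \<and> K \<subseteq> B \<longrightarrow> compact {z\<in>A. f z \<in> K})"

definition map_degree :: "(complex \<Rightarrow> complex) \<Rightarrow> complex set \<Rightarrow> complex set \<Rightarrow> nat \<Rightarrow> bool" where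
  "map_degree f A B d \<longleftrightarrow> (\<forall>w\<in>B. finite {z\<in>A. f z = w} \<and>
     (\<Sum>z\<in>{z\<in>A. f z = w}. nat (zorder (\<lambda>x. f x - w) z)) = d)"

end

theory Submission
  imports Defs
begin

text \<open>
  Write \<open>F = ftan lam\<close>, so that the map is \<open>f = F + m * pi\<close> and, since \<open>F\<close> commutes with the translation
  by \<open>pi\<close>, \<open>f\<^sup>n = F\<^sup>n + n * m * pi\<close>.  The solutions of \<open>tan z = - lam\<close> are attracting fixed points of
  \<open>F\<close>; they form one class modulo \<open>pi\<close>, their basins are shifted into one another by \<open>f\<close>, and this is
  where the wandering domains come from.  The points that reach the upper half-plane form the
  primary component.  It remains to see that a point with all iterates defined nearby lies in one of
  these sets.  As \<open>F\<close> has no finite asymptotic values, inverse branches of iterates exist away from the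
  postcritical set; by Fatou's argument the critical points below the real axis lie in the immediate
  basins, so the postcritical set is harmless, and inverse branches along a nonescaping orbit
  contract, which excludes normality of any further orbit.  On the immediate basin, which contains
  exactly one simple critical point, \<open>F\<close> is conjugate to a Blaschke product of degree 2, whose boundary
  fixed point forces the immediate basin to be unbounded.
\<close>

section \<open>Covering maps and normal families\<close>

text \<open>At a solution of \<open>tan z = - lam\<close> the derivative of \<open>F\<close> is
  \<open>2 + (tan z)^2 = 2 + lam^2\<close>, so the hypothesis says that these fixed points attract.
  It also forces \<open>Im lam > 1\<close>. Far below the real axis \<open>tan z\<close> tends to
  \<open>-i\<close>, so \<open>F\<close> is there nearly the translation by \<open>lam - i\<close>
  and moves points upwards; an orbit that stays below the real axis therefore accumulates modulo
  \<open>pi\<close>. Critical points satisfy \<open>tan z = i * sqrt 2\<close> or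
  \<open>tan z = - i * sqrt 2\<close>. Those of the first kind lie above the real axis; those of the
  second form one class modulo \<open>pi\<close>, one point per basin. Normality for
  \<open>F\<close> and for \<open>f\<close> are different conditions: a finite limit of
  \<open>F^n\<close> becomes the limit infinity for \<open>f^n = F^n + n m pi\<close>. The two maps
  are therefore compared through the set where all iterates are defined, which they share. Since
  \<open>f\<close> carries the basin of index \<open>k\<close> into the basin of index
  \<open>k + m\<close>, grand orbits of wandering domains correspond to residue classes modulo
  \<open>m\<close>, whence their number \<open>|m|\<close>. On the lower half-plane
  \<open>exp (- i * F^n)\<close> is bounded by 1; this replaces a normal families argument in the
  derivative estimates.\<close>

lemma covering_space_simply_connected_inj:
  fixes p :: "complex \<Rightarrow> complex"
  assumes cov: "covering_space V p T" and V: "open V" "connected V"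
    and T: "open T" "simply_connected T"
  shows "inj_on p V"
proof (cases "V = {}")
  case False
  have pV: "p ` V = T" and contp: "continuous_on V p"
    using cov by (auto simp: covering_space_def)
  \<comment> \<open>Lifting the identity of the simply connected base gives a section
    \<open>g\<close>. Its image turns out to be open and closed in \<open>V\<close>, so
    \<open>g\<close> is an inverse of \<open>p\<close>.\<close>
  obtain g where g: "continuous_on T g" "g \<in> T \<rightarrow> V" and pg: "\<And>y. y \<in> T \<Longrightarrow> p (g y) = y"
    using covering_space_lift [OF cov T(2) open_imp_locally_path_connected [OF T(1)] continuous_on_id]
    by blast
  have inj: "inj_on g T"
    by (metis inj_onI pg)
  have op: "open (g ` T)"
    using invariance_of_domain [OF g(1) T(1) inj] .
  \<comment> \<open>\<open>GPicard2\<close> serves as the clopen principle: a nonempty open subset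
    of a connected set that contains all its limit points there is the whole set.\<close>
  have "g ` T = V"
  proof (rule GPicard2)
    show "g ` T \<subseteq> V" "connected V" "open (g ` T)" using g V op by auto
    show "g ` T \<noteq> {}" using False pV by auto
    fix x assume x: "x islimpt g ` T" "x \<in> V"
    then obtain s where s: "\<And>n. s n \<in> g ` T" "s \<longlonglongrightarrow> x"
      by (meson DiffD1 islimpt_sequential)
    then have "(\<lambda>n. p (s n)) \<longlonglongrightarrow> p x"
      using contp V(1) x(2) s(2) continuous_on_eq_continuous_at isCont_tendsto_compose by blast
    moreover have px: "p x \<in> T" using pV x by auto
    ultimately have "(\<lambda>n. g (p (s n))) \<longlonglongrightarrow> g (p x)"
      using g(1) T(1) continuous_on_eq_continuous_at isCont_tendsto_compose by blast
    moreover have "g (p (s n)) = s n" for n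
      using s(1)[of n] pg by auto
    ultimately have "x = g (p x)"
      using s(2) LIMSEQ_unique by auto
    then show "x \<in> g ` T" using px by auto
  qed
  then show ?thesis
    by (metis imageE inj_onI pg)
qed auto

text \<open>A proper local homeomorphism is a finite covering. The fibre is compact and, by local
  injectivity, discrete, hence finite; properness is used again to keep points far from the fibre
  from being mapped close to \<open>y\<close>.\<close>

lemma proper_holomorphic_covering_space:
  assumes V: "open V" and T: "open T" and holf: "f holomorphic_on V"
    and nz: "\<And>z. z \<in> V \<Longrightarrow> deriv f z \<noteq> 0"
    and prp: "proper_cmap f V T" and onto: "f ` V = T"
  shows "covering_space V f T"
proof
  show contf: "continuous_on V f"
    using holf holomorphic_on_imp_continuous_on by blast
  show "f ` V = T" by fact
  fix y assume y: "y \<in> T"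
  have comp: "compact {z \<in> V. f z \<in> K}" if "compact K" "K \<subseteq> T" for K
    using prp that by (auto simp: proper_cmap_def)
  define S where "S = {z \<in> V. f z = y}"
  have cS: "compact S"
    using comp[of "{y}"] y by (simp add: S_def)
  have "\<exists>r>0. ball x r \<subseteq> V \<and> inj_on f (ball x r)" if "x \<in> V" for x
    using has_complex_derivative_locally_injective [OF holf that V nz [OF that]] by metis
  then obtain r where r: "\<And>x. x \<in> V \<Longrightarrow> r x > 0 \<and> ball x (r x) \<subseteq> V \<and> inj_on f (ball x (r x))"
    by metis
  have SV: "S \<subseteq> V" by (auto simp: S_def)
  have finS: "finite S"
  proof -
    have "S \<subseteq> (\<Union>x\<in>S. ball x (r x))" using r SV by force
    then obtain S' where S': "S' \<subseteq> S" "finite S'" "S \<subseteq> (\<Union>x\<in>S'. ball x (r x))"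
      using compactE_image [OF cS, of S "\<lambda>x. ball x (r x)"] by (metis open_ball)
    have "x = z" if "z \<in> S'" "x \<in> S" "x \<in> ball z (r z)" for x z
    proof -
      have "z \<in> V" "f x = f z" using that S' by (auto simp: S_def)
      then show ?thesis using r[of z] that by (auto dest: inj_onD)
    qed
    then have "S \<subseteq> S'" using S' by blast
    then show ?thesis using S' finite_subset by blast
  qed
  \<comment> \<open>The entry 1 makes \<open>M\<close> nonempty without looking at the fibre. Balls
    of half the minimum are pairwise disjoint and lie where \<open>f\<close> is injective.\<close>
  define M where "M = insert 1 (r ` S \<union> (\<lambda>(x,z). dist x z) ` {(x,z). x \<in> S \<and> z \<in> S \<and> x \<noteq> z})"
  have "finite {(x,z). x \<in> S \<and> z \<in> S \<and> x \<noteq> z}"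
    by (rule finite_subset [of _ "S \<times> S"]) (use finS in auto)
  then have finM: "finite M" using finS by (simp add: M_def)
  define e where "e = Min M"
  have e0: "e > 0"
    unfolding e_def using finM r SV by (subst Min_gr_iff) (auto simp: M_def)
  have er: "e \<le> r x" if "x \<in> S" for x
    unfolding e_def using finM that by (intro Min_le) (auto simp: M_def)
  have ed: "e \<le> dist x z" if "x \<in> S" "z \<in> S" "x \<noteq> z" for x z
    unfolding e_def using finM that by (intro Min_le) (auto simp: M_def image_iff)
  define A where "A = (\<lambda>x::complex. ball x (e/2))"
  have Ar: "A x \<subseteq> ball x (r x)" if "x \<in> S" for x
    using er[OF that] e0 by (auto simp: A_def)
  have AV: "A x \<subseteq> V" and Ainj: "inj_on f (A x)" if "x \<in> S" for x
    using Ar[OF that] r[of x] that SV inj_on_subset by blast+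
  have opA: "open (f ` A x)" if "x \<in> S" for x
    using Ainj AV contf that
    by (intro invariance_of_domain) (auto simp: A_def intro: continuous_on_subset)
  obtain d where d: "d > 0" "cball y d \<subseteq> T"
    using T y open_contains_cball by blast
  define L where "L = {z \<in> V. f z \<in> cball y d}"
  have "compact (L - (\<Union>x\<in>S. A x))"
    using comp[OF _ d(2)] by (intro compact_diff) (auto simp: L_def A_def)
  then have "compact (f ` (L - (\<Union>x\<in>S. A x)))"
    by (intro compact_continuous_image continuous_on_subset [OF contf]) (auto simp: L_def)
  then have cl: "closed (f ` (L - (\<Union>x\<in>S. A x)))"
    using compact_imp_closed by blast
  \<comment> \<open>Subtracting the image of the rest of \<open>L\<close> leaves \<open>N\<close>
    without preimages outside the chosen balls; that image is closed because \<open>L\<close> is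
    compact.\<close>
  define N where "N = ball y d \<inter> (\<Inter>x\<in>S. f ` A x) - f ` (L - (\<Union>x\<in>S. A x))"
  have opN: "open N"
    unfolding N_def using finS opA cl by (intro open_Diff open_Int open_INT) auto
  have SA: "x \<in> A x" if "x \<in> S" for x using e0 by (simp add: A_def)
  have yN: "y \<in> N"
  proof -
    have "y \<notin> f ` (L - (\<Union>x\<in>S. A x))"
      using SA by (auto simp: L_def S_def)
    moreover have "y \<in> f ` A x" if "x \<in> S" for x
      using SA[OF that] that by (auto simp: S_def)
    ultimately show ?thesis using d by (auto simp: N_def)
  qed
  have NT: "N \<subseteq> T" using d by (auto simp: N_def)
  show "\<exists>N. y \<in> N \<and> openin (top_of_set T) N \<and>
        (\<exists>v. \<Union>v = V \<inter> f -` N \<and> (\<forall>u\<in>v. openin (top_of_set V) u) \<and> pairwise disjnt v \<and>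
        (\<forall>u\<in>v. \<exists>q. homeomorphism u N f q))"
  proof (intro exI conjI)
    show "y \<in> N" by fact
    show "openin (top_of_set T) N" using opN NT T by (simp add: openin_open_eq)
    let ?v = "(\<lambda>x. A x \<inter> f -` N) ` S"
    have opu: "open (A x \<inter> f -` N)" if "x \<in> S" for x
      using continuous_open_preimage [OF continuous_on_subset [OF contf AV[OF that]] _ opN]
      by (simp add: A_def)
    show "\<Union>?v = V \<inter> f -` N"
      using AV by (auto simp: N_def L_def)
    show "\<forall>u\<in>?v. openin (top_of_set V) u"
      using opu AV V by (auto simp: openin_open_eq)
    show "pairwise disjnt ?v"
    proof (rule pairwise_imageI)
      fix x z assume xz: "x \<in> S" "z \<in> S" "x \<noteq> z"
      have "A x \<inter> A z = {}"
        unfolding A_def by (rule disjoint_ballI) (use ed[OF xz] in auto)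
      then show "disjnt (A x \<inter> f -` N) (A z \<inter> f -` N)" by (auto simp: disjnt_def)
    qed
    show "\<forall>u\<in>?v. \<exists>q. homeomorphism u N f q"
    proof clarify
      fix x assume x: "x \<in> S"
      have "f ` (A x \<inter> f -` N) = N"
      proof -
        have "N \<subseteq> f ` A x" using x by (auto simp: N_def)
        then show ?thesis by blast
      qed
      then show "\<exists>q. homeomorphism (A x \<inter> f -` N) N f q"
        using invariance_of_domain_homeomorphism [OF opu[OF x], of f]
              inj_on_subset [OF Ainj[OF x], of "A x \<inter> f -` N"]
              continuous_on_subset [OF contf, of "A x \<inter> f -` N"] AV[OF x]
        by (metis Int_lower1 order.refl order.trans)
    qed
  qed
qed

text \<open>\<open>normal_family\<close> tests arbitrary index sequences \<open>k\<close>, not only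
  increasing ones. Either some value is taken infinitely often, or every value finitely often, and
  then \<open>k\<close> tends to infinity.\<close>

lemma nat_seq_const_or_filterlim:
  fixes k :: "nat \<Rightarrow> nat"
  obtains r :: "nat \<Rightarrow> nat" and c where "strict_mono r" "\<And>j. k (r j) = c"
  | r :: "nat \<Rightarrow> nat" where "strict_mono r" "filterlim (\<lambda>j. k (r j)) at_top sequentially"
proof (cases "\<exists>c. infinite {j. k j = c}")
  case True
  then obtain c where c: "infinite {j. k j = c}" by auto
  then show ?thesis
    using infinite_enumerate[OF c] that(1) by blast
next
  case False
  have "filterlim k at_top sequentially"
  proof (subst filterlim_at_top, rule allI)
    fix Z
    have "{j. \<not> Z \<le> k j} \<subseteq> (\<Union>c<Z. {j. k j = c})" by auto
    moreover have "finite (\<Union>c<Z. {j. k j = c})" using False by auto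
    ultimately have "finite {j. \<not> Z \<le> k j}" using finite_subset by blast
    then show "eventually (\<lambda>j. Z \<le> k j) sequentially"
      by (simp add: eventually_cofinite flip: cofinite_eq_sequentially)
  qed
  then show ?thesis using that(2)[of id] by (auto simp: strict_mono_def)
qed

text \<open>This is how normality of the shifted map is obtained, both on the basins and on the
  primary component: its iterates tend to infinity locally uniformly there.\<close>

lemma normal_family_tends_infinity:
  assumes "\<And>K B. compact K \<Longrightarrow> K \<subseteq> U \<Longrightarrow> \<forall>\<^sub>F n in sequentially. \<forall>w\<in>K. B \<le> norm (F n w)"
  shows "normal_family U F"
  unfolding normal_family_def
proof
  fix k :: "nat \<Rightarrow> nat"
  show "\<exists>r. strict_mono r \<and>
          ((\<exists>g. \<forall>K. compact K \<and> K \<subseteq> U \<longrightarrow> uniform_limit K (\<lambda>j. F (k (r j))) g sequentially) \<or>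
           (\<forall>K. compact K \<and> K \<subseteq> U \<longrightarrow> (\<forall>B. \<forall>\<^sub>F j in sequentially. \<forall>w\<in>K. B \<le> cmod (F (k (r j)) w))))"
  proof (rule nat_seq_const_or_filterlim [of k])
    fix r :: "nat \<Rightarrow> nat" and c assume "strict_mono r" "\<And>j. k (r j) = c"
    then show ?thesis
      by (intro exI[of _ r] conjI disjI1 exI[of _ "F c"]) (auto intro: uniform_limit_const)
  next
    fix r :: "nat \<Rightarrow> nat"
    assume r: "strict_mono r" "filterlim (\<lambda>j. k (r j)) at_top sequentially"
    show ?thesis
    proof (intro exI[of _ r] conjI disjI2 allI impI)
      show "strict_mono r" by (fact r)
      fix K and B :: real assume "compact K \<and> K \<subseteq> U"
      then have "\<forall>\<^sub>F n in sequentially. \<forall>w\<in>K. B \<le> norm (F n w)" using assms by auto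
      then show "\<forall>\<^sub>F j in sequentially. \<forall>w\<in>K. B \<le> norm (F (k (r j)) w)"
        using r(2) by (rule eventually_compose_filterlim)
    qed
  qed
qed

section \<open>The tangent family as a covering\<close>

text \<open>The intersection with \<open>tan_domain\<close> discards the poles, where
  \<open>tan\<close> has the default value 0 and \<open>ftan l z\<close> would be
  \<open>l + z\<close>.\<close>

definition tan_preimage :: "complex \<Rightarrow> complex set \<Rightarrow> complex set" where
  "tan_preimage l T = {z \<in> tan_domain. ftan l z \<in> T}"

section \<open>Elementary identities and estimates for the complex tangent\<close>

lemma open_tan_domain: "open tan_domain"
  unfolding tan_domain_def by (intro open_Collect_neq continuous_intros)

lemma tan_domain_if_Im_nonzero: "Im z \<noteq> 0 \<Longrightarrow> z \<in> tan_domain"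
proof -
  assume a: "Im z \<noteq> 0"
  have "exp (Im z) \<noteq> inverse (exp (Im z))"
    using a by (simp flip: exp_minus)
  then have "(exp (Im z) - inverse (exp (Im z)))\<^sup>2 / 4 > 0" by simp
  then have "norm (cos z) ^ 2 > 0"
    unfolding norm_cos_squared by (simp add: add_nonneg_pos)
  then show ?thesis by (auto simp: tan_domain_def)
qed

lemma cos_add_int_pi: "cos (z + of_int k * of_real pi) = cos z * cos (of_int k * of_real pi :: complex)"
  and sin_add_int_pi: "sin (z + of_int k * of_real pi) = sin z * cos (of_int k * of_real pi :: complex)"
  and cos_int_pi_nonzero: "cos (of_int k * of_real pi :: complex) \<noteq> 0"
proof -
  have s: "sin (of_int k * of_real pi :: complex) = 0"
    by (auto simp: sin_eq_0)
  show "cos (z + of_int k * of_real pi) = cos z * cos (of_int k * of_real pi :: complex)"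
    "sin (z + of_int k * of_real pi) = sin z * cos (of_int k * of_real pi :: complex)"
    by (simp_all add: cos_add sin_add s)
  show "cos (of_int k * of_real pi :: complex) \<noteq> 0"
    using sin_cos_squared_add [of "of_int k * of_real pi :: complex"] s by auto
qed

lemma tan_add_int_pi: "tan (z + of_int k * of_real pi :: complex) = tan z"
  by (simp add: tan_def cos_add_int_pi sin_add_int_pi cos_int_pi_nonzero)

lemma tan_domain_add_int_pi: "z + of_int k * of_real pi \<in> tan_domain \<longleftrightarrow> z \<in> tan_domain"
  by (simp add: tan_domain_def cos_add_int_pi cos_int_pi_nonzero)

lemma ftan_add_int_pi: "ftan l (z + of_int k * of_real pi) = ftan l z + of_int k * of_real pi"
  by (simp add: ftan_def tan_add_int_pi)

lemma ftan_param_add: "ftan (l + a) z = ftan l z + a"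
  by (simp add: ftan_def)

text \<open>Extend the fraction by \<open>cnj (cos z)\<close>; the numerator collapses by
  \<open>sin^2 + cos^2 = 1\<close>. What matters later is the sign: \<open>tan\<close> preserves the
  closed upper and the closed lower half-plane.\<close>

lemma Im_tan: "Im (tan z) = sinh (Im z) * cosh (Im z) / (cmod (cos z))\<^sup>2"
proof -
  have alg: "c * (E - G) / 2 * (c * (E + G) / 2) - s * (E + G) / 2 * - (s * (E - G) / 2)
      = (E - G) / 2 * ((E + G) / 2) * (c\<^sup>2 + s\<^sup>2)" for c s E G :: real
    by (simp add: field_simps power2_eq_square)
  have "Im (sin z * cnj (cos z)) =
      cos (Re z) * (exp (Im z) - exp (- Im z)) / 2 * (cos (Re z) * (exp (Im z) + exp (- Im z)) / 2)
      - sin (Re z) * (exp (Im z) + exp (- Im z)) / 2 * - (sin (Re z) * (exp (Im z) - exp (- Im z)) / 2)"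
    by (simp add: Im_sin Re_sin Im_cos Re_cos field_simps)
  then have "Im (sin z * cnj (cos z)) = sinh (Im z) * cosh (Im z)"
    unfolding alg by (simp add: sinh_field_def cosh_field_def)
  moreover have "Im (tan z) = Im (sin z * cnj (cos z)) / (cmod (cos z))\<^sup>2"
    unfolding tan_def complex_div_cnj [of "sin z"] by (metis Im_divide_of_real of_real_power)
  ultimately show ?thesis by simp
qed

lemma norm_sin_squared_sinh: "(cmod (sin z))\<^sup>2 = (sin (Re z))\<^sup>2 + (sinh (Im z))\<^sup>2"
  and norm_cos_squared_sinh: "(cmod (cos z))\<^sup>2 = (cos (Re z))\<^sup>2 + (sinh (Im z))\<^sup>2"
proof -
  have e: "(exp (Im z) - inverse (exp (Im z)))\<^sup>2 / 4 = (sinh (Im z))\<^sup>2"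
    by (simp add: sinh_field_def power_divide exp_minus)
  show "(cmod (cos z))\<^sup>2 = (cos (Re z))\<^sup>2 + (sinh (Im z))\<^sup>2"
    by (simp add: norm_cos_squared e)
  have "(exp (Im z) - inverse (exp (Im z)))\<^sup>2 = exp (2 * Im z) + inverse (exp (2 * Im z)) - 2"
  proof -
    have alg: "(E - inverse E)\<^sup>2 = E * E + inverse (E * E) - 2" if "E \<noteq> 0" for E :: real
      using that by (simp add: power2_eq_square field_simps)
    have e2: "exp (2 * Im z) = exp (Im z) * exp (Im z)" unfolding mult_2 exp_add ..
    show ?thesis unfolding e2 by (rule alg) simp
  qed
  then show "(cmod (sin z))\<^sup>2 = (sin (Re z))\<^sup>2 + (sinh (Im z))\<^sup>2"
    unfolding norm_sin_squared e[symmetric] cos_double_sin by (simp add: field_simps)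
qed

lemma Im_tan_nonneg: "0 \<le> Im z \<Longrightarrow> 0 \<le> Im (tan z)"
  and Im_tan_nonpos: "Im z \<le> 0 \<Longrightarrow> Im (tan z) \<le> 0"
  by (simp_all add: Im_tan mult_nonpos_nonneg divide_nonpos_nonneg)

lemma norm_tan_squared_le: "Im z \<noteq> 0 \<Longrightarrow> (cmod (tan z))\<^sup>2 \<le> 1 + 1 / (sinh (Im z))\<^sup>2"
proof -
  assume a: "Im z \<noteq> 0"
  define s where "s = (sinh (Im z))\<^sup>2"
  have s: "s > 0" unfolding s_def zero_less_power2 sinh_real_zero_iff by (rule a)
  have "(cmod (tan z))\<^sup>2 = ((sin (Re z))\<^sup>2 + s) / ((cos (Re z))\<^sup>2 + s)"
    unfolding tan_def norm_divide power_divide norm_sin_squared_sinh norm_cos_squared_sinh s_def ..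
  also have "\<dots> \<le> (1 + s) / s"
  proof (rule frac_le)
    have "(sin (Re z))\<^sup>2 \<le> 1" by (simp add: abs_square_le_1)
    then show "(sin (Re z))\<^sup>2 + s \<le> 1 + s" by linarith
  qed (use s in auto)
  also have "\<dots> = 1 + 1 / s" using s by (simp add: field_simps)
  finally show ?thesis unfolding s_def .
qed

lemma norm_tan_le_2: "1 \<le> \<bar>Im z\<bar> \<Longrightarrow> cmod (tan z) \<le> 2"
proof -
  assume a: "1 \<le> \<bar>Im z\<bar>"
  \<comment> \<open>\<open>exp y >= 2\<close> gives \<open>sinh y >= (2 - 1/2) / 2\<close>. With
    \<open>9/16\<close> below the square, the reciprocal is at most 3, and
    \<open>1 + 3 = 2^2\<close>.\<close>
  have sinh_ge: "3/4 \<le> sinh y" if y: "y \<ge> 1" for y :: real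
  proof -
    have e1: "2 \<le> exp y" using exp_ge_add_one_self[of y] y by linarith
    then have e2: "exp (- y) \<le> 1 / 2"
      unfolding exp_minus inverse_eq_divide by (intro divide_left_mono) auto
    have alg: "3/4 \<le> (E - G) / 2" if "2 \<le> E" "G \<le> 1/2" for E G :: real
      using that by simp
    show ?thesis unfolding sinh_field_def by (rule alg [OF e1 e2])
  qed
  have "3/4 \<le> \<bar>sinh (Im z)\<bar>"
    using sinh_ge[of "\<bar>Im z\<bar>"] a by (simp only: sinh_real_abs)
  then have s: "9/16 \<le> (sinh (Im z))\<^sup>2"
  proof -
    assume h: "3/4 \<le> \<bar>sinh (Im z)\<bar>"
    have "(3/4)\<^sup>2 \<le> \<bar>sinh (Im z)\<bar>\<^sup>2" by (rule power_mono [OF h]) simp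
    moreover have "(3/4)\<^sup>2 = (9/16 :: real)" by (simp add: power2_eq_square)
    ultimately show ?thesis by (simp only: power2_abs)
  qed
  have alg: "1 / t \<le> 3" if "9/16 \<le> t" for t :: real
    using that by (simp add: field_simps)
  have "Im z \<noteq> 0" using a by auto
  from norm_tan_squared_le[OF this] alg[OF s] have "(cmod (tan z))\<^sup>2 \<le> 2\<^sup>2"
    unfolding power2_eq_square[of 2] by linarith
  then show ?thesis by (rule power2_le_imp_le) simp
qed

lemma norm_tan_le_1_on_lines: "Re z = of_int k * pi \<Longrightarrow> cmod (tan z) \<le> 1"
proof -
  assume a: "Re z = of_int k * pi"
  have s: "sin (Re z) = 0" using a by (auto simp: sin_zero_iff_int2)
  then have c: "(cos (Re z))\<^sup>2 = 1" by (simp add: cos_squared_eq)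
  have "cmod (sin z) ^ 2 \<le> cmod (cos z) ^ 2"
    unfolding norm_sin_squared_sinh norm_cos_squared_sinh s c by simp
  then have "cmod (sin z) \<le> cmod (cos z)" by (simp add: power2_le_iff_abs_le)
  then show ?thesis by (simp add: tan_def norm_divide divide_le_eq_1)
qed

lemma tan_eq_imp_int_pi:
  assumes "z \<in> tan_domain" "w \<in> tan_domain" "tan z = tan w"
  obtains k :: int where "z = w + of_int k * of_real pi"
proof -
  have "sin (z - w) = 0"
    using assms by (simp add: tan_domain_def tan_def sin_diff field_simps)
  then obtain n :: int where "z - w = of_real (n * pi)" by (auto simp: sin_eq_0)
  then have "z = w + of_int n * of_real pi" by (simp add: algebra_simps)
  then show ?thesis using that by blast
qed

lemma has_field_derivative_tan_complex:
  "z \<in> tan_domain \<Longrightarrow> (tan has_field_derivative (1 + (tan z)\<^sup>2)) (at z)"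
proof -
  assume z: "z \<in> tan_domain"
  then have "1 + (tan z)\<^sup>2 = inverse ((cos z)\<^sup>2)"
    using sin_cos_squared_add[of z]
    by (simp add: tan_domain_def tan_def field_simps power2_eq_square)
  then show ?thesis using DERIV_tan[of z] z by (simp add: tan_domain_def)
qed

lemma has_field_derivative_ftan:
  "z \<in> tan_domain \<Longrightarrow> (ftan l has_field_derivative (2 + (tan z)\<^sup>2)) (at z)"
  unfolding ftan_def
  by (rule derivative_eq_intros has_field_derivative_tan_complex | simp)+

lemma deriv_ftan: "z \<in> tan_domain \<Longrightarrow> deriv (ftan l) z = 2 + (tan z)\<^sup>2"
  using has_field_derivative_ftan DERIV_imp_deriv by blast

lemma deriv_deriv_ftan: "z \<in> tan_domain \<Longrightarrow> deriv (deriv (ftan l)) z = 2 * tan z * (1 + (tan z)\<^sup>2)"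
proof -
  assume z: "z \<in> tan_domain"
  have "((\<lambda>z. 2 + (tan z)\<^sup>2) has_field_derivative 2 * tan z * (1 + (tan z)\<^sup>2)) (at z)"
    by (rule derivative_eq_intros has_field_derivative_tan_complex z | simp)+
  then have "(deriv (ftan l) has_field_derivative 2 * tan z * (1 + (tan z)\<^sup>2)) (at z)"
    by (rule has_field_derivative_transform_within_open [OF _ open_tan_domain z])
       (simp add: deriv_ftan)
  then show ?thesis using DERIV_imp_deriv by blast
qed

lemma holomorphic_ftan: "ftan l holomorphic_on tan_domain"
  using has_field_derivative_ftan holomorphic_on_open open_tan_domain by blast

lemma continuous_on_ftan: "continuous_on tan_domain (ftan l)"
  using holomorphic_ftan holomorphic_on_imp_continuous_on by blast

section \<open>Preimage components: properness, surjectivity, covering\<close>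

lemma tan_preimage_subset: "tan_preimage l T \<subseteq> tan_domain"
  by (auto simp: tan_preimage_def)

lemma open_tan_preimage: "open T \<Longrightarrow> open (tan_preimage l T)"
  using continuous_open_preimage [OF continuous_on_ftan open_tan_domain, of T]
  by (auto simp: tan_preimage_def Int_def vimage_def)

lemma tan_preimage_mono: "S \<subseteq> T \<Longrightarrow> tan_preimage l S \<subseteq> tan_preimage l T"
  by (auto simp: tan_preimage_def)

lemma norm_diff_diff_le: "norm (a - b - c) \<le> norm a + norm b + norm (c :: 'a :: real_normed_vector)"
  using norm_triangle_ineq4 [of "a - b" c] norm_triangle_ineq4 [of a b] by linarith

text \<open>If the limit were a pole, \<open>cos (s n)\<close> would tend to 0 while
  \<open>tan (s n)\<close>, which is \<open>ftan l (s n) - l - s n\<close>, stays bounded; then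
  \<open>sin = tan * cos\<close> would tend to 0 as well.\<close>

lemma tan_domain_limit_bounded:
  assumes s: "s \<longlonglongrightarrow> z" "\<And>n::nat. s n \<in> tan_domain" "\<And>n. cmod (ftan l (s n)) \<le> R"
  shows "z \<in> tan_domain"
proof (rule ccontr)
  assume "z \<notin> tan_domain"
  then have c: "cos z = 0" by (simp add: tan_domain_def)
  have "Bseq s" using s(1) convergent_def convergent_imp_Bseq by blast
  then obtain C where C: "\<And>n. cmod (s n) \<le> C" by (auto simp: Bseq_def)
  have bt: "cmod (tan (s n)) \<le> R + cmod l + C" for n
  proof -
    have "tan (s n) = ftan l (s n) - l - s n" by (simp add: ftan_def)
    then have "cmod (tan (s n)) \<le> cmod (ftan l (s n)) + cmod l + cmod (s n)"
      by (metis norm_diff_diff_le)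
    then show ?thesis using s(3)[of n] C[of n] by linarith
  qed
  have "(\<lambda>n. cos (s n)) \<longlonglongrightarrow> 0" using tendsto_cos[OF s(1)] c by simp
  moreover have "Bseq (\<lambda>n. tan (s n))" using bt by (rule BseqI')
  ultimately have "(\<lambda>n. tan (s n) * cos (s n)) \<longlonglongrightarrow> 0"
    using bounded_bilinear.Bfun_prod_Zfun [OF bounded_bilinear_mult]
    by (simp add: tendsto_Zfun_iff)
  moreover have "tan (s n) * cos (s n) = sin (s n)" for n
    using s(2)[of n] by (simp add: tan_def tan_domain_def)
  ultimately have "sin z = 0"
    using tendsto_sin[OF s(1)] LIMSEQ_unique by auto
  then show False using c sin_cos_squared_add[of z] by simp
qed

text \<open>On the lines \<open>Re z = k * pi\<close> the tangent is bounded, so points there with bounded image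
  are bounded; hence a connected set with bounded image cannot cross such lines far out.\<close>
lemma bounded_if_ftan_bounded:
  assumes X: "connected X" and b: "bounded (ftan l ` X)"
  shows "bounded X"
proof (cases "X = {}")
  case False
  then obtain x0 where x0: "x0 \<in> X" by auto
  obtain R where R: "\<And>z. z \<in> X \<Longrightarrow> cmod (ftan l z) \<le> R"
    using b by (auto simp: bounded_iff)
  have zz: "cmod z \<le> R + cmod l + t" if "z \<in> X" "cmod (tan z) \<le> t" for z t
  proof -
    have "z = ftan l z - l - tan z" by (simp add: ftan_def)
    then have "cmod z \<le> cmod (ftan l z) + cmod l + cmod (tan z)"
      by (metis norm_diff_diff_le)
    then show ?thesis using R[of z] that by linarith
  qed
  \<comment> \<open>\<open>N\<close> puts the lines \<open>Re z = N * pi\<close> and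
    \<open>Re z = - N * pi\<close> beyond \<open>Re x0\<close> and beyond the bound for points of
    \<open>X\<close> on such lines, so that the connected set \<open>X\<close> is trapped between
    them.\<close>
  define N where "N = nat \<lceil>R + cmod l + 1 + \<bar>Re x0\<bar>\<rceil> + 1"
  have "real N > R + cmod l + 1 + \<bar>Re x0\<bar>" unfolding N_def by linarith
  moreover have "real N \<le> real N * pi" using pi_gt3 by (simp add: mult_le_cancel_left1)
  ultimately have N: "real N * pi > R + cmod l + 1" "real N * pi > \<bar>Re x0\<bar>"
    using zz[of x0 "cmod (tan x0)"] R[OF x0] norm_ge_zero[of "ftan l x0"] norm_ge_zero[of l] by linarith+
  have line: "Re z \<noteq> of_int k * pi" if "z \<in> X" "\<bar>k\<bar> = int N" for z k
  proof
    assume e: "Re z = of_int k * pi"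
    then have "cmod z \<le> R + cmod l + 1" using zz[OF that(1)] norm_tan_le_1_on_lines by blast
    moreover have "\<bar>Re z\<bar> = real N * pi"
    proof -
      have "\<bar>Re z\<bar> = of_int \<bar>k\<bar> * pi" using e by (simp add: abs_mult)
      then show ?thesis using that(2) by simp
    qed
    ultimately show False using N abs_Re_le_cmod[of z] by linarith
  qed
  have conn: "is_interval (Re ` X)"
    using X by (simp add: is_interval_connected_1 connected_continuous_image continuous_on_Re)
  have Re_bd: "\<bar>Re z\<bar> < real N * pi" if z: "z \<in> X" for z
  proof (rule ccontr)
    assume "\<not> ?thesis"
    then consider "Re z \<ge> real N * pi" | "Re z \<le> - (real N * pi)" by linarith
    then show False
    proof cases
      case 1
      then have "real N * pi \<in> Re ` X"
        using conn N(2) x0 z unfolding is_interval_1 by (smt (verit, ccfv_threshold) image_eqI)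
      then obtain w where "w \<in> X" "Re w = real N * pi" by (metis imageE)
      then show False using line[of w "int N"] by simp
    next
      case 2
      then have "- (real N * pi) \<in> Re ` X"
        using conn N(2) x0 z unfolding is_interval_1
        by (smt (verit, ccfv_threshold) image_eqI)
      then obtain w where "w \<in> X" "Re w = - (real N * pi)" by (metis imageE)
      then show False using line[of w "- int N"] by simp
    qed
  qed
  have "cmod z \<le> R + cmod l + 3 + real N * pi" if z: "z \<in> X" for z
  proof (cases "1 \<le> \<bar>Im z\<bar>")
    case True
    then show ?thesis using zz[OF z norm_tan_le_2] by (simp add: add_increasing2)
  next
    case False
    then have "cmod z \<le> real N * pi + 1" using cmod_le[of z] Re_bd[OF z] by linarith
    moreover have "R \<ge> 0" using R[OF z] norm_ge_zero[of "ftan l z"] by linarith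
    ultimately show ?thesis using norm_ge_zero[of l] by linarith
  qed
  then show ?thesis by (auto simp: bounded_iff)
qed auto

text \<open>The bound \<open>R\<close> keeps the limit away from the poles, and a component is
  relatively closed in the preimage. The hypothesis \<open>lim\<close> asks only that possible limit
  values lie in \<open>T\<close>.\<close>

lemma component_tan_preimage_limit:
  assumes V: "V \<in> components (tan_preimage l T)" and s: "s \<longlonglongrightarrow> z" "\<And>n::nat. s n \<in> V"
    and Fz: "\<And>n. cmod (ftan l (s n)) \<le> R"
    and lim: "\<And>w. (\<lambda>n. ftan l (s n)) \<longlonglongrightarrow> w \<Longrightarrow> w \<in> T"
  shows "z \<in> V"
proof -
  have sub: "V \<subseteq> tan_preimage l T" using V in_components_subset by blast
  have dom: "s n \<in> tan_domain" for n using s(2) sub tan_preimage_subset by blast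
  have z: "z \<in> tan_domain" using tan_domain_limit_bounded[OF s(1) dom Fz] .
  then have "(\<lambda>n. ftan l (s n)) \<longlonglongrightarrow> ftan l z"
    using s(1) continuous_on_ftan open_tan_domain continuous_on_eq_continuous_at isCont_tendsto_compose by blast
  then have zp: "z \<in> tan_preimage l T" using lim z by (auto simp: tan_preimage_def)
  obtain C where C: "closed C" "V = tan_preimage l T \<inter> C"
    using closedin_component[OF V] by (auto simp: closedin_closed)
  have "z \<in> C" using closed_sequentially[OF C(1)] s C(2) by blast
  then show ?thesis using zp C(2) by blast
qed

text \<open>A component over a bounded set is itself bounded, so a sequence in it with values in a
  compact set cannot run off to infinity. This is the precise form of having no finite asymptotic
  values.\<close>

lemma proper_ftan_component:
  assumes T: "bounded T" and V: "V \<in> components (tan_preimage l T)"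
  shows "proper_cmap (ftan l) V T"
  unfolding proper_cmap_def
proof (intro conjI allI impI)
  have sub: "V \<subseteq> tan_preimage l T" using V in_components_subset by blast
  then show im: "ftan l ` V \<subseteq> T" by (auto simp: tan_preimage_def)
  have bV: "bounded V"
    using bounded_if_ftan_bounded[OF in_components_connected[OF V]] bounded_subset[OF T im] by blast
  fix K assume K: "compact K \<and> K \<subseteq> T"
  have "closed {z \<in> V. ftan l z \<in> K}"
    unfolding closed_sequential_limits
  proof (intro allI impI)
    fix s z assume s: "(\<forall>n. s n \<in> {z \<in> V. ftan l z \<in> K}) \<and> s \<longlonglongrightarrow> z"
    obtain R where R: "\<And>w. w \<in> K \<Longrightarrow> cmod w \<le> R"
      using K compact_imp_bounded bounded_iff by metis
    have lim: "w \<in> K" if "(\<lambda>n. ftan l (s n)) \<longlonglongrightarrow> w" for w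
      using K s that closed_sequentially[OF compact_imp_closed] by (metis (mono_tags, lifting) mem_Collect_eq)
    have zV: "z \<in> V"
      by (rule component_tan_preimage_limit[OF V]) (use s R lim K in auto)
    then have "z \<in> tan_domain" using sub tan_preimage_subset by blast
    then have "(\<lambda>n. ftan l (s n)) \<longlonglongrightarrow> ftan l z"
      using s continuous_on_ftan open_tan_domain continuous_on_eq_continuous_at isCont_tendsto_compose by blast
    then show "z \<in> {z \<in> V. ftan l z \<in> K}" using lim zV by auto
  qed
  moreover have "bounded {z \<in> V. ftan l z \<in> K}" by (rule bounded_subset[OF bV]) auto
  ultimately show "compact {z \<in> V. ftan l z \<in> K}" using compact_eq_bounded_closed by blast
qed

text \<open>Constancy near a point would give \<open>(tan z)^2 = - 2\<close> and also, from the
  second derivative, \<open>tan z * (1 + (tan z)^2) = 0\<close>, which are incompatible.\<close>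

lemma ftan_not_constant_on:
  assumes "open V" "V \<subseteq> tan_domain" "V \<noteq> {}"
  shows "\<not> ftan l constant_on V"
proof
  assume "ftan l constant_on V"
  then obtain c where c: "\<And>z. z \<in> V \<Longrightarrow> ftan l z = c" by (auto simp: constant_on_def)
  have d1: "2 + (tan z)\<^sup>2 = 0" if z: "z \<in> V" for z
  proof -
    have "deriv (ftan l) z = deriv (\<lambda>_. c) z"
      using c z assms(1) by (intro deriv_cong_ev) (auto intro!: eventually_nhds_in_open eventually_mono[OF eventually_nhds_in_open[of V z]])
    then show ?thesis using deriv_ftan z assms by auto
  qed
  obtain z where z: "z \<in> V" using assms by auto
  have "deriv (deriv (ftan l)) z = deriv (\<lambda>_. 0) z"
    using assms d1 z deriv_ftan
    by (intro deriv_cong_ev) (auto intro!: eventually_mono[OF eventually_nhds_in_open[of V z]])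
  then have "tan z * (1 + (tan z)\<^sup>2) = 0" using deriv_deriv_ftan z assms by auto
  then have "(tan z)\<^sup>2 = 0 \<or> 1 + (tan z)\<^sup>2 = 0" by simp
  then show False
  proof
    assume "1 + (tan z)\<^sup>2 = 0"
    moreover have "2 + (tan z)\<^sup>2 = (1 + (tan z)\<^sup>2) + 1" by simp
    ultimately show False using d1[OF z] by simp
  qed (use d1[OF z] in simp)
qed

lemma open_ftan_image: "open V \<Longrightarrow> V \<subseteq> tan_domain \<Longrightarrow> connected V \<Longrightarrow> open (ftan l ` V)"
  using ftan_not_constant_on
  by (metis holomorphic_ftan holomorphic_on_subset image_empty open_empty open_mapping_thm order_refl)

text \<open>For bounded \<open>T\<close> the image is open, and closed in \<open>T\<close> by
  properness. For general \<open>T\<close> the bounded case is applied to a small disc about a limit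
  point \<open>x\<close> of the image: a component over that disc meets \<open>V\<close>, hence lies
  in \<open>V\<close>, and already covers \<open>x\<close>.\<close>

lemma ftan_component_onto:
  assumes T: "open T" "connected T" and V: "V \<in> components (tan_preimage l T)"
  shows "ftan l ` V = T"
proof -
  have onto_bounded: "ftan l ` V = T" if T: "open T" "connected T" "bounded T"
    and V: "V \<in> components (tan_preimage l T)" for T V
  proof (rule GPicard2)
    have sub: "V \<subseteq> tan_preimage l T" using V in_components_subset by blast
    have opV: "open V" using open_components[OF open_tan_preimage[OF T(1)] V] .
    show "ftan l ` V \<subseteq> T" using sub by (auto simp: tan_preimage_def)
    show "connected T" by fact
    show "ftan l ` V \<noteq> {}" using in_components_nonempty[OF V] by auto
    show "open (ftan l ` V)"
      using open_ftan_image opV sub tan_preimage_subset in_components_connected[OF V] by blast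
    fix x assume x: "x islimpt ftan l ` V" "x \<in> T"
    obtain d where d: "d > 0" "cball x d \<subseteq> T" using T(1) x(2) open_contains_cball by blast
    define L where "L = {z \<in> V. ftan l z \<in> cball x d}"
    have "compact L"
      using proper_ftan_component[OF T(3) V] d(2) unfolding proper_cmap_def L_def
      by (metis compact_cball)
    moreover have "L \<subseteq> tan_domain" using sub tan_preimage_subset by (auto simp: L_def)
    ultimately have "closed (ftan l ` L)"
      by (metis compact_continuous_image compact_imp_closed continuous_on_ftan continuous_on_subset)
    moreover have "x \<in> closure (ftan l ` L)"
      unfolding closure_approachable
    proof (intro allI impI)
      fix e :: real assume "e > 0"
      then obtain y where "y \<in> ftan l ` V" "dist y x < min e d"
        using x(1) d(1) unfolding islimpt_approachable by (metis min_less_iff_conj)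
      then show "\<exists>y\<in>ftan l ` L. dist y x < e" by (auto simp: L_def dist_commute)
    qed
    ultimately show "x \<in> ftan l ` V" by (auto simp: L_def)
  qed
  show ?thesis
  proof (rule GPicard2)
    have sub: "V \<subseteq> tan_preimage l T" using V in_components_subset by blast
    have opV: "open V" using open_components[OF open_tan_preimage[OF T(1)] V] .
    show "ftan l ` V \<subseteq> T" using sub by (auto simp: tan_preimage_def)
    show "connected T" by fact
    show "ftan l ` V \<noteq> {}" using in_components_nonempty[OF V] by auto
    show "open (ftan l ` V)"
      using open_ftan_image opV sub tan_preimage_subset in_components_connected[OF V] by blast
    fix x assume x: "x islimpt ftan l ` V" "x \<in> T"
    obtain d where d: "d > 0" "ball x d \<subseteq> T" using T(1) x(2) open_contains_ball by blast
    obtain z where z: "z \<in> V" "ftan l z \<in> ball x d"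
      using x(1) d(1) unfolding islimpt_approachable by (auto simp: dist_commute)
    define C where "C = connected_component_set (tan_preimage l (ball x d)) z"
    have zp: "z \<in> tan_preimage l (ball x d)" using z sub by (auto simp: tan_preimage_def)
    then have C: "C \<in> components (tan_preimage l (ball x d))" "z \<in> C"
      by (auto simp: C_def componentsI)
    have "ftan l ` C = ball x d" by (rule onto_bounded[OF _ _ _ C(1)]) auto
    then have xC: "x \<in> ftan l ` C" using d by simp
    have "C \<subseteq> tan_preimage l T"
      using C(1) tan_preimage_mono[OF d(2)] in_components_subset by blast
    then have "C \<subseteq> V"
      using components_maximal[OF V in_components_connected[OF C(1)]] C(2) z(1) by blast
    then show "x \<in> ftan l ` V" using xC by blast
  qed
qed

text \<open>The map has no finite asymptotic values, so only critical points obstruct the covering property.\<close>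
lemma ftan_covering_space:
  assumes D: "open D" and onto: "ftan l ` V = D"
    and sub: "V \<subseteq> tan_preimage l D"
    and sat: "\<And>C. connected C \<Longrightarrow> C \<subseteq> tan_preimage l D \<Longrightarrow> C \<inter> V \<noteq> {} \<Longrightarrow> C \<subseteq> V"
    and nz: "\<And>z. z \<in> V \<Longrightarrow> 2 + (tan z)\<^sup>2 \<noteq> 0"
  shows "covering_space V (ftan l) D"
proof
  have Vdom: "V \<subseteq> tan_domain" using sub tan_preimage_subset by blast
  show "continuous_on V (ftan l)" using continuous_on_ftan continuous_on_subset Vdom by blast
  show "ftan l ` V = D" by fact
  fix x assume x: "x \<in> D"
  obtain d where d: "d > 0" "ball x d \<subseteq> D" using D x open_contains_ball by blast
  \<comment> \<open>The sheets over a small disc are the components over it that meet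
    \<open>V\<close>. Each is mapped properly and without critical points onto the disc, hence
    injectively, since a disc is simply connected.\<close>
  define v where "v = {C \<in> components (tan_preimage l (ball x d)). C \<inter> V \<noteq> {}}"
  have CV: "C \<subseteq> V" if "C \<in> v" for C
    using that sat[of C] tan_preimage_mono[OF d(2)] in_components_subset in_components_connected
    unfolding v_def by blast
  have opC: "open C" if "C \<in> v" for C
    using that open_components[OF open_tan_preimage] by (auto simp: v_def)
  have inj: "inj_on (ftan l) C" if C: "C \<in> v" for C
  proof (rule covering_space_simply_connected_inj)
    have comp: "C \<in> components (tan_preimage l (ball x d))" using C by (auto simp: v_def)
    show "covering_space C (ftan l) (ball x d)"
    proof (rule proper_holomorphic_covering_space)
      show "ftan l holomorphic_on C" using holomorphic_ftan CV[OF C] Vdom holomorphic_on_subset by blast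
      show "deriv (ftan l) z \<noteq> 0" if "z \<in> C" for z
        using nz CV[OF C] Vdom that deriv_ftan by (metis subsetD)
      show "proper_cmap (ftan l) C (ball x d)" by (rule proper_ftan_component[OF _ comp]) auto
      show "ftan l ` C = ball x d" by (rule ftan_component_onto[OF _ _ comp]) auto
    qed (use opC[OF C] in auto)
    show "connected C" using comp in_components_connected by blast
    show "simply_connected (ball x d)" by (simp add: convex_imp_simply_connected)
  qed (use opC[OF C] in auto)
  show "\<exists>T. x \<in> T \<and> openin (top_of_set D) T \<and>
        (\<exists>v. \<Union>v = V \<inter> ftan l -` T \<and> (\<forall>u\<in>v. openin (top_of_set V) u) \<and> pairwise disjnt v \<and>
        (\<forall>u\<in>v. \<exists>q. homeomorphism u T (ftan l) q))"
  proof (intro exI conjI)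
    show "x \<in> ball x d" using d by simp
    show "openin (top_of_set D) (ball x d)" using d by (simp add: openin_open_eq D)
    show "\<Union>v = V \<inter> ftan l -` ball x d"
    proof
      show "\<Union>v \<subseteq> V \<inter> ftan l -` ball x d"
        using CV in_components_subset unfolding v_def tan_preimage_def by blast
      show "V \<inter> ftan l -` ball x d \<subseteq> \<Union>v"
      proof
        fix z assume z: "z \<in> V \<inter> ftan l -` ball x d"
        then have "z \<in> tan_preimage l (ball x d)" using Vdom by (auto simp: tan_preimage_def)
        then obtain C where "C \<in> components (tan_preimage l (ball x d))" "z \<in> C"
          by (metis UnionE Union_components)
        then show "z \<in> \<Union>v" using z by (auto simp: v_def)
      qed
    qed
    show "\<forall>u\<in>v. openin (top_of_set V) u"
    proof
      fix u assume "u \<in> v"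
      then show "openin (top_of_set V) u" using opC CV by (metis inf.absorb_iff2 openin_open_Int)
    qed
    show "pairwise disjnt v"
      using pairwise_disjoint_components[of "tan_preimage l (ball x d)"]
      by (auto simp: v_def pairwise_def disjnt_def)
    show "\<forall>u\<in>v. \<exists>q. homeomorphism u (ball x d) (ftan l) q"
    proof
      fix u assume u: "u \<in> v"
      have "ftan l ` u = ball x d"
        by (rule ftan_component_onto[of _ u]) (use u in \<open>auto simp: v_def\<close>)
      then show "\<exists>q. homeomorphism u (ball x d) (ftan l) q"
        using invariance_of_domain_homeomorphism[OF opC[OF u], of "ftan l"] inj[OF u]
          continuous_on_subset[OF continuous_on_ftan, of u] CV[OF u] Vdom
        by (metis order.refl order.trans)
    qed
  qed
qed

lemma ftan_inj_on_component:
  assumes D: "open D" "simply_connected D" and V: "V \<in> components (tan_preimage l D)"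
    and nz: "\<And>z. z \<in> V \<Longrightarrow> 2 + (tan z)\<^sup>2 \<noteq> 0"
  shows "inj_on (ftan l) V"
proof (rule covering_space_simply_connected_inj)
  have conD: "connected D" using D simply_connected_imp_connected by blast
  show "covering_space V (ftan l) D"
  proof (rule ftan_covering_space)
    show "ftan l ` V = D" using ftan_component_onto[OF D(1) conD V] .
    show "V \<subseteq> tan_preimage l D" using V in_components_subset by blast
    show "C \<subseteq> V" if "connected C" "C \<subseteq> tan_preimage l D" "C \<inter> V \<noteq> {}" for C
      using components_maximal[OF V that(1,2)] that(3) by blast
  qed (use D nz in auto)
  show "open V" using open_components[OF open_tan_preimage[OF D(1)] V] .
  show "connected V" using V in_components_connected by blast
qed (use D in auto)

section \<open>The completely invariant upper basin\<close>

lemma holomorphic_inverse_exists: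
  assumes "f holomorphic_on S" "open S" "inj_on f S"
  shows "\<exists>g. g holomorphic_on f ` S \<and> (\<forall>z\<in>S. deriv f z * deriv g (f z) = 1) \<and> (\<forall>z\<in>S. g (f z) = z)"
proof (rule holomorphic_has_inverse[OF assms])
  fix g
  assume "g holomorphic_on f ` S" "\<And>z. z \<in> S \<Longrightarrow> deriv f z * deriv g (f z) = 1"
    "\<And>z. z \<in> S \<Longrightarrow> g (f z) = z"
  then show ?thesis by (intro exI[of _ g]) simp
qed

section \<open>Iterated preimages and inverse branches\<close>

abbreviation tan_preimages :: "complex \<Rightarrow> nat \<Rightarrow> complex set \<Rightarrow> complex set" where
  "tan_preimages l n T \<equiv> (tan_preimage l ^^ n) T"

lemma mem_tan_preimages_iff:
  "z \<in> tan_preimages l n T \<longleftrightarrow> (\<forall>j<n. (ftan l ^^ j) z \<in> tan_domain) \<and> (ftan l ^^ n) z \<in> T"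
proof (induction n arbitrary: z)
  case (Suc n)
  have "z \<in> tan_preimages l (Suc n) T \<longleftrightarrow> z \<in> tan_domain \<and> ftan l z \<in> tan_preimages l n T"
    by (simp add: tan_preimage_def)
  also have "\<dots> \<longleftrightarrow> z \<in> tan_domain \<and> (\<forall>j<n. (ftan l ^^ Suc j) z \<in> tan_domain) \<and> (ftan l ^^ Suc n) z \<in> T"
    by (simp only: Suc.IH funpow_Suc_right o_apply)
  also have "\<dots> \<longleftrightarrow> (\<forall>j<Suc n. (ftan l ^^ j) z \<in> tan_domain) \<and> (ftan l ^^ Suc n) z \<in> T"
    by (subst All_less_Suc2) auto
  finally show ?case .
qed simp

lemma open_tan_preimages: "open T \<Longrightarrow> open (tan_preimages l n T)"
  by (induction n) (auto intro: open_tan_preimage)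

lemma funpow_ftan_add_int_pi:
  "(ftan l ^^ n) (z + of_int k * of_real pi) = (ftan l ^^ n) z + of_int k * of_real pi"
  by (induction n) (auto simp: ftan_add_int_pi)

lemma funpow_ftan_param_add_int_pi:
  "(ftan (l + of_int m * of_real pi) ^^ n) z = (ftan l ^^ n) z + of_int (int n * m) * of_real pi"
proof (induction n)
  case (Suc n)
  then show ?case
    by (simp add: ftan_param_add ftan_add_int_pi del: of_int_mult) (simp add: algebra_simps)
qed simp

text \<open>The poles are \<open>pi\<close>-periodic, so this set is the same for \<open>l\<close>
  and for \<open>l + m * pi\<close>. Statements about its interior thus pass between the original
  and the shifted map.\<close>

definition orbit_domain :: "complex \<Rightarrow> complex set" where
  "orbit_domain l = {z. \<forall>n. (ftan l ^^ n) z \<in> tan_domain}"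

lemma funpow_ftan_in_orbit_domain: "z \<in> orbit_domain l \<Longrightarrow> (ftan l ^^ n) z \<in> orbit_domain l"
proof -
  assume "z \<in> orbit_domain l"
  then have "(ftan l ^^ (k + n)) z \<in> tan_domain" for k by (simp add: orbit_domain_def)
  then show ?thesis by (simp add: orbit_domain_def funpow_add)
qed

lemma orbit_domain_subset: "orbit_domain l \<subseteq> tan_domain"
proof
  fix z assume "z \<in> orbit_domain l"
  then have "(ftan l ^^ 0) z \<in> tan_domain" unfolding orbit_domain_def by blast
  then show "z \<in> tan_domain" by simp
qed

lemma orbit_domain_step: "z \<in> tan_domain \<Longrightarrow> ftan l z \<in> orbit_domain l \<Longrightarrow> z \<in> orbit_domain l"
  unfolding orbit_domain_def
proof (intro CollectI allI)
  fix n assume "z \<in> tan_domain" "ftan l z \<in> {z. \<forall>n. (ftan l ^^ n) z \<in> tan_domain}"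
  then show "(ftan l ^^ n) z \<in> tan_domain"
    by (cases n) (auto simp: funpow_swap1)
qed

lemma holomorphic_funpow_ftan: "S \<subseteq> orbit_domain l \<Longrightarrow> (ftan l ^^ n) holomorphic_on S"
proof (induction n)
  case (Suc n)
  have "(ftan l ^^ n) ` S \<subseteq> tan_domain" using Suc.prems by (auto simp: orbit_domain_def)
  then have "ftan l \<circ> (ftan l ^^ n) holomorphic_on S"
    using Suc by (intro holomorphic_on_compose holomorphic_on_subset[OF holomorphic_ftan]) auto
  then show ?case by (simp only: funpow.simps(2))
qed (simp add: holomorphic_on_def field_differentiable_id)

lemma connected_component_set_disjoint_Un:
  assumes "open A" "open B" "A \<inter> B = {}" "z \<in> A"
  shows "connected_component_set (A \<union> B) z = connected_component_set A z"
proof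
  have c: "connected (connected_component_set (A \<union> B) z)" by simp
  have s: "connected_component_set (A \<union> B) z \<subseteq> A \<union> B" by (rule connected_component_subset)
  have z: "z \<in> connected_component_set (A \<union> B) z" using assms by simp
  have "connected_component_set (A \<union> B) z \<subseteq> A"
    using connectedD[OF c assms(1,2)] assms s z by blast
  then show "connected_component_set (A \<union> B) z \<subseteq> connected_component_set A z"
    by (rule connected_component_maximal[OF z c])
  show "connected_component_set A z \<subseteq> connected_component_set (A \<union> B) z"
    by (rule connected_component_mono) auto
qed

text \<open>Induction on \<open>n\<close> that peels off the first step of the orbit of
  \<open>p\<close>. Critical points are excluded only on connected sets through the orbit point, so
  that a caller may use either a connectedness argument (immediate basin) or mere membership in the
  preimage.\<close>

lemma inverse_branch:
  assumes D: "open D" "simply_connected D"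
    and "\<And>j. j < n \<Longrightarrow> (ftan l ^^ j) p \<in> tan_domain" "(ftan l ^^ n) p \<in> D"
    and "\<And>i C z. i < n \<Longrightarrow> connected C \<Longrightarrow> (ftan l ^^ i) p \<in> C \<Longrightarrow> C \<subseteq> tan_preimages l (n - i) D
          \<Longrightarrow> z \<in> C \<Longrightarrow> 2 + (tan z)\<^sup>2 \<noteq> 0"
  shows "\<exists>h. h holomorphic_on D \<and> h ((ftan l ^^ n) p) = p \<and>
    (\<forall>x\<in>D. h x \<in> tan_preimages l n D \<and> (ftan l ^^ n) (h x) = x)"
  using assms(3-)
proof (induction n arbitrary: p)
  case 0
  show ?case by (rule exI[of _ "\<lambda>x. x"]) auto
next
  case (Suc n)
  have dom: "(ftan l ^^ j) (ftan l p) \<in> tan_domain" if "j < n" for j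
    using Suc.prems(1)[of "Suc j"] that by (simp add: funpow_swap1)
  have end_D: "(ftan l ^^ n) (ftan l p) \<in> D"
    using Suc.prems(2) by (simp add: funpow_swap1)
  have nz: "2 + (tan z)\<^sup>2 \<noteq> 0" if "i < n" "connected C" "(ftan l ^^ i) (ftan l p) \<in> C"
    "C \<subseteq> tan_preimages l (n - i) D" "z \<in> C" for i C z
    using Suc.prems(3)[of "Suc i" C z] that by (simp add: funpow_swap1)
  have "\<exists>h. h holomorphic_on D \<and> h ((ftan l ^^ n) (ftan l p)) = ftan l p \<and>
      (\<forall>x\<in>D. h x \<in> tan_preimages l n D \<and> (ftan l ^^ n) (h x) = x)"
  proof (rule Suc.IH)
    fix i C z assume "i < n" "connected C" "(ftan l ^^ i) (ftan l p) \<in> C"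
      "C \<subseteq> tan_preimages l (n - i) D" "z \<in> C"
    then show "2 + (tan z)\<^sup>2 \<noteq> 0" by (rule nz)
  qed (use dom end_D in auto)
  then obtain h where h: "h holomorphic_on D" "h ((ftan l ^^ n) (ftan l p)) = ftan l p"
    "\<And>x. x \<in> D \<Longrightarrow> h x \<in> tan_preimages l n D" "\<And>x. x \<in> D \<Longrightarrow> (ftan l ^^ n) (h x) = x"
    by blast
  have conth: "continuous_on D h" using h(1) holomorphic_on_imp_continuous_on by blast
  have injh: "inj_on h D" using h(4) by (rule inj_on_inverseI)
  \<comment> \<open>The image of the branch for the remaining steps is homeomorphic to
    \<open>D\<close>, hence simply connected, so the covering argument applies to the component over
    \<open>E\<close> that contains \<open>p\<close>.\<close>
  define E where "E = h ` D"
  have opE: "open E" unfolding E_def using invariance_of_domain[OF conth D(1) injh] .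
  have scE: "simply_connected E"
    using homeomorphic_simply_connected[OF invariance_of_domain_homeomorphic[OF D(1) conth _ injh] D(2)]
    by (simp add: E_def)
  have pE: "ftan l p \<in> E" using h(2) end_D by (force simp: E_def)
  have p: "p \<in> tan_preimage l E" using pE Suc.prems(1)[of 0] by (simp add: tan_preimage_def)
  define V where "V = connected_component_set (tan_preimage l E) p"
  have V: "V \<in> components (tan_preimage l E)" "p \<in> V"
    using p by (auto simp: V_def componentsI)
  have opV: "open V" using open_components[OF open_tan_preimage[OF opE] V(1)] .
  have Vsub: "V \<subseteq> tan_preimage l E" using V in_components_subset by blast
  have Esub: "E \<subseteq> tan_preimages l n D" using h(3) by (auto simp: E_def)
  have Vsub': "V \<subseteq> tan_preimages l (Suc n) D"
  proof -
    have "tan_preimage l E \<subseteq> tan_preimage l (tan_preimages l n D)" by (rule tan_preimage_mono[OF Esub])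
    then show ?thesis using Vsub by (simp only: funpow.simps o_apply)
  qed
  have nzV: "2 + (tan z)\<^sup>2 \<noteq> 0" if "z \<in> V" for z
  proof (rule Suc.prems(3)[of 0 V])
    show "connected V" by (rule in_components_connected[OF V(1)])
    show "(ftan l ^^ 0) p \<in> V" using V(2) by simp
    show "V \<subseteq> tan_preimages l (Suc n - 0) D" using Vsub' by (simp only: diff_zero)
  qed (use that in auto)
  have inj: "inj_on (ftan l) V" by (rule ftan_inj_on_component[OF opE scE V(1) nzV])
  have onto: "ftan l ` V = E"
    using ftan_component_onto[OF opE _ V(1)] simply_connected_imp_connected[OF scE] by blast
  have holV: "ftan l holomorphic_on V"
    using holomorphic_ftan Vsub tan_preimage_subset holomorphic_on_subset by blast
  obtain g where g: "g holomorphic_on ftan l ` V" "\<forall>z\<in>V. deriv (ftan l) z * deriv g (ftan l z) = 1"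
    "\<forall>z\<in>V. g (ftan l z) = z"
    using holomorphic_inverse_exists[OF holV opV inj] by blast
  have gE: "g y \<in> V \<and> ftan l (g y) = y" if yE: "y \<in> E" for y
  proof -
    obtain z where "z \<in> V" "y = ftan l z" using yE onto by blast
    then show ?thesis using g(3) by simp
  qed
  have hE: "h x \<in> E" if "x \<in> D" for x using that by (simp add: E_def)
  show ?case
  proof (intro exI[of _ "g \<circ> h"] conjI ballI)
    show "g \<circ> h holomorphic_on D"
      using h(1) g(1) unfolding onto E_def by (rule holomorphic_on_compose)
    show "(g \<circ> h) ((ftan l ^^ Suc n) p) = p"
      using h(2) g(3) V(2) by (simp add: funpow_swap1)
    show "(g \<circ> h) x \<in> tan_preimages l (Suc n) D" if "x \<in> D" for x
      using Vsub' gE[OF hE[OF that]] unfolding o_apply by blast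
    show "(ftan l ^^ Suc n) ((g \<circ> h) x) = x" if "x \<in> D" for x
      using gE[OF hE[OF that]] h(4)[OF that] by (simp add: funpow_swap1)
  qed
qed

section \<open>Points whose orbit reaches the upper half-plane\<close>

definition upper_basin :: "complex \<Rightarrow> complex set" where
  "upper_basin l = (\<Union>n. tan_preimages l n {z. 0 < Im z})"

lemma open_upper_halfplane: "open {z. 0 < Im z}"
  by (intro open_Collect_less continuous_intros)

lemma open_upper_basin: "open (upper_basin l)"
  unfolding upper_basin_def by (intro open_UN ballI open_tan_preimages open_upper_halfplane)

lemma Im_ftan_ge: "0 \<le> Im z \<Longrightarrow> Im l + Im z \<le> Im (ftan l z)"
  using Im_tan_nonneg[of z] by (simp add: ftan_def)

lemma Im_ftan_le: "Im z \<le> 0 \<Longrightarrow> Im (ftan l z) \<le> Im l + Im z"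
  using Im_tan_nonpos[of z] by (simp add: ftan_def)

lemma Im_funpow_ftan_ge:
  assumes "0 < Im l" "0 \<le> Im z"
  shows "real n * Im l + Im z \<le> Im ((ftan l ^^ n) z)"
proof (induction n)
  case (Suc n)
  have "0 \<le> real n * Im l + Im z" using assms by simp
  then have "0 \<le> Im ((ftan l ^^ n) z)" using Suc by linarith
  then show ?case using Suc Im_ftan_ge[of "(ftan l ^^ n) z" l] by (simp add: algebra_simps)
qed simp

lemma upper_halfplane_subset_orbit_domain:
  assumes "0 < Im l" "0 < Im z" shows "z \<in> orbit_domain l"
proof -
  have "(ftan l ^^ n) z \<in> tan_domain" for n
  proof (rule tan_domain_if_Im_nonzero)
    have "0 < real n * Im l + Im z" using assms by (simp add: add_nonneg_pos)
    then show "Im ((ftan l ^^ n) z) \<noteq> 0" using Im_funpow_ftan_ge[of l z n] assms by linarith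
  qed
  then show ?thesis by (simp add: orbit_domain_def)
qed

lemma upper_basin_step:
  assumes "0 < Im l" "z \<in> tan_domain" shows "ftan l z \<in> upper_basin l \<longleftrightarrow> z \<in> upper_basin l"
proof
  assume "ftan l z \<in> upper_basin l"
  then obtain n where "ftan l z \<in> tan_preimages l n {z. 0 < Im z}" by (auto simp: upper_basin_def)
  then have "z \<in> tan_preimages l (Suc n) {z. 0 < Im z}" using assms by (simp add: tan_preimage_def)
  then show "z \<in> upper_basin l" unfolding upper_basin_def by blast
next
  assume "z \<in> upper_basin l"
  then obtain n where n: "z \<in> tan_preimages l n {z. 0 < Im z}" by (auto simp: upper_basin_def)
  show "ftan l z \<in> upper_basin l"
  proof (cases n)
    case 0
    then have "0 < Im (ftan l z)" using n Im_ftan_ge[of z l] assms by simp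
    then have "ftan l z \<in> tan_preimages l 0 {z. 0 < Im z}" by simp
    then show ?thesis unfolding upper_basin_def by blast
  next
    case (Suc k)
    then have "ftan l z \<in> tan_preimages l k {z. 0 < Im z}" using n by (simp add: tan_preimage_def)
    then show ?thesis unfolding upper_basin_def by blast
  qed
qed

lemma upper_halfplane_subset_upper_basin: "{z. 0 < Im z} \<subseteq> upper_basin l"
proof -
  have "tan_preimages l 0 {z. 0 < Im z} \<subseteq> upper_basin l" unfolding upper_basin_def by blast
  then show ?thesis by simp
qed

lemma upper_basin_subset_orbit_domain:
  assumes "0 < Im l" shows "upper_basin l \<subseteq> orbit_domain l"
proof -
  have "z \<in> orbit_domain l" if "z \<in> tan_preimages l n {z. 0 < Im z}" for n z
    using that
  proof (induction n arbitrary: z)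
    case 0
    then show ?case using assms upper_halfplane_subset_orbit_domain by auto
  next
    case (Suc n)
    then show ?case using orbit_domain_step by (auto simp: tan_preimage_def)
  qed
  then show ?thesis by (auto simp: upper_basin_def)
qed

lemma funpow_upper_basin:
  assumes l: "0 < Im l" and z: "z \<in> orbit_domain l"
  shows "(ftan l ^^ n) z \<in> upper_basin l \<longleftrightarrow> z \<in> upper_basin l"
proof (induction n)
  case (Suc n)
  have "(ftan l ^^ n) z \<in> tan_domain" using z by (simp add: orbit_domain_def)
  from upper_basin_step[OF l this] Suc show ?case by simp
qed simp

lemma upper_basin_Im_at_top:
  assumes l: "0 < Im l" and z: "z \<in> upper_basin l"
  shows "filterlim (\<lambda>n. Im ((ftan l ^^ n) z)) at_top sequentially"
proof -
  obtain n where "0 < Im ((ftan l ^^ n) z)"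
    using z by (auto simp: upper_basin_def mem_tan_preimages_iff)
  then have ge: "real k * Im l \<le> Im ((ftan l ^^ (k + n)) z)" for k
    using Im_funpow_ftan_ge[OF l, of "(ftan l ^^ n) z" k] by (simp add: funpow_add)
  have lim: "filterlim (\<lambda>k. - (real n * Im l) + real k * Im l) at_top sequentially"
    by (intro filterlim_tendsto_add_at_top[OF tendsto_const]
        filterlim_at_top_mult_tendsto_pos[OF tendsto_const l filterlim_real_sequentially])
  have "- (real n * Im l) + real k * Im l \<le> Im ((ftan l ^^ k) z)" if "k \<ge> n" for k
    using ge[of "k - n"] that by (simp add: of_nat_diff algebra_simps)
  then show ?thesis
    by (intro filterlim_at_top_mono[OF lim] eventually_sequentiallyI[of n])
qed

lemma closed_upper_halfplane_minus_poles_connected: "connected ({z. 0 \<le> Im z} \<inter> tan_domain)"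
proof (rule connected_intermediate_closure)
  have "convex {z. 0 < Im z}" by (rule convex_halfspace_Im_gt)
  then show "connected {z. 0 < Im z}" by (rule convex_connected)
  show "{z. 0 < Im z} \<subseteq> {z. 0 \<le> Im z} \<inter> tan_domain"
    using tan_domain_if_Im_nonzero by force
  show "{z. 0 \<le> Im z} \<inter> tan_domain \<subseteq> closure {z. 0 < Im z}"
    using closure_halfspace_gt[of "\<i>" 0] by (auto simp: inner_complex_def)
qed

text \<open>A component of the preimage of \<open>T\<close> maps onto \<open>T\<close>, hence attains values with large imaginary
  part, which is impossible inside the lower half-plane.\<close>
lemma connected_tan_preimage_upper:
  assumes l: "0 < Im l" and T: "open T" "connected T" "{z. 0 < Im z} \<subseteq> T"
  shows "connected (tan_preimage l T)"
proof -
  let ?H = "{z. 0 \<le> Im z} \<inter> tan_domain"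
  have Hsub: "?H \<subseteq> tan_preimage l T"
  proof
    fix z assume "z \<in> ?H"
    then have "z \<in> tan_domain" "0 < Im (ftan l z)" using Im_ftan_ge[of z l] l by auto
    then show "z \<in> tan_preimage l T" using T(3) by (auto simp: tan_preimage_def)
  qed
  have "\<i> \<in> ?H" using tan_domain_if_Im_nonzero[of \<i>] by simp
  have "?H \<subseteq> C" if C: "C \<in> components (tan_preimage l T)" for C
  proof -
    have "of_real (Im l + 1) * \<i> \<in> T" using T(3) l by auto
    then obtain z where z: "z \<in> C" "ftan l z = of_real (Im l + 1) * \<i>"
      using ftan_component_onto[OF T(1,2) C] by (metis imageE)
    then have "0 \<le> Im z" using Im_ftan_le[of z l] by fastforce
    then have "C \<inter> ?H \<noteq> {}" using z C in_components_subset tan_preimage_subset by blast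
    then show ?thesis
      using components_maximal[OF C closed_upper_halfplane_minus_poles_connected Hsub] by blast
  qed
  then have "C = C'" if "C \<in> components (tan_preimage l T)" "C' \<in> components (tan_preimage l T)" for C C'
    using that \<open>\<i> \<in> ?H\<close> components_nonoverlap by blast
  then show ?thesis
    by (metis Hsub \<open>\<i> \<in> ?H\<close> connected_eq_connected_components_eq)
qed

text \<open>By induction every iterated preimage is connected and contains the upper half-plane, so
  all of them share the point \<open>\<i>\<close>.\<close>

lemma connected_upper_basin:
  assumes l: "0 < Im l" shows "connected (upper_basin l)"
proof -
  have "connected (tan_preimages l n {z. 0 < Im z}) \<and> {z. 0 < Im z} \<subseteq> tan_preimages l n {z. 0 < Im z}" for n
  proof (induction n)
    case 0
    have "convex {z. 0 < Im z}" by (rule convex_halfspace_Im_gt)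
    then show ?case by (simp add: convex_connected)
  next
    case (Suc n)
    have "{z. 0 < Im z} \<subseteq> tan_preimage l {z. 0 < Im z}"
    proof
      fix z assume z: "z \<in> {z. 0 < Im z}"
      then show "z \<in> tan_preimage l {z. 0 < Im z}"
        using Im_ftan_ge[of z l] l tan_domain_if_Im_nonzero[of z] by (auto simp: tan_preimage_def)
    qed
    then show ?case
      using connected_tan_preimage_upper[OF l open_tan_preimages[OF open_upper_halfplane]] Suc
        tan_preimage_mono by (simp) blast
  qed
  moreover have "\<i> \<in> {z. 0 < Im z}" by simp
  ultimately show ?thesis
    unfolding upper_basin_def by (intro connected_Union) blast+
qed

lemma pole_in_closure_upper_basin: "z \<notin> tan_domain \<Longrightarrow> z \<in> closure (upper_basin l)"
proof -
  assume "z \<notin> tan_domain"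
  then have "Im z = 0" using tan_domain_if_Im_nonzero by blast
  then have "z \<in> closure {z. 0 < Im z}"
    using closure_halfspace_gt[of "\<i>" 0] by (auto simp: inner_complex_def)
  then show ?thesis using closure_mono[OF upper_halfplane_subset_upper_basin] by blast
qed

lemma Im_nonpos_if_notin_upper_basin:
  assumes "0 < Im l" "z \<in> orbit_domain l" "z \<notin> upper_basin l"
  shows "Im ((ftan l ^^ n) z) \<le> 0"
  using assms funpow_upper_basin[OF assms(1,2), of n] upper_halfplane_subset_upper_basin[of l]
  by (meson in_mono mem_Collect_eq not_le)

text \<open>By the open mapping theorem, the image of a small disc about \<open>z\<close> is a
  neighbourhood of \<open>ftan l z\<close>, so it meets \<open>upper_basin l\<close>; complete
  invariance pulls such a point back into the disc.\<close>

lemma closure_upper_basin_step: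
  assumes l: "0 < Im l" and z: "z \<in> tan_domain" "ftan l z \<in> closure (upper_basin l)"
  shows "z \<in> closure (upper_basin l)"
  unfolding closure_approachable
proof (intro allI impI)
  fix e :: real assume "e > 0"
  then obtain d where d: "d > 0" "d \<le> e" "ball z d \<subseteq> tan_domain"
    using open_contains_ball[of tan_domain] open_tan_domain z(1)
    by (metis ball_min_Int inf.coboundedI2 min.bounded_iff min_less_iff_conj order_refl)
  have "open (ftan l ` ball z d)" using d by (intro open_ftan_image) auto
  moreover have "ftan l z \<in> ftan l ` ball z d" using d by simp
  ultimately obtain y where "y \<in> upper_basin l" "y \<in> ftan l ` ball z d"
    using z(2) open_Int_closure_eq_empty by blast
  then obtain w where "w \<in> ball z d" "ftan l w \<in> upper_basin l" by blast
  then have "w \<in> tan_domain" "dist w z < e" "ftan l w \<in> upper_basin l"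
    using d(2,3) by (auto simp: dist_commute)
  then have "w \<in> upper_basin l" "dist w z < e"
    using upper_basin_step[OF l] by blast+
  then show "\<exists>y\<in>upper_basin l. dist y z < e" by blast
qed

text \<open>The poles lie in the closure of the upper basin and this closure is backward invariant,
  so an orbit starting outside never meets a pole.\<close>

lemma orbit_domain_if_notin_closure_upper_basin:
  assumes l: "0 < Im l" and z: "z \<notin> closure (upper_basin l)"
  shows "z \<in> orbit_domain l"
proof -
  have "(ftan l ^^ n) z \<in> tan_domain \<and> (ftan l ^^ n) z \<notin> closure (upper_basin l)" for n
  proof (induction n)
    case 0
    then show ?case using z pole_in_closure_upper_basin by auto
  next
    case (Suc n)
    then have "(ftan l ^^ Suc n) z \<notin> closure (upper_basin l)"
      using closure_upper_basin_step[OF l] by auto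
    then show ?case using pole_in_closure_upper_basin by blast
  qed
  then show ?thesis by (simp add: orbit_domain_def)
qed

section \<open>Attracting basins\<close>

text \<open>Cauchy's estimate on the disc of half the radius, which stays away from the boundary of
  the ball; this accounts for the factor 2.\<close>

lemma deriv_bound_if_bounded_1:
  assumes "f holomorphic_on ball x e" "e > 0" "\<And>z. z \<in> ball x e \<Longrightarrow> cmod (f z) \<le> 1"
  shows "cmod (deriv f x) \<le> 2 / e"
proof -
  have "cmod ((deriv ^^ 1) f x) \<le> fact 1 * 1 / (e/2) ^ 1"
  proof (rule Cauchy_inequality)
    show "f holomorphic_on ball x (e/2)" by (rule holomorphic_on_subset[OF assms(1)]) (use assms in auto)
    have "cball x (e/2) \<subseteq> ball x e" using assms by auto
    then show "continuous_on (cball x (e/2)) f"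
      using assms(1) holomorphic_on_imp_continuous_on continuous_on_subset by blast
  qed (use assms in \<open>auto simp: dist_norm\<close>)
  then show ?thesis by simp
qed

lemma cos_zero_iff_exp: "cos z = 0 \<longleftrightarrow> exp (- (2 * \<i> * z)) = -1"
proof -
  have "2 * cos z = exp (\<i> * z) * (1 + exp (- (2 * \<i> * z)))"
    by (simp add: cos_exp_eq algebra_simps flip: exp_add)
  then have "cos z = 0 \<longleftrightarrow> 1 + exp (- (2 * \<i> * z)) = 0"
    by (metis exp_not_eq_zero mult_eq_0_iff zero_neq_numeral)
  also have "\<dots> \<longleftrightarrow> exp (- (2 * \<i> * z)) = -1"
    by (simp add: add_eq_0_iff)
  finally show ?thesis .
qed

lemma tan_preimages_subset_orbit_domain:
  "T \<subseteq> orbit_domain l \<Longrightarrow> tan_preimages l n T \<subseteq> orbit_domain l"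
proof (induction n)
  case (Suc n)
  show ?case
  proof
    fix z assume "z \<in> tan_preimages l (Suc n) T"
    then have "z \<in> tan_domain" "ftan l z \<in> tan_preimages l n T" by (auto simp: tan_preimage_def)
    then show "z \<in> orbit_domain l" using Suc orbit_domain_step by blast
  qed
qed simp

lemma orbit_domain_add_int_pi: "z + of_int k * of_real pi \<in> orbit_domain l \<longleftrightarrow> z \<in> orbit_domain l"
  by (simp add: orbit_domain_def funpow_ftan_add_int_pi tan_domain_add_int_pi)

text \<open>\<open>exp (- 2 * \<i> * f\<^sup>n)\<close> omits 0 and -1 wherever all iterates are defined, so Schottky's theorem
  bounds the imaginary parts of the iterates from above.\<close>
lemma upper_basin_closed_in_orbit_domain:
  assumes l: "0 < Im l" and e: "e > 0" "ball p e \<subseteq> orbit_domain l" and p: "p \<notin> upper_basin l"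
  shows "ball p (e/4) \<inter> upper_basin l = {}"
proof (rule ccontr)
  assume "ball p (e/4) \<inter> upper_basin l \<noteq> {}"
  then obtain y where y: "y \<in> ball p (e/4)" "y \<in> upper_basin l" by blast
  \<comment> \<open>The closed disc of radius \<open>e/2\<close> about \<open>p\<close> is rescaled
    to the unit disc; then \<open>dist p y < e/4\<close> becomes \<open>norm x <= 1/2\<close>, the
    \<open>t\<close> of Schottky's theorem.\<close>
  define x where "x = of_real (2/e) * (y - p)"
  have "norm x = norm (of_real (2/e) :: complex) * norm (y - p)" unfolding x_def by (rule norm_mult)
  also have "norm (of_real (2/e) :: complex) = 2 / e" using e
    unfolding norm_of_real by simp
  finally have nx: "norm x = 2 / e * norm (y - p)" .
  have "4 * norm (y - p) < e" using y by (simp add: dist_norm norm_minus_commute)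
  then have x1: "norm x \<le> 1/2" unfolding nx using e by (simp add: field_simps)
  have x2: "y = p + of_real (e/2) * x" using e by (simp add: x_def field_simps)
  note x = x1 x2
  \<comment> \<open>The outer sign moves the omitted value -1 to 1, as Schottky's theorem requires.
    The modulus of \<open>g n z\<close> is \<open>exp\<close> of twice the imaginary part of the
    iterate, hence at most 1 at the centre.\<close>
  define g where "g = (\<lambda>n z. - exp (- (2 * \<i> * (ftan l ^^ n) (p + of_real (e/2) * z))))"
  have sub: "p + of_real (e/2) * z \<in> ball p e" if "z \<in> cball 0 1" for z
  proof -
    have "norm (of_real (e/2) * z) \<le> e/2 * 1"
      unfolding norm_mult using that e by (intro mult_mono) auto
    then show ?thesis using e by (simp add: dist_norm)
  qed
  have bd: "norm (g n x) \<le> exp (pi * exp (pi * (2 + 2 * 1 + 12 * (1/2) / (1 - 1/2))))" for n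
  proof (rule Schottky[where f = "g n" and r = 1 and t = "1/2"])
    show "g n holomorphic_on cball 0 1"
    proof -
      have "(ftan l ^^ n) \<circ> (\<lambda>z. p + of_real (e/2) * z) holomorphic_on cball 0 1"
        using sub e(2)
        by (intro holomorphic_on_compose holomorphic_intros holomorphic_funpow_ftan) auto
      then show ?thesis unfolding g_def o_def by (intro holomorphic_intros)
    qed
    have "p \<in> orbit_domain l" using e by auto
    then have "Im ((ftan l ^^ n) p) \<le> 0" using Im_nonpos_if_notin_upper_basin l p by blast
    then show "norm (g n 0) \<le> 1" by (simp add: g_def)
    show "\<not> (g n z = 0 \<or> g n z = 1)" if "z \<in> cball 0 1" for z
    proof -
      have "(ftan l ^^ n) (p + of_real (e/2) * z) \<in> tan_domain"
        using sub[OF that] e(2) by (auto simp: orbit_domain_def)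
      then have "exp (- (2 * \<i> * (ftan l ^^ n) (p + of_real (e/2) * z))) \<noteq> -1"
        using cos_zero_iff_exp by (auto simp: tan_domain_def)
      then show ?thesis unfolding g_def by (metis exp_not_eq_zero minus_equation_iff neg_0_equal_iff_equal)
    qed
  qed (use x in auto)
  define M where "M = pi * exp (pi * (2 + 2 * 1 + 12 * (1/2) / (1 - 1/2)))"
  have M: "2 * Im ((ftan l ^^ n) y) \<le> M" for n
    using bd[of n] x(2) unfolding g_def M_def[symmetric] by simp
  have "\<forall>\<^sub>F n in sequentially. \<bar>M\<bar> < Im ((ftan l ^^ n) y)"
    using upper_basin_Im_at_top[OF l y(2)] unfolding filterlim_at_top_dense by blast
  then obtain n where "\<bar>M\<bar> < Im ((ftan l ^^ n) y)"
    using eventually_happens'[OF sequentially_bot] by blast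
  then show False using M[of n] by linarith
qed

section \<open>Attracting fixed points and their basins\<close>

locale attracting_tan =
  fixes l :: complex
  assumes Im_pos: "0 < Im l" and attracting: "cmod (2 + l\<^sup>2) < 1"
begin

text \<open>The real part of \<open>2 + l^2\<close> exceeds -1... and is below 1; the latter reads
  \<open>(Im l)^2 > 1 + (Re l)^2\<close>. The strict bound is what beats the limit \<open>-i\<close>
  of \<open>tan\<close> far below the real axis.\<close>

lemma Im_gt_1: "1 < Im l"
proof -
  have "\<bar>Re (2 + l\<^sup>2)\<bar> < 1" using attracting abs_Re_le_cmod[of "2 + l\<^sup>2"] by linarith
  then have "1 + (Re l)\<^sup>2 < (Im l)\<^sup>2" by (simp add: power2_eq_square)
  then have "1\<^sup>2 < (Im l)\<^sup>2" unfolding one_power2 using zero_le_power2[of "Re l"] by linarith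
  then show ?thesis using Im_pos by (intro power2_less_imp_less[of 1]) auto
qed

definition z0 :: complex where "z0 = Arctan (- l)"

lemma tan_z0: "tan z0 = - l"
proof -
  \<comment> \<open>\<open>Arctan\<close> inverts \<open>tan\<close> except at the two omitted
    values \<open>\<i>\<close> and \<open>- \<i>\<close>; for these \<open>2 + l^2\<close> would
    equal 1.\<close>
  have "(- l)\<^sup>2 \<noteq> -1"
  proof
    assume "(- l)\<^sup>2 = -1"
    then have "l\<^sup>2 = -1" by (simp only: power2_minus)
    from attracting[unfolded this] show False by simp
  qed
  then show ?thesis by (simp add: z0_def)
qed

lemma Im_z0: "Im z0 < 0"
  using Im_tan_nonneg[of z0] tan_z0 Im_pos by force

lemma z0_dom: "z0 \<in> tan_domain"
  using tan_domain_if_Im_nonzero Im_z0 by force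

lemma ftan_z0: "ftan l z0 = z0"
  by (simp add: ftan_def tan_z0)

lemma deriv_z0: "(ftan l has_field_derivative 2 + l\<^sup>2) (at z0)"
  using has_field_derivative_ftan[OF z0_dom, of l] by (simp add: tan_z0)

lemma ftan_fixed_points:
  assumes "z \<in> tan_domain" "tan z = - l" obtains k :: int where "z = z0 + of_int k * of_real pi"
  using tan_eq_imp_int_pi[OF assms(1) z0_dom] assms(2) tan_z0 by metis

lemma contraction:
  obtains r c where "0 < r" "0 < c" "c < 1" "ball z0 r \<subseteq> tan_domain"
    "\<And>z. z \<in> ball z0 r \<Longrightarrow> dist (ftan l z) z0 \<le> c * dist z z0"
proof -
  obtain c where c: "cmod (2 + l\<^sup>2) < c" "c < 1" using attracting dense by blast
  have c0: "0 < c" using c norm_ge_zero[of "2 + l\<^sup>2"] by linarith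
  have "((\<lambda>z. (ftan l z - ftan l z0) / (z - z0)) \<longlongrightarrow> 2 + l\<^sup>2) (at z0)"
    using deriv_z0 by (simp add: has_field_derivative_iff)
  then have "((\<lambda>z. cmod ((ftan l z - ftan l z0) / (z - z0))) \<longlongrightarrow> cmod (2 + l\<^sup>2)) (at z0)"
    by (rule tendsto_norm)
  then have "\<forall>\<^sub>F z in at z0. cmod ((ftan l z - ftan l z0) / (z - z0)) < c"
    using c(1) by (rule order_tendstoD(2))
  then obtain d where d: "d > 0"
    "\<And>z. z \<noteq> z0 \<Longrightarrow> dist z z0 < d \<Longrightarrow> cmod ((ftan l z - ftan l z0) / (z - z0)) < c"
    by (auto simp: eventually_at)
  obtain d' where d': "d' > 0" "ball z0 d' \<subseteq> tan_domain"
    using open_contains_ball[of tan_domain] open_tan_domain z0_dom by blast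
  show ?thesis
  proof (rule that[of "min d d'" c])
    show "ball z0 (min d d') \<subseteq> tan_domain" using d' by auto
    fix z assume z: "z \<in> ball z0 (min d d')"
    show "dist (ftan l z) z0 \<le> c * dist z z0"
    proof (cases "z = z0")
      case False
      then have "cmod (ftan l z - ftan l z0) / cmod (z - z0) < c"
        using d(2)[of z] z by (simp add: norm_divide dist_commute)
      then show ?thesis using False ftan_z0 by (simp add: dist_norm field_simps)
    qed (simp add: ftan_z0)
  qed (use d d' c c0 in auto)
qed

definition basin :: "int \<Rightarrow> complex set" where
  "basin k = {z \<in> orbit_domain l. (\<lambda>n. (ftan l ^^ n) z) \<longlonglongrightarrow> z0 + of_int k * of_real pi}"

lemma basin_add_int_pi: "z + of_int j * of_real pi \<in> basin (k + j) \<longleftrightarrow> z \<in> basin k"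
proof -
  have "(\<lambda>n. (ftan l ^^ n) z + of_int j * of_real pi) \<longlonglongrightarrow> z0 + of_int (k + j) * of_real pi \<longleftrightarrow>
        (\<lambda>n. (ftan l ^^ n) z) \<longlonglongrightarrow> z0 + of_int k * of_real pi"
    using tendsto_add_const_iff[of "of_int j * of_real pi" "\<lambda>n. (ftan l ^^ n) z"
        "z0 + of_int k * of_real pi" sequentially]
    by (simp add: algebra_simps)
  then show ?thesis by (simp add: basin_def orbit_domain_add_int_pi funpow_ftan_add_int_pi)
qed

lemma basin_subset: "basin k \<subseteq> orbit_domain l"
  by (auto simp: basin_def)

lemma basin_step:
  assumes "z \<in> tan_domain" shows "ftan l z \<in> basin k \<longleftrightarrow> z \<in> basin k"
proof -
  have "ftan l z \<in> orbit_domain l \<longleftrightarrow> z \<in> orbit_domain l"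
    using orbit_domain_step[OF assms] funpow_ftan_in_orbit_domain[of z l 1] by auto
  moreover have "(\<lambda>n. (ftan l ^^ n) (ftan l z)) = (\<lambda>n. (ftan l ^^ Suc n) z)"
    by (simp add: funpow_swap1)
  ultimately show ?thesis unfolding basin_def
    by (simp only: mem_Collect_eq filterlim_sequentially_Suc[of "\<lambda>n. (ftan l ^^ n) z"])
qed

lemma funpow_basin: "z \<in> orbit_domain l \<Longrightarrow> (ftan l ^^ n) z \<in> basin k \<longleftrightarrow> z \<in> basin k"
proof (induction n)
  case (Suc n)
  have "(ftan l ^^ n) z \<in> tan_domain" using Suc by (simp add: orbit_domain_def)
  from basin_step[OF this] Suc show ?case by simp
qed simp

lemma basin_disjoint: "j \<noteq> k \<Longrightarrow> basin j \<inter> basin k = {}"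
proof -
  assume "j \<noteq> k"
  then have "z0 + of_int j * of_real pi \<noteq> z0 + of_int k * of_real pi" by simp
  then show ?thesis using LIMSEQ_unique by (fastforce simp: basin_def)
qed

lemma z0_basin: "z0 + of_int k * of_real pi \<in> basin k"
proof -
  have fix0: "(ftan l ^^ n) z0 = z0" for n by (induction n) (auto simp: ftan_z0)
  have "z0 \<in> basin 0" by (simp add: basin_def orbit_domain_def fix0 z0_dom)
  then show ?thesis using basin_add_int_pi[of z0 k 0] by simp
qed

lemma basin_upper_basin_disjoint: "basin k \<inter> upper_basin l = {}"
proof -
  have False if z: "z \<in> basin k" "z \<in> upper_basin l" for z
  proof -
    have "(\<lambda>n. Im ((ftan l ^^ n) z)) \<longlonglongrightarrow> Im (z0 + of_int k * of_real pi)"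
      using z(1) by (intro tendsto_Im) (simp add: basin_def)
    then show False
      using upper_basin_Im_at_top[OF Im_pos z(2)] not_tendsto_and_filterlim_at_infinity[of sequentially]
        filterlim_at_top_imp_at_infinity by (metis sequentially_bot)
  qed
  then show ?thesis by blast
qed

lemma Im_basin:
  assumes "z \<in> basin k" shows "Im z \<le> 0"
proof (rule ccontr)
  assume "\<not> Im z \<le> 0"
  then have "z \<in> upper_basin l" using upper_halfplane_subset_upper_basin[of l] by auto
  then show False using assms basin_upper_basin_disjoint[of k] by blast
qed

text \<open>The radius and the rate found at \<open>z0\<close> serve every fixed point, because
  \<open>ftan l\<close> commutes with translation by \<open>pi\<close>. This uniformity in
  \<open>k\<close> later gives the positive distance to the boundary along a wandering
  orbit.\<close>

lemma trap:
  obtains r c where "0 < r" "0 < c" "c < 1"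
    "\<And>k z. z \<in> ball (z0 + of_int k * of_real pi) r \<Longrightarrow> z \<in> basin k"
    "\<And>k z n. z \<in> ball (z0 + of_int k * of_real pi) r \<Longrightarrow>
       dist ((ftan l ^^ n) z) (z0 + of_int k * of_real pi) \<le> c ^ n * r"
proof -
  obtain r c where r: "0 < r" "0 < c" "c < 1" "ball z0 r \<subseteq> tan_domain"
    "\<And>z. z \<in> ball z0 r \<Longrightarrow> dist (ftan l z) z0 \<le> c * dist z z0"
    using contraction by blast
  have it: "(ftan l ^^ n) z \<in> ball z0 r \<and> dist ((ftan l ^^ n) z) z0 \<le> c ^ n * r" if z: "z \<in> ball z0 r" for z n
  proof (induction n)
    case 0
    then show ?case using z by (simp add: dist_commute)
  next
    case (Suc n)
    define w where "w = (ftan l ^^ n) z"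
    have w: "w \<in> ball z0 r" "dist w z0 \<le> c ^ n * r" using Suc by (auto simp: w_def)
    have a: "dist (ftan l w) z0 \<le> c * dist w z0" using r(5) w(1) by blast
    also have "c * dist w z0 \<le> c * (c ^ n * r)" using w(2) r(2) by (intro mult_left_mono) auto
    finally have b: "dist (ftan l w) z0 \<le> c ^ Suc n * r" by (simp add: mult.assoc)
    have "c * dist w z0 \<le> 1 * dist w z0" using r(3) by (intro mult_right_mono) auto
    then have "dist (ftan l w) z0 < r" using a w(1) by (simp add: dist_commute)
    then show ?case using b by (simp add: w_def dist_commute)
  qed
  have orb: "z \<in> orbit_domain l" if "z \<in> ball z0 r" for z
    using it[OF that] r(4) by (auto simp: orbit_domain_def)
  have "(\<lambda>n. c ^ n * r) \<longlonglongrightarrow> 0 * r" using r by (intro tendsto_intros LIMSEQ_power_zero) auto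
  then have cn: "(\<lambda>n. c ^ n * r) \<longlonglongrightarrow> 0" by simp
  have bas: "z \<in> basin 0" if "z \<in> ball z0 r" for z
  proof -
    have "(\<lambda>n. dist ((ftan l ^^ n) z) z0) \<longlonglongrightarrow> 0"
      by (rule tendsto_sandwich[OF _ _ tendsto_const cn]) (use it[OF that] in auto)
    then have "(\<lambda>n. (ftan l ^^ n) z) \<longlonglongrightarrow> z0" by (rule iffD2[OF tendsto_dist_iff])
    then show ?thesis using orb[OF that] by (simp add: basin_def)
  qed
  have shift: "z - of_int k * of_real pi \<in> ball z0 r" if "z \<in> ball (z0 + of_int k * of_real pi) r" for k z
    using that by (simp add: dist_norm algebra_simps)
  show ?thesis
  proof (rule that[of r c])
    fix k z assume "z \<in> ball (z0 + of_int k * of_real pi) r"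
    then have s: "z - of_int k * of_real pi \<in> ball z0 r" using shift by blast
    show "z \<in> basin k" using bas[OF s] basin_add_int_pi[of "z - of_int k * of_real pi" k 0] by simp
    show "dist ((ftan l ^^ n) z) (z0 + of_int k * of_real pi) \<le> c ^ n * r" for n
      using it[OF s, of n] funpow_ftan_add_int_pi[of n l "z - of_int k * of_real pi" k]
      by (simp add: dist_norm algebra_simps)
  qed (use r in auto)
qed

text \<open>Take the preimage of a trapping ball under an iterate \<open>N\<close> that brings
  \<open>z\<close> into it. Convergence is uniform on this whole preimage, since the geometric rate
  starts at time \<open>N\<close> for all its points.\<close>

lemma basin_nbhd:
  assumes z: "z \<in> basin k"
  obtains T where "open T" "z \<in> T" "T \<subseteq> basin k"
    "uniform_limit T (\<lambda>n. ftan l ^^ n) (\<lambda>_. z0 + of_int k * of_real pi) sequentially"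
proof -
  obtain r c where r: "0 < r" "0 < c" "c < 1"
    "\<And>k z. z \<in> ball (z0 + of_int k * of_real pi) r \<Longrightarrow> z \<in> basin k"
    "\<And>k z n. z \<in> ball (z0 + of_int k * of_real pi) r \<Longrightarrow>
       dist ((ftan l ^^ n) z) (z0 + of_int k * of_real pi) \<le> c ^ n * r"
    using trap by metis
  let ?a = "z0 + of_int k * of_real pi"
  have "(\<lambda>n. (ftan l ^^ n) z) \<longlonglongrightarrow> ?a" using z by (simp add: basin_def)
  then have "\<forall>\<^sub>F n in sequentially. dist ((ftan l ^^ n) z) ?a < r" using r(1) by (rule tendstoD)
  then obtain N where "dist ((ftan l ^^ N) z) ?a < r"
    using eventually_happens'[OF sequentially_bot] by blast
  then have N: "(ftan l ^^ N) z \<in> ball ?a r" by (simp add: dist_commute)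
  define T where "T = tan_preimages l N (ball ?a r)"
  have TN: "(ftan l ^^ N) w \<in> ball ?a r" if "w \<in> T" for w
    using that by (simp add: T_def mem_tan_preimages_iff)
  have Torb: "T \<subseteq> orbit_domain l"
    unfolding T_def using r(4)[of _ k] basin_subset[of k] by (intro tan_preimages_subset_orbit_domain) blast
  show ?thesis
  proof (rule that)
    show "open T" unfolding T_def by (intro open_tan_preimages open_ball)
    show "z \<in> T" using z N basin_subset by (auto simp: T_def mem_tan_preimages_iff orbit_domain_def)
    show "T \<subseteq> basin k"
    proof
      fix w assume w: "w \<in> T"
      then show "w \<in> basin k" using funpow_basin[of w N k] r(4)[OF TN[OF w]] Torb by blast
    qed
    show "uniform_limit T (\<lambda>n. ftan l ^^ n) (\<lambda>_. ?a) sequentially"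
    proof (rule uniform_limitI)
      fix e :: real assume e: "e > 0"
      have "(\<lambda>n. c ^ n * r) \<longlonglongrightarrow> 0 * r" using r by (intro tendsto_intros LIMSEQ_power_zero) auto
      then have "\<forall>\<^sub>F n in sequentially. c ^ n * r < e" using e by (intro order_tendstoD(2)) auto
      then obtain M where M: "\<And>n. n \<ge> M \<Longrightarrow> c ^ n * r < e" by (auto simp: eventually_sequentially)
      show "\<forall>\<^sub>F n in sequentially. \<forall>x\<in>T. dist ((ftan l ^^ n) x) ?a < e"
      proof (rule eventually_sequentiallyI[of "M + N"], rule ballI)
        fix n x assume n: "M + N \<le> n" and x: "x \<in> T"
        have "(ftan l ^^ (n - N)) ((ftan l ^^ N) x) = (ftan l ^^ n) x"
          using n funpow_add[of "n - N" N "ftan l"] by simp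
        then show "dist ((ftan l ^^ n) x) ?a < e"
          using r(5)[OF TN[OF x], of "n - N"] M[of "n - N"] n by fastforce
      qed
    qed
  qed
qed

lemma open_basin: "open (basin k)"
  by (subst open_subopen) (metis basin_nbhd)

end

section \<open>Fatou sets and critical points\<close>

context attracting_tan
begin

section \<open>Comparison with the Fatou set of the shifted map\<close>

lemma param_shift_mem_tan_domain:
  "(ftan (l + of_int m * of_real pi) ^^ n) w \<in> tan_domain \<longleftrightarrow> (ftan l ^^ n) w \<in> tan_domain"
  unfolding funpow_ftan_param_add_int_pi by (rule tan_domain_add_int_pi)

lemma upper_basin_subset_fatou_set:
  "upper_basin l \<subseteq> fatou_set (ftan (l + of_int m * of_real pi)) tan_domain"
proof
  fix z assume "z \<in> upper_basin l"
  then obtain N where N: "z \<in> tan_preimages l N {z. 0 < Im z}" by (auto simp: upper_basin_def)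
  define T where "T = tan_preimages l N {z. 0 < Im z}"
  have T: "open T" unfolding T_def by (intro open_tan_preimages open_upper_halfplane)
  have "T \<subseteq> upper_basin l" by (auto simp: T_def upper_basin_def)
  then have Torb: "T \<subseteq> orbit_domain l" using upper_basin_subset_orbit_domain[OF Im_pos] by blast
  have ge: "real (n - N) * Im l \<le> cmod ((ftan (l + of_int m * of_real pi) ^^ n) w)"
    if w: "w \<in> T" and n: "n \<ge> N" for w n
  proof -
    have "0 \<le> Im ((ftan l ^^ N) w)" using w by (simp add: T_def mem_tan_preimages_iff)
    then have "real (n - N) * Im l \<le> Im ((ftan l ^^ (n - N)) ((ftan l ^^ N) w))"
      using Im_funpow_ftan_ge[OF Im_pos, of "(ftan l ^^ N) w" "n - N"] by linarith
    also have "(ftan l ^^ (n - N)) ((ftan l ^^ N) w) = (ftan l ^^ n) w"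
      using n funpow_add[of "n - N" N "ftan l"] by simp
    also have "Im ((ftan l ^^ n) w) = Im ((ftan (l + of_int m * of_real pi) ^^ n) w)"
      unfolding funpow_ftan_param_add_int_pi by simp
    also have "\<dots> \<le> cmod ((ftan (l + of_int m * of_real pi) ^^ n) w)"
      using abs_Im_le_cmod abs_le_D1 by blast
    finally show ?thesis .
  qed
  have "normal_family T (\<lambda>n. ftan (l + of_int m * of_real pi) ^^ n)"
  proof (rule normal_family_tends_infinity)
    fix K :: "complex set" and B :: real assume K: "K \<subseteq> T"
    define M where "M = nat \<lceil>\<bar>B\<bar>\<rceil>"
    show "\<forall>\<^sub>F n in sequentially. \<forall>w\<in>K. B \<le> norm ((ftan (l + of_int m * of_real pi) ^^ n) w)"
    proof (rule eventually_sequentiallyI[of "N + M"], rule ballI)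
      fix n w assume n: "N + M \<le> n" and w: "w \<in> K"
      have "B \<le> real M" unfolding M_def by linarith
      also have "real M \<le> real (n - N) * 1" using n by simp
      also have "\<dots> \<le> real (n - N) * Im l" using Im_gt_1 by (intro mult_left_mono) auto
      also have "\<dots> \<le> norm ((ftan (l + of_int m * of_real pi) ^^ n) w)" using ge[of w n] w K n by auto
      finally show "B \<le> norm ((ftan (l + of_int m * of_real pi) ^^ n) w)" .
    qed
  qed
  moreover have "(ftan (l + of_int m * of_real pi) ^^ n) w \<in> tan_domain" if "w \<in> T" for n w
    using that Torb param_shift_mem_tan_domain by (auto simp: orbit_domain_def)
  ultimately show "z \<in> fatou_set (ftan (l + of_int m * of_real pi)) tan_domain"
    unfolding fatou_set_def using T N[folded T_def] by blast
qed

text \<open>The iterates of \<open>ftan l\<close> stay bounded near \<open>z\<close>, while the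
  added term \<open>n * m * pi\<close> grows because \<open>m\<close> is nonzero; so the iterates of
  the shifted map tend to infinity uniformly.\<close>

lemma basin_subset_fatou_set:
  assumes m: "m \<noteq> 0"
  shows "basin k \<subseteq> fatou_set (ftan (l + of_int m * of_real pi)) tan_domain"
proof
  fix z assume "z \<in> basin k"
  define a where "a = z0 + of_int k * of_real pi"
  obtain T where T: "open T" "z \<in> T" "T \<subseteq> basin k"
    "uniform_limit T (\<lambda>n. ftan l ^^ n) (\<lambda>_. a) sequentially"
    using basin_nbhd[OF \<open>z \<in> basin k\<close>] unfolding a_def by metis
  have "\<forall>\<^sub>F n in sequentially. \<forall>x\<in>T. dist ((ftan l ^^ n) x) a < 1"
    using uniform_limitD[OF T(4), of 1] by simp
  then obtain N where N: "\<And>n x. n \<ge> N \<Longrightarrow> x \<in> T \<Longrightarrow> dist ((ftan l ^^ n) x) a < 1"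
    by (auto simp: eventually_sequentially)
  have "normal_family T (\<lambda>n. ftan (l + of_int m * of_real pi) ^^ n)"
  proof (rule normal_family_tends_infinity)
    fix K :: "complex set" and B :: real assume K: "K \<subseteq> T"
    \<comment> \<open>From time \<open>N\<close> on, the iterates of \<open>ftan l\<close> have
      modulus at most \<open>cmod a + 1\<close>, and the shift has modulus at least
      \<open>n\<close>; for \<open>n >= M\<close> the difference exceeds \<open>B\<close>.\<close>
    define M where "M = nat \<lceil>\<bar>B\<bar> + cmod a + 1\<rceil>"
    show "\<forall>\<^sub>F n in sequentially. \<forall>w\<in>K. B \<le> norm ((ftan (l + of_int m * of_real pi) ^^ n) w)"
    proof (rule eventually_sequentiallyI[of "N + M"], rule ballI)
      fix n w assume n: "N + M \<le> n" and w: "w \<in> K"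
      define v where "v = (ftan l ^^ n) w"
      have "dist v a < 1" using N[of n w] n w K by (auto simp: v_def)
      then have v: "cmod v \<le> cmod a + 1"
        using norm_triangle_ineq2[of v a] by (simp add: dist_norm)
      have "\<bar>B\<bar> + cmod a + 1 \<le> real M" unfolding M_def by linarith
      also have "real M \<le> real n" using n by simp
      also have "\<dots> \<le> real n * (real_of_int \<bar>m\<bar> * pi)"
      proof -
        have "1 \<le> real_of_int \<bar>m\<bar>" using m by linarith
        then have "1 * 1 \<le> real_of_int \<bar>m\<bar> * pi" using pi_gt3 by (intro mult_mono) auto
        then have "real n * 1 \<le> real n * (real_of_int \<bar>m\<bar> * pi)" by (intro mult_left_mono) auto
        then show ?thesis by simp
      qed
      also have "\<dots> = cmod (of_int (int n * m) * of_real pi)"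
        by (simp add: norm_mult)
      finally have "\<bar>B\<bar> + cmod a + 1 \<le> cmod (of_int (int n * m) * of_real pi)" .
      moreover have "cmod (of_int (int n * m) * of_real pi) - cmod v \<le> cmod (v + of_int (int n * m) * of_real pi)"
        using norm_triangle_ineq2[of "of_int (int n * m) * of_real pi" "- v"] by (simp add: add.commute)
      ultimately show "B \<le> norm ((ftan (l + of_int m * of_real pi) ^^ n) w)"
        unfolding funpow_ftan_param_add_int_pi v_def[symmetric] using v by linarith
    qed
  qed
  moreover have "(ftan (l + of_int m * of_real pi) ^^ n) w \<in> tan_domain" if "w \<in> T" for n w
    using that T(3) basin_subset param_shift_mem_tan_domain by (auto simp: orbit_domain_def)
  ultimately show "z \<in> fatou_set (ftan (l + of_int m * of_real pi)) tan_domain"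
    unfolding fatou_set_def using T(1,2) by blast
qed

lemma fatou_set_subset_interior_orbit_domain:
  "fatou_set (ftan (l + of_int m * of_real pi)) tan_domain \<subseteq> interior (orbit_domain l)"
proof
  fix z assume "z \<in> fatou_set (ftan (l + of_int m * of_real pi)) tan_domain"
  then obtain T where T: "open T" "z \<in> T"
    "\<And>n w. w \<in> T \<Longrightarrow> (ftan (l + of_int m * of_real pi) ^^ n) w \<in> tan_domain"
    unfolding fatou_set_def by blast
  have "T \<subseteq> orbit_domain l"
    using T(3) param_shift_mem_tan_domain by (auto simp: orbit_domain_def)
  then show "z \<in> interior (orbit_domain l)" using T interior_maximal by blast
qed

section \<open>Critical points and the postcritical set\<close>

definition immediate_basin :: "complex set" where
  "immediate_basin = connected_component_set (basin 0) z0"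

lemma z0_basin0: "z0 \<in> basin 0"
  using z0_basin[of 0] by simp

lemma immediate_basin_subset: "immediate_basin \<subseteq> basin 0"
  unfolding immediate_basin_def by (rule connected_component_subset)

lemma z0_immediate_basin: "z0 \<in> immediate_basin"
  unfolding immediate_basin_def using z0_basin0 by simp

lemma open_immediate_basin: "open immediate_basin"
  unfolding immediate_basin_def by (rule open_connected_component[OF open_basin])

lemma connected_immediate_basin: "connected immediate_basin"
  unfolding immediate_basin_def by simp

lemma tan_preimages_basin: "T \<subseteq> basin k \<Longrightarrow> tan_preimages l n T \<subseteq> basin k"
proof (induction n)
  case (Suc n)
  show ?case
  proof
    fix z assume "z \<in> tan_preimages l (Suc n) T"
    then have "z \<in> tan_domain" "ftan l z \<in> tan_preimages l n T" by (auto simp: tan_preimage_def)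
    then show "z \<in> basin k" using Suc basin_step by blast
  qed
qed simp

lemma funpow_z0: "(ftan l ^^ n) z0 = z0"
  by (induction n) (auto simp: ftan_z0)

lemma deriv_funpow_z0: "((ftan l ^^ n) has_field_derivative (2 + l\<^sup>2) ^ n) (at z0)"
proof (induction n)
  case (Suc n)
  have "(ftan l \<circ> (ftan l ^^ n) has_field_derivative (2 + l\<^sup>2) * (2 + l\<^sup>2) ^ n) (at z0)"
    using deriv_z0 by (intro DERIV_chain Suc) (simp add: funpow_z0)
  then show ?case by (simp only: funpow.simps(2) power_Suc)
qed (simp add: id_def)

text \<open>Fatou's argument: otherwise the inverse branches of the iterates fixing \<open>z0\<close> would be defined
  on a common disc with values below the real axis, although their derivatives at \<open>z0\<close> explode.\<close>
lemma critical_point_immediate_basin: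
  obtains c where "c \<in> immediate_basin" "2 + (tan c)\<^sup>2 = 0"
proof -
  have False if nocrit: "\<And>z. z \<in> immediate_basin \<Longrightarrow> 2 + (tan z)\<^sup>2 \<noteq> 0"
  proof -
    obtain r where r: "0 < r" "\<And>k z. z \<in> ball (z0 + of_int k * of_real pi) r \<Longrightarrow> z \<in> basin k"
      using trap by metis
    have D: "ball z0 r \<subseteq> basin 0" using r(2)[of _ 0] by auto
    define q where "q = cmod (2 + l\<^sup>2)"
    have q1: "q < 1" using attracting by (simp add: q_def)
    have bound: "exp (Im z0) \<le> (2 / r) * q ^ n" for n
    proof -
      have "\<exists>h. h holomorphic_on ball z0 r \<and> h ((ftan l ^^ n) z0) = z0 \<and>
        (\<forall>x\<in>ball z0 r. h x \<in> tan_preimages l n (ball z0 r) \<and> (ftan l ^^ n) (h x) = x)"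
      proof (rule inverse_branch)
        show "simply_connected (ball z0 r)" by (simp add: convex_imp_simply_connected)
        show "(ftan l ^^ j) z0 \<in> tan_domain" for j by (simp add: funpow_z0 z0_dom)
        show "(ftan l ^^ n) z0 \<in> ball z0 r" using r by (simp add: funpow_z0)
        fix i C z assume C: "connected C" "(ftan l ^^ i) z0 \<in> C"
          "C \<subseteq> tan_preimages l (n - i) (ball z0 r)" "z \<in> C"
        have "C \<subseteq> basin 0" using C(3) tan_preimages_basin[OF D] by blast
        \<comment> \<open>The iterate of \<open>z0\<close> is \<open>z0\<close> itself, so every
          connected set occurring in the pullback contains \<open>z0\<close> and stays in its
          component of the basin.\<close>
        then have "C \<subseteq> immediate_basin"
          unfolding immediate_basin_def using C(1,2) by (intro connected_component_maximal) (auto simp: funpow_z0)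
        then show "2 + (tan z)\<^sup>2 \<noteq> 0" using nocrit C(4) by blast
      qed simp
      then obtain h where h: "h holomorphic_on ball z0 r" "h z0 = z0"
        "\<And>x. x \<in> ball z0 r \<Longrightarrow> h x \<in> tan_preimages l n (ball z0 r)"
        "\<And>x. x \<in> ball z0 r \<Longrightarrow> (ftan l ^^ n) (h x) = x"
        unfolding funpow_z0 by blast
      have Imh: "Im (h x) \<le> 0" if "x \<in> ball z0 r" for x
        using Im_basin[of "h x" 0] h(3)[OF that] tan_preimages_basin[OF D] by blast
      have hd: "(h has_field_derivative deriv h z0) (at z0)"
        using holomorphic_derivI[OF h(1) open_ball] r(1) by simp
      have "((ftan l ^^ n) \<circ> h has_field_derivative (2 + l\<^sup>2) ^ n * deriv h z0) (at z0)"
        using deriv_funpow_z0 by (intro DERIV_chain hd) (simp add: h(2))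
      moreover have "((ftan l ^^ n) \<circ> h has_field_derivative 1) (at z0)"
      proof (rule has_field_derivative_transform_within_open)
        show "((\<lambda>x. x) has_field_derivative 1) (at z0)" by simp
        show "open (ball z0 r)" "z0 \<in> ball z0 r" using r by auto
      qed (use h(4) in auto)
      ultimately have "(2 + l\<^sup>2) ^ n * deriv h z0 = 1" by (rule DERIV_unique)
      then have dh: "q ^ n * cmod (deriv h z0) = 1"
        by (metis norm_mult norm_one norm_power q_def)
      \<comment> \<open>Since \<open>h\<close> has values below the real axis, \<open>g\<close> is
        bounded by 1 on a disc that does not depend on \<open>n\<close>. This caps
        \<open>cmod (deriv h z0)\<close>, whereas the chain rule makes it
        \<open>q^(-n)\<close>.\<close>
      define g where "g = (\<lambda>x. exp (- \<i> * h x))"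
      have "cmod (deriv g z0) \<le> 2 / r"
      proof (rule deriv_bound_if_bounded_1)
        show "g holomorphic_on ball z0 r" unfolding g_def by (intro holomorphic_intros h)
      qed (use r Imh in \<open>auto simp: g_def\<close>)
      moreover have "(g has_field_derivative exp (- \<i> * h z0) * (- \<i> * deriv h z0)) (at z0)"
        unfolding g_def by (rule derivative_eq_intros hd refl | simp)+
      then have "deriv g z0 = exp (- \<i> * h z0) * (- \<i> * deriv h z0)" by (rule DERIV_imp_deriv)
      then have "cmod (deriv g z0) = exp (Im z0) * cmod (deriv h z0)"
        by (simp add: norm_mult h(2))
      ultimately have "exp (Im z0) * cmod (deriv h z0) \<le> 2 / r" by simp
      then have "exp (Im z0) * cmod (deriv h z0) * q ^ n \<le> 2 / r * q ^ n"
        by (intro mult_right_mono) (auto simp: q_def)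
      moreover have "exp (Im z0) * cmod (deriv h z0) * q ^ n = exp (Im z0) * (q ^ n * cmod (deriv h z0))"
        by simp
      ultimately show ?thesis unfolding dh by simp
    qed
    have "(\<lambda>n. (2 / r) * q ^ n) \<longlonglongrightarrow> (2 / r) * 0"
      using q1 by (intro tendsto_intros LIMSEQ_power_zero) (auto simp: q_def)
    then have "exp (Im z0) \<le> 2 / r * 0"
      using bound by (intro LIMSEQ_le_const) auto
    then show False by simp
  qed
  then show ?thesis using that by blast
qed

definition crit :: complex where
  "crit = (SOME c. c \<in> immediate_basin \<and> 2 + (tan c)\<^sup>2 = 0)"

lemma crit: "crit \<in> immediate_basin" "2 + (tan crit)\<^sup>2 = 0"
proof -
  have "\<exists>c. c \<in> immediate_basin \<and> 2 + (tan c)\<^sup>2 = 0"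
    using critical_point_immediate_basin by metis
  then have "crit \<in> immediate_basin \<and> 2 + (tan crit)\<^sup>2 = 0" unfolding crit_def by (rule someI_ex)
  then show "crit \<in> immediate_basin" "2 + (tan crit)\<^sup>2 = 0" by auto
qed

text \<open>Besides \<open>tan z = tan crit\<close> only \<open>tan z = - tan crit\<close> is
  possible. As \<open>tan\<close> preserves the lower half-plane, the latter would make
  \<open>tan crit\<close> real, contradicting \<open>(tan crit)^2 = - 2\<close>.\<close>

lemma critical_points:
  assumes z: "z \<in> tan_domain" "2 + (tan z)\<^sup>2 = 0" "Im z \<le> 0"
  obtains k :: int where "z = crit + of_int k * of_real pi"
proof -
  have cb: "crit \<in> basin 0" using crit(1) immediate_basin_subset by blast
  have cd: "crit \<in> tan_domain" using cb basin_subset orbit_domain_subset by blast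
  have "(tan z - tan crit) * (tan z + tan crit) = (2 + (tan z)\<^sup>2) - (2 + (tan crit)\<^sup>2)"
    by (simp add: power2_eq_square algebra_simps)
  then consider "tan z = tan crit" | "tan z = - tan crit"
    using z(2) crit(2) by (auto simp: add_eq_0_iff)
  then show ?thesis
  proof cases
    case 1
    then show ?thesis using tan_eq_imp_int_pi[OF z(1) cd] that by metis
  next
    case 2
    have "Im (tan z) \<le> 0" "Im (tan crit) \<le> 0"
      using Im_tan_nonpos z(3) Im_basin[OF cb] by auto
    then have "Im (tan crit) = 0" using 2 by simp
    then have "Re (2 + (tan crit)\<^sup>2) = 2 + (Re (tan crit))\<^sup>2" by (simp add: power2_eq_square)
    then show ?thesis using crit(2) zero_le_power2[of "Re (tan crit)"] by simp
  qed
qed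

lemma Im_ftan_ge_far_below:
  obtains R where "R > 0" "\<And>z. Im z \<le> - R \<Longrightarrow> Im z \<le> Im (ftan l z)"
proof -
  define e where "e = Im l - 1"
  have e: "e > 0" using Im_gt_1 by (simp add: e_def)
  \<comment> \<open>The threshold makes \<open>s\<close> at least 1 and at least \<open>1/e\<close>,
    hence \<open>s^2 >= 1/e\<close>, so that \<open>1 + 1/s^2 <= 1 + e = Im l\<close>.\<close>
  have "\<forall>\<^sub>F R in at_top. 1 + 1 / e < sinh (R::real)"
    using sinh_real_at_top unfolding filterlim_at_top_dense by blast
  then have "\<forall>\<^sub>F R in at_top. 1 + 1 / e < sinh (R::real) \<and> R > 0"
    using eventually_gt_at_top[of 0] by (rule eventually_conj)
  then obtain R where R: "1 + 1 / e < sinh R" "R > 0"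
    using eventually_happens'[OF trivial_limit_at_top_linorder] by blast
  have "Im z \<le> Im (ftan l z)" if z: "Im z \<le> - R" for z
  proof -
    define s where "s = sinh (- Im z)"
    have "sinh R \<le> s" unfolding s_def sinh_real_le_iff using z by linarith
    then have s: "1 + 1 / e < s" using R by linarith
    have e1: "0 < 1 / e" using e by simp
    have s1: "1 \<le> s" "1 / e \<le> s" using s e1 by linarith+
    have "1 / e * 1 \<le> s * s" using s1 e1 by (intro mult_mono) linarith+
    then have "1 / e \<le> s\<^sup>2" unfolding power2_eq_square by linarith
    then have "1 / s\<^sup>2 \<le> 1 / (1 / e)" using e1 s1 by (intro divide_left_mono mult_pos_pos) auto
    then have "1 / s\<^sup>2 \<le> e" by simp
    moreover have "(cmod (tan z))\<^sup>2 \<le> 1 + 1 / s\<^sup>2"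
      using norm_tan_squared_le[of z] z R by (simp add: s_def)
    ultimately have t: "(cmod (tan z))\<^sup>2 \<le> Im l" by (simp add: e_def)
    \<comment> \<open>A modulus above 1 is at most its square, and a modulus up to 1 is below
      \<open>Im l\<close> by \<open>Im_gt_1\<close>.\<close>
    have "cmod (tan z) \<le> Im l"
    proof (cases "cmod (tan z) \<le> 1")
      case False
      then have "cmod (tan z) * 1 \<le> cmod (tan z) * cmod (tan z)" by (intro mult_left_mono) auto
      then show ?thesis using t by (simp add: power2_eq_square)
    qed (use Im_gt_1 in linarith)
    then have "- Im l \<le> Im (tan z)" using abs_Im_le_cmod[of "tan z"] by linarith
    then show ?thesis by (simp add: ftan_def)
  qed
  then show ?thesis using R(2) that by blast
qed

text \<open>Far below the real axis the map moves points upwards, so the orbit cannot drift downwards to infinity.\<close>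
lemma recurrent_subsequence:
  assumes Im_le: "\<And>n. Im ((ftan l ^^ n) p) \<le> 0"
  obtains n :: "nat \<Rightarrow> nat" and j :: "nat \<Rightarrow> int" and w where "strict_mono n"
    "(\<lambda>k. (ftan l ^^ n k) p - of_int (j k) * of_real pi) \<longlonglongrightarrow> w"
proof -
  obtain R where R: "R > 0" "\<And>z. Im z \<le> - R \<Longrightarrow> Im z \<le> Im (ftan l z)"
    using Im_ftan_ge_far_below by blast
  \<comment> \<open>Either the orbit returns above height \<open>- R\<close> infinitely often, or it
    stays below from time \<open>N\<close> on; then its imaginary part is nondecreasing and its
    value at time \<open>N\<close> is a lower bound.\<close>
  obtain S where S: "infinite {n. - S \<le> Im ((ftan l ^^ n) p)}"
  proof (cases "infinite {n. - R \<le> Im ((ftan l ^^ n) p)}")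
    case False
    then obtain N where N: "\<And>n. - R \<le> Im ((ftan l ^^ n) p) \<Longrightarrow> n < N"
      by (auto simp: finite_nat_set_iff_bounded)
    have "Im ((ftan l ^^ N) p) \<le> Im ((ftan l ^^ (N + n)) p)" for n
    proof (induction n)
      case (Suc n)
      have "Im ((ftan l ^^ (N + n)) p) \<le> - R" using N[of "N + n"] by linarith
      then show ?case using R(2) Suc by fastforce
    qed simp
    then have "N + n \<in> {n. - (- Im ((ftan l ^^ N) p)) \<le> Im ((ftan l ^^ n) p)}" for n by simp
    then have "infinite {n. - (- Im ((ftan l ^^ N) p)) \<le> Im ((ftan l ^^ n) p)}"
      unfolding infinite_nat_iff_unbounded_le by (metis le_add2)
    then show ?thesis by (rule that)
  qed (use that in blast)
  obtain n0 :: "nat \<Rightarrow> nat" where n0: "strict_mono n0" "\<And>k. - S \<le> Im ((ftan l ^^ n0 k) p)"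
    using infinite_enumerate[OF S] by blast
  define j0 where "j0 = (\<lambda>k. \<lfloor>Re ((ftan l ^^ n0 k) p) / pi\<rfloor>)"
  define x where "x = (\<lambda>k. (ftan l ^^ n0 k) p - of_int (j0 k) * of_real pi)"
  have "cmod (x k) \<le> pi + \<bar>S\<bar>" for k
  proof -
    have "of_int (j0 k) \<le> Re ((ftan l ^^ n0 k) p) / pi" "Re ((ftan l ^^ n0 k) p) / pi < of_int (j0 k) + 1"
      unfolding j0_def by linarith+
    then have "of_int (j0 k) * pi \<le> Re ((ftan l ^^ n0 k) p)" "Re ((ftan l ^^ n0 k) p) < of_int (j0 k) * pi + pi"
      by (simp_all add: field_simps)
    then have "\<bar>Re (x k)\<bar> \<le> pi" by (simp add: x_def)
    moreover have "\<bar>Im (x k)\<bar> \<le> \<bar>S\<bar>" using n0(2)[of k] Im_le[of "n0 k"] by (simp add: x_def)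
    ultimately show ?thesis using cmod_le[of "x k"] by linarith
  qed
  then have "bounded (range x)" by (auto simp: bounded_iff)
  then obtain w r where r: "strict_mono r" "(x \<circ> r) \<longlonglongrightarrow> w"
    using bounded_imp_convergent_subsequence by blast
  show ?thesis
  proof (rule that[of "n0 \<circ> r" "j0 \<circ> r" w])
    show "strict_mono (n0 \<circ> r)" using n0(1) r(1) by (simp add: strict_mono_o)
    show "(\<lambda>k. (ftan l ^^ (n0 \<circ> r) k) p - of_int ((j0 \<circ> r) k) * of_real pi) \<longlonglongrightarrow> w"
      using r(2) by (simp add: x_def o_def)
  qed
qed

text \<open>Written as a sum of two sets so that closedness follows from
  \<open>compact_closed_sums\<close>: the orbit of \<open>crit\<close> together with its limit
  \<open>z0\<close> is compact, and the multiples of \<open>pi\<close> form a closed set.\<close>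

definition postcrit :: "complex set" where
  "postcrit = (\<Union>x\<in>insert z0 (range (\<lambda>i. (ftan l ^^ i) crit)). \<Union>y\<in>range (\<lambda>k. of_int k * of_real pi). {x + y})"

lemma postcrit_shift: "x \<in> postcrit \<Longrightarrow> x + of_int k * of_real pi \<in> postcrit"
proof -
  assume "x \<in> postcrit"
  then obtain y a where y: "y \<in> insert z0 (range (\<lambda>i. (ftan l ^^ i) crit))" "x = y + of_int a * of_real pi"
    by (auto simp: postcrit_def)
  have "x + of_int k * of_real pi = y + of_int (a + k) * of_real pi" using y(2) by (simp add: algebra_simps)
  then show ?thesis unfolding postcrit_def using y(1) by blast
qed

lemma crit_basin: "crit \<in> basin 0"
  using crit(1) immediate_basin_subset by blast

lemma closed_postcrit: "closed postcrit"
  unfolding postcrit_def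
proof (rule compact_closed_sums)
  have "(\<lambda>i. (ftan l ^^ i) crit) \<longlonglongrightarrow> z0" using crit_basin by (simp add: basin_def)
  then show "compact (insert z0 (range (\<lambda>i. (ftan l ^^ i) crit)))" by (rule compact_sequence_with_limit)
  show "closed (range (\<lambda>k. of_int k * of_real pi :: complex))"
  proof (rule discrete_imp_closed[of 1], simp, intro ballI impI)
    fix x y :: complex assume xy: "x \<in> range (\<lambda>k. of_int k * of_real pi)" "y \<in> range (\<lambda>k. of_int k * of_real pi)" "dist y x < 1"
    then obtain a b :: int where ab: "x = of_int a * of_real pi" "y = of_int b * of_real pi" by blast
    have "dist y x = cmod (of_int (b - a) * of_real pi)"
      unfolding ab dist_norm by (simp add: algebra_simps)
    also have "\<dots> = real_of_int \<bar>b - a\<bar> * pi" by (simp only: norm_mult norm_of_int norm_of_real) simp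
    finally have lt: "real_of_int \<bar>b - a\<bar> * pi < 1" using xy(3) by simp
    have "b = a"
    proof (rule ccontr)
      assume "b \<noteq> a"
      then have "1 \<le> real_of_int \<bar>b - a\<bar>" by linarith
      then have "1 * 1 \<le> real_of_int \<bar>b - a\<bar> * pi" using pi_gt3 by (intro mult_mono) auto
      then show False using lt by simp
    qed
    then show "y = x" using ab by simp
  qed
qed

lemma countable_postcrit: "countable postcrit"
  unfolding postcrit_def by (intro countable_UN countable_insert) auto

lemma postcrit_subset_basins: "postcrit \<subseteq> (\<Union>k. basin k)"
proof
  fix x assume "x \<in> postcrit"
  then obtain y k where y: "y \<in> insert z0 (range (\<lambda>i. (ftan l ^^ i) crit))" "x = y + of_int k * of_real pi"
    by (auto simp: postcrit_def)
  have "(ftan l ^^ i) crit \<in> basin 0" for i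
    using funpow_basin[of crit i 0] crit_basin basin_subset by blast
  then have "y \<in> basin 0" using y(1) z0_basin0 by auto
  then have "x \<in> basin k" using basin_add_int_pi[of y k 0] y(2) by simp
  then show "x \<in> (\<Union>k. basin k)" by blast
qed

end

section \<open>Classification of the Fatou set\<close>

text \<open>Segments from \<open>w\<close> to distinct points of the line \<open>Im = 1/2\<close>
  meet only in \<open>w\<close>, so each point of \<open>Q\<close> blocks at most one
  \<open>t\<close>, and there are uncountably many. Height \<open>1/2\<close> lies inside the upper
  half-plane, yet below height 1, above which pullbacks may meet critical values.\<close>

lemma segment_avoiding_countable:
  assumes w: "Im w \<le> 0" and Q: "countable Q" "w \<notin> Q"
  obtains t :: real where "closed_segment w (of_real t + \<i> / 2) \<inter> Q = {}"
proof -
  define B where "B = (\<lambda>q. {t. q \<in> closed_segment w (of_real t + \<i> / 2)})"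
  have same: "t = t'" if q: "q \<in> Q" and t: "t \<in> B q" "t' \<in> B q" for q t t'
  proof -
    obtain s where s: "q = (1 - s) *\<^sub>R w + s *\<^sub>R (of_real t + \<i> / 2)"
      using t(1) by (auto simp: B_def in_segment)
    obtain s' where s': "q = (1 - s') *\<^sub>R w + s' *\<^sub>R (of_real t' + \<i> / 2)"
      using t(2) by (auto simp: B_def in_segment)
    have "Im q = (1 - s) * Im w + s * (1/2)" "Im q = (1 - s') * Im w + s' * (1/2)"
      by (subst s, simp) (subst s', simp)
    then have "(s - s') * (1/2 - Im w) = 0" by (simp add: field_simps)
    then have ss: "s = s'" using w by simp
    have "Re q = (1 - s) * Re w + s * t" "Re q = (1 - s') * Re w + s' * t'"
      by (subst s, simp) (subst s', simp)
    then have "s * (t - t') = 0" using ss by (auto simp: algebra_simps)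
    moreover have "s \<noteq> 0" using s q Q(2) by auto
    ultimately show ?thesis by simp
  qed
  have "countable (B q)" if "q \<in> Q" for q
  proof (cases "B q = {}")
    case False
    then obtain t where "t \<in> B q" by blast
    then have "B q \<subseteq> {t}" using same[OF that] by blast
    then show ?thesis using countable_subset by blast
  qed simp
  then have "countable (\<Union>q\<in>Q. B q)" using Q(1) by blast
  then have "(\<Union>q\<in>Q. B q) \<noteq> UNIV" using uncountable_UNIV_real by metis
  then obtain t where "t \<notin> (\<Union>q\<in>Q. B q)" by blast
  then have "closed_segment w (of_real t + \<i> / 2) \<inter> Q = {}" by (auto simp: B_def)
  then show ?thesis by (rule that)
qed

text \<open>All \<open>h n\<close> avoid the poles and share the value \<open>p\<close> at
  \<open>w\<close>. Two poles far enough apart, moved to 0 and 1 by an affine map that brings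
  \<open>p\<close> into the unit disc, make Schottky's bound uniform in \<open>n\<close>.\<close>

lemma locally_bounded_if_omits_two_values:
  assumes S: "open S" "connected S" "w \<in> S" and hol: "\<And>n. h n holomorphic_on S"
    and omit: "\<And>n z. z \<in> S \<Longrightarrow> h n z \<in> tan_domain" and base: "\<And>n. h n w = p"
    and K: "compact K" "K \<subseteq> S"
  obtains B where "\<And>n z. z \<in> K \<Longrightarrow> norm (h (n::nat) z) \<le> B"
proof -
  \<comment> \<open>The omitted poles are \<open>pi/2\<close> and \<open>pi/2 + N * pi\<close>;
    dividing by \<open>N * pi\<close> makes the rescaled base value at most 1 in modulus.\<close>
  define N where "N = nat \<lceil>norm (p - of_real (pi/2))\<rceil> + 1"
  have N0: "N > 0" by (simp add: N_def)
  have N: "norm (p - of_real (pi/2)) \<le> real N * pi" "real N * pi > 0"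
  proof -
    have "norm (p - of_real (pi/2)) \<le> real N" "real N \<ge> 1" unfolding N_def by linarith+
    moreover have "real N * 1 \<le> real N * pi" using pi_gt3 by (intro mult_left_mono) auto
    ultimately show "norm (p - of_real (pi/2)) \<le> real N * pi" "real N * pi > 0" by linarith+
  qed
  define g where "g = (\<lambda>n z. (h n z - of_real (pi/2)) / of_real (real N * pi))"
  have c0: "cos (of_real (pi/2) :: complex) = 0" by (simp flip: cos_of_real)
  have pole: "of_real (pi/2) + of_int k * of_real pi \<notin> tan_domain" for k
    using c0 by (simp add: tan_domain_add_int_pi) (simp add: tan_domain_def)
  obtain B where B: "\<And>h z. h \<in> range g \<Longrightarrow> z \<in> K \<Longrightarrow> norm (h z) \<le> B"
  proof (rule GPicard3[OF S, of "range g" "range g" K])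
    fix f assume "f \<in> range g"
    then obtain n where n: "f = g n" by blast
    show "f holomorphic_on S" unfolding n g_def using N by (intro holomorphic_intros hol) auto
    show "norm (f w) \<le> 1" unfolding n g_def base norm_divide norm_of_real using N by (simp add: divide_le_eq_1)
    fix z assume z: "z \<in> S"
    have "h n z \<noteq> of_real (pi/2) + of_int 0 * of_real pi" "h n z \<noteq> of_real (pi/2) + of_int (int N) * of_real pi"
      using omit[OF z, of n] pole by metis+
    then show "f z \<noteq> 0 \<and> f z \<noteq> 1" unfolding n g_def using N(2) N0 by (simp add: field_simps)
  qed (use K in auto)
  have "norm (h n z) \<le> B * (real N * pi) + pi" if "z \<in> K" for n z
  proof -
    have "norm (h n z - of_real (pi/2)) / (real N * pi) \<le> B"
      using B[of "g n" z] that N(2) by (simp add: g_def norm_divide norm_mult)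
    then have "norm (h n z - of_real (pi/2)) \<le> B * (real N * pi)"
      using N(2) by (simp add: pos_divide_le_eq)
    moreover have "norm (h n z) \<le> norm (h n z - of_real (pi/2)) + norm (of_real (pi/2) :: complex)"
      by (metis diff_add_cancel norm_triangle_ineq)
    moreover have "norm (of_real (pi/2) :: complex) \<le> pi" by simp
    ultimately show ?thesis by linarith
  qed
  then show ?thesis using that by blast
qed

context attracting_tan
begin

text \<open>A critical point below the real axis is a translate of \<open>crit\<close> and would
  land in \<open>postcrit\<close>. One above it gains at least \<open>Im l > 1\<close> in height per
  step, so it would land above height 1.\<close>

lemma postcrit_pullback:
  assumes i: "i < n" and z: "z \<in> tan_preimages l (n - i) D"
    and D: "D \<inter> postcrit = {}" "\<And>x. x \<in> D \<Longrightarrow> Im x < 1"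
  shows "2 + (tan z)\<^sup>2 \<noteq> 0"
proof
  assume cr: "2 + (tan z)\<^sup>2 = 0"
  have Fz: "(ftan l ^^ (n - i)) z \<in> D" using z by (simp add: mem_tan_preimages_iff)
  have "(ftan l ^^ 0) z \<in> tan_domain" using z i unfolding mem_tan_preimages_iff by (meson zero_less_diff)
  then have zd: "z \<in> tan_domain" by simp
  show False
  proof (cases "Im z \<le> 0")
    case True
    then obtain a where a: "z = crit + of_int a * of_real pi" using critical_points[OF zd cr] by blast
    have "(ftan l ^^ (n - i)) z = (ftan l ^^ (n - i)) crit + of_int a * of_real pi"
      unfolding a by (rule funpow_ftan_add_int_pi)
    then have "(ftan l ^^ (n - i)) z \<in> postcrit" unfolding postcrit_def by blast
    then show False using Fz D(1) by blast
  next
    case False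
    have "1 * 1 \<le> real (n - i) * Im l" using i Im_gt_1 by (intro mult_mono) auto
    moreover have "real (n - i) * Im l + Im z \<le> Im ((ftan l ^^ (n - i)) z)"
      using Im_funpow_ftan_ge[OF Im_pos, of z "n - i"] False by simp
    ultimately show False using D(2)[OF Fz] False by linarith
  qed
qed

text \<open>Let \<open>w\<close> be an accumulation point (modulo \<open>pi\<close>) of the orbit of \<open>p\<close>.  Inverse branches of the
  iterates along this orbit are defined on a convex region joining \<open>w\<close> to the upper half-plane.
  Near the end in the upper half-plane a nonconstant limit would contradict the escape to infinity
  there, so the branches contract; then the iterates cannot be normal at \<open>p\<close>.\<close>
lemma interior_orbit_domain_subset:
  "interior (orbit_domain l) \<subseteq> upper_basin l \<union> (\<Union>k. basin k)"
proof (rule subsetI, rule ccontr)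
  fix p assume pint: "p \<in> interior (orbit_domain l)" and "p \<notin> upper_basin l \<union> (\<Union>k. basin k)"
  then have pU: "p \<notin> upper_basin l" and pB: "\<And>k. p \<notin> basin k" by auto
  have porb: "p \<in> orbit_domain l" using pint interior_subset by blast
  obtain e0 where e0: "e0 > 0" "ball p e0 \<subseteq> orbit_domain l"
    using pint by (auto simp: mem_interior)
  \<comment> \<open>On this smaller disc all points avoid \<open>upper_basin l\<close>, so every
    iterate maps the disc below the real axis.\<close>
  define e where "e = e0 / 4"
  have e: "e > 0" "ball p e \<subseteq> orbit_domain l" using e0 by (auto simp: e_def)
  have dis: "ball p e \<inter> upper_basin l = {}"
    using upper_basin_closed_in_orbit_domain[OF Im_pos e0 pU] by (simp add: e_def)
  have Im_le: "Im ((ftan l ^^ n) y) \<le> 0" if "y \<in> ball p e" for n y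
    using Im_nonpos_if_notin_upper_basin[OF Im_pos] that e(2) dis by blast
  have ppe: "p \<in> ball p e" using e by simp
  obtain n0 :: "nat \<Rightarrow> nat" and j0 :: "nat \<Rightarrow> int" and w where n0: "strict_mono n0"
    "(\<lambda>k. (ftan l ^^ n0 k) p - of_int (j0 k) * of_real pi) \<longlonglongrightarrow> w"
    using recurrent_subsequence[OF Im_le[OF ppe]] by metis
  have Imw: "Im w \<le> 0"
  proof (rule LIMSEQ_le_const2)
    show "(\<lambda>k. Im ((ftan l ^^ n0 k) p - of_int (j0 k) * of_real pi)) \<longlonglongrightarrow> Im w"
      using n0(2) by (rule tendsto_Im)
    show "\<exists>N. \<forall>n\<ge>N. Im ((ftan l ^^ n0 n) p - of_int (j0 n) * of_real pi) \<le> 0"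
      using Im_le[OF ppe] by simp
  qed
  have wB: "w \<notin> basin k" for k
  proof
    assume "w \<in> basin k"
    then have "\<forall>\<^sub>F i in sequentially. (ftan l ^^ n0 i) p - of_int (j0 i) * of_real pi \<in> basin k"
      using topological_tendstoD[OF n0(2) open_basin] by blast
    then obtain i where "(ftan l ^^ n0 i) p - of_int (j0 i) * of_real pi \<in> basin k"
      using eventually_happens'[OF sequentially_bot] by blast
    then have "(ftan l ^^ n0 i) p \<in> basin (k + j0 i)"
      using basin_add_int_pi[of "(ftan l ^^ n0 i) p - of_int (j0 i) * of_real pi" "j0 i" k] by simp
    then show False using funpow_basin[OF porb] pB by blast
  qed
  have wQ: "w \<notin> postcrit" using wB postcrit_subset_basins by blast
  obtain t where t: "closed_segment w (of_real t + \<i> / 2) \<inter> postcrit = {}"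
    using segment_avoiding_countable[OF Imw countable_postcrit wQ] by blast
  define u where "u = of_real t + \<i> / 2"
  have Imu: "Im u = 1/2" by (simp add: u_def)
  obtain d0 where d0: "d0 > 0" "\<And>x y. x \<in> closed_segment w u \<Longrightarrow> y \<in> postcrit \<Longrightarrow> d0 \<le> dist x y"
    using separate_compact_closed[OF compact_segment closed_postcrit t] unfolding u_def by blast
  \<comment> \<open>Points are displaced by less than \<open>2 * \<epsilon>\<close>: once for the
    thickness of \<open>D\<close>, once for the distance of \<open>d i\<close> from a multiple of
    \<open>pi\<close>. The bound \<open>d0 / 4\<close> keeps them off \<open>postcrit\<close>;
    \<open>1/8\<close> keeps them below height 1, and those near \<open>u\<close> above height
    0.\<close>
  define \<epsilon> where "\<epsilon> = min (d0 / 4) (1/8)"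
  have \<epsilon>: "\<epsilon> > 0" "2 * \<epsilon> < d0" "\<epsilon> \<le> 1/8" using d0 by (auto simp: \<epsilon>_def)
  define D where "D = (\<Union>x\<in>closed_segment w u. \<Union>y\<in>ball 0 \<epsilon>. {x + y})"
  have opD: "open D" unfolding D_def by (intro open_sums) auto
  have cvD: "convex D" unfolding D_def by (intro convex_sums) auto
  have ballD: "ball x \<epsilon> \<subseteq> D" if "x \<in> closed_segment w u" for x
  proof
    fix y assume "y \<in> ball x \<epsilon>"
    then have "y - x \<in> ball 0 \<epsilon>" "y = x + (y - x)" by (auto simp: dist_norm norm_minus_commute)
    then show "y \<in> D" unfolding D_def using that by blast
  qed
  have wD: "w \<in> D" and uD: "ball u \<epsilon> \<subseteq> D" using ballD[of w] ballD[of u] \<epsilon> by auto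
  have Imseg: "Im x \<le> 1/2" if x: "x \<in> closed_segment w u" for x
  proof -
    obtain s where s: "0 \<le> s" "s \<le> 1" "x = (1 - s) *\<^sub>R w + s *\<^sub>R u" using x by (auto simp: in_segment)
    have "(1 - s) * Im w \<le> 0" using s Imw by (intro mult_nonneg_nonpos) auto
    moreover have "Im x = (1 - s) * Im w + s * (1/2)" unfolding s(3) using Imu by simp
    ultimately show ?thesis using s(2) by linarith
  qed
  obtain N0 where N0: "\<And>i. i \<ge> N0 \<Longrightarrow> dist ((ftan l ^^ n0 i) p - of_int (j0 i) * of_real pi) w < \<epsilon>"
    using tendstoD[OF n0(2) \<epsilon>(1)] by (auto simp: eventually_sequentially)
  \<comment> \<open>The offset by \<open>N0\<close> makes the closeness to \<open>w\<close> hold for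
    all \<open>i\<close>; the extra 1 ensures \<open>n i >= 1\<close>, so that values of the
    branches themselves avoid the poles.\<close>
  define n where "n = (\<lambda>i. n0 (i + N0 + 1))"
  define j where "j = (\<lambda>i. j0 (i + N0 + 1))"
  have n: "strict_mono n" "n i \<ge> 1" for i
  proof -
    show "strict_mono n" using n0(1) by (simp add: n_def strict_mono_def)
    have "i + N0 + 1 \<le> n0 (i + N0 + 1)" using strict_mono_imp_increasing[OF n0(1)] by blast
    then show "n i \<ge> 1" by (simp add: n_def)
  qed
  \<comment> \<open>Precomposing the branches with the translation by \<open>d i\<close> gives them
    the common domain \<open>D\<close> and the common base point \<open>w\<close>, although the
    orbit points themselves may be unbounded.\<close>
  define d where "d = (\<lambda>i. (ftan l ^^ n i) p - w)"
  have dj: "cmod (d i - of_int (j i) * of_real pi) < \<epsilon>" for i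
    using N0[of "i + N0 + 1"] by (simp add: d_def n_def j_def dist_norm algebra_simps)
  have Dd: "x + d i \<notin> postcrit" "Im (x + d i) < 1" "Im (x + d i) > Im x - \<epsilon>" if x: "x \<in> D" for x i
  proof -
    obtain s y where sy: "s \<in> closed_segment w u" "norm y < \<epsilon>" "x = s + y"
      using x by (auto simp: D_def)
    define v where "v = y + (d i - of_int (j i) * of_real pi)"
    have v: "cmod v < 2 * \<epsilon>" using norm_triangle_ineq[of y "d i - of_int (j i) * of_real pi"] sy(2) dj[of i]
      by (simp add: v_def)
    have xd: "x + d i = (s + v) + of_int (j i) * of_real pi" by (simp add: v_def sy(3))
    show "x + d i \<notin> postcrit"
    proof
      assume "x + d i \<in> postcrit"
      then have "x + d i + of_int (- j i) * of_real pi \<in> postcrit" by (rule postcrit_shift)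
      then have "s + v \<in> postcrit" unfolding xd by simp
      then have "d0 \<le> dist s (s + v)" using d0(2) sy(1) by blast
      then show False using v \<epsilon>(2) by (simp add: dist_norm)
    qed
    have "Im (x + d i) = Im s + Im v" unfolding xd by simp
    moreover have "Im v \<le> cmod v" using abs_Im_le_cmod[of v] by linarith
    ultimately show "Im (x + d i) < 1" using Imseg[OF sy(1)] v \<epsilon>(3) by linarith
    have "Im (x + d i) = Im x + Im (d i - of_int (j i) * of_real pi)" by simp
    moreover have "\<bar>Im (d i - of_int (j i) * of_real pi)\<bar> < \<epsilon>"
      using dj[of i] abs_Im_le_cmod[of "d i - of_int (j i) * of_real pi"] by linarith
    ultimately show "Im (x + d i) > Im x - \<epsilon>" by linarith
  qed
  have "\<exists>h. h holomorphic_on D \<and> h w = p \<and> (\<forall>x\<in>D. (\<forall>j<n i. (ftan l ^^ j) (h x) \<in> tan_domain) \<and> (ftan l ^^ n i) (h x) = x + d i)" for i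
  proof -
    define D' where "D' = (\<lambda>x. x + d i) ` D"
    have "\<exists>h. h holomorphic_on D' \<and> h ((ftan l ^^ n i) p) = p \<and>
       (\<forall>x\<in>D'. h x \<in> tan_preimages l (n i) D' \<and> (ftan l ^^ n i) (h x) = x)"
    proof (rule inverse_branch)
      have "D' = (\<lambda>x. d i + x) ` D" by (auto simp: D'_def add.commute)
      then show "open D'" "simply_connected D'"
        using opD cvD by (auto intro!: open_translation convex_imp_simply_connected convex_translation)
      show "(ftan l ^^ j) p \<in> tan_domain" for j using porb by (simp add: orbit_domain_def)
      have "(ftan l ^^ n i) p = w + d i" by (simp add: d_def)
      then show "(ftan l ^^ n i) p \<in> D'" using wD by (simp add: D'_def)
      fix a C z assume a: "a < n i" "C \<subseteq> tan_preimages l (n i - a) D'" "z \<in> C"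
      show "2 + (tan z)\<^sup>2 \<noteq> 0"
      proof (rule postcrit_pullback[OF a(1)])
        show "z \<in> tan_preimages l (n i - a) D'" using a by blast
        show "D' \<inter> postcrit = {}" using Dd(1) by (auto simp: D'_def)
        show "Im x < 1" if "x \<in> D'" for x using Dd(2) that by (auto simp: D'_def)
      qed
    qed
    then obtain h where h: "h holomorphic_on D'" "h ((ftan l ^^ n i) p) = p"
       "\<And>x. x \<in> D' \<Longrightarrow> h x \<in> tan_preimages l (n i) D'" "\<And>x. x \<in> D' \<Longrightarrow> (ftan l ^^ n i) (h x) = x" by blast
    show ?thesis
    proof (intro exI[of _ "\<lambda>x. h (x + d i)"] conjI ballI)
      have "h \<circ> (\<lambda>x. x + d i) holomorphic_on D"
        using h(1) by (intro holomorphic_on_compose holomorphic_intros) (simp add: D'_def)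
      then show "(\<lambda>x. h (x + d i)) holomorphic_on D" by (simp add: o_def)
      show "h (w + d i) = p" using h(2) by (simp add: d_def)
      fix x assume "x \<in> D"
      then have x: "x + d i \<in> D'" by (simp add: D'_def)
      show "(ftan l ^^ n i) (h (x + d i)) = x + d i" using h(4)[OF x] .
      show "\<forall>j<n i. (ftan l ^^ j) (h (x + d i)) \<in> tan_domain"
        using h(3)[OF x] unfolding mem_tan_preimages_iff by blast
    qed
  qed
  then obtain h where h: "\<And>i. h i holomorphic_on D" "\<And>i. h i w = p"
    "\<And>i j x. x \<in> D \<Longrightarrow> j < n i \<Longrightarrow> (ftan l ^^ j) (h i x) \<in> tan_domain"
    "\<And>i x. x \<in> D \<Longrightarrow> (ftan l ^^ n i) (h i x) = x + d i"
    by metis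
  have hdom: "h i x \<in> tan_domain" if "x \<in> D" for i x
    using h(3)[OF that, of 0 i] n(2)[of i] by simp
  have conD: "connected D" using cvD by (rule convex_connected)
  have bdd: "\<exists>B. \<forall>f\<in>range h. \<forall>z\<in>K. norm (f z) \<le> B" if K: "compact K" "K \<subseteq> D" for K
  proof -
    obtain B where "\<And>i z. z \<in> K \<Longrightarrow> norm (h i z) \<le> B"
      using locally_bounded_if_omits_two_values[where h = h, OF opD conD wD h(1) hdom h(2) K] by metis
    then show ?thesis by blast
  qed
  obtain H \<sigma> where H: "H holomorphic_on D" "strict_mono \<sigma>"
    "\<And>x. x \<in> D \<Longrightarrow> ((\<lambda>i. h (\<sigma> i) x) \<longlonglongrightarrow> H x)"
    "\<And>K. compact K \<Longrightarrow> K \<subseteq> D \<Longrightarrow> uniform_limit K (h \<circ> \<sigma>) H sequentially"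
    using Montel[of D "range h" h, OF opD _ bdd] h(1) by blast
  define S where "S = ball u \<epsilon>"
  have uS: "u \<in> S" using \<epsilon> by (simp add: S_def)
  \<comment> \<open>For a nonconstant limit, Hurwitz makes \<open>y = H u\<close> a value on
    \<open>S\<close> of branches with arbitrarily large index. Then \<open>y\<close> lies in the
    upper basin, but its orbit has height below 1 at arbitrarily late times.\<close>
  have constS: "H constant_on S"
  proof (rule ccontr)
    assume nc: "\<not> H constant_on S"
    define y where "y = H u"
    have ex: "\<exists>i\<ge>K. \<exists>x\<in>S. h (\<sigma> i) x = y" for K
    proof (rule ccontr)
      assume "\<not> ?thesis"
      then have ne: "\<And>i x. i \<ge> K \<Longrightarrow> x \<in> S \<Longrightarrow> h (\<sigma> i) x \<noteq> y" by blast
      have "H u - y \<noteq> 0"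
      proof (rule Hurwitz_no_zeros[where \<F> = "\<lambda>i x. h (\<sigma> (i + K)) x - y" and S = S and g = "\<lambda>x. H x - y"])
        show "open S" "connected S" by (auto simp: S_def)
        show "(\<lambda>x. h (\<sigma> (i + K)) x - y) holomorphic_on S" for i
          by (intro holomorphic_intros holomorphic_on_subset[OF h(1)]) (use uD in \<open>simp add: S_def\<close>)
        show "(\<lambda>x. H x - y) holomorphic_on S"
          by (intro holomorphic_intros holomorphic_on_subset[OF H(1)]) (use uD in \<open>simp add: S_def\<close>)
        show "\<not> (\<lambda>x. H x - y) constant_on S"
        proof
          assume "(\<lambda>x. H x - y) constant_on S"
          then obtain c where "\<And>x. x \<in> S \<Longrightarrow> H x - y = c" by (auto simp: constant_on_def)
          then have "\<And>x. x \<in> S \<Longrightarrow> H x = c + y" by (simp add: algebra_simps)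
          then show False using nc by (auto simp: constant_on_def)
        qed
        show "h (\<sigma> (i + K)) z - y \<noteq> 0" if "z \<in> S" for i z using ne[of "i + K" z] that by simp
        fix L assume L: "compact L" "L \<subseteq> S"
        have "uniform_limit L (h \<circ> \<sigma>) H sequentially"
          using H(4) L uD by (auto simp: S_def)
        then have "uniform_limit L (\<lambda>i. (h \<circ> \<sigma>) (i + K)) H sequentially"
          unfolding uniform_limit_iff
          by (subst eventually_sequentially_seg) blast
        then show "uniform_limit L (\<lambda>i x. h (\<sigma> (i + K)) x - y) (\<lambda>x. H x - y) sequentially"
          by (intro uniform_limit_intros) (simp add: o_def)
      qed (rule uS)
      then show False by (simp add: y_def)
    qed
    have yU: "y \<in> upper_basin l \<and> (\<exists>i\<ge>K. Im ((ftan l ^^ n i) y) < 1)" for K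
    proof -
      obtain i x where i: "i \<ge> K" "x \<in> S" "h (\<sigma> i) x = y" using ex by blast
      have xD: "x \<in> D" using i(2) uD by (auto simp: S_def)
      have Fy: "(ftan l ^^ n (\<sigma> i)) y = x + d (\<sigma> i)" using h(4)[OF xD, of "\<sigma> i"] i(3) by simp
      have "\<bar>Im (x - u)\<bar> < \<epsilon>"
        using i(2) abs_Im_le_cmod[of "x - u"] by (simp add: S_def dist_norm norm_minus_commute)
      then have Im0: "Im (x + d (\<sigma> i)) > 0" using Dd(3)[OF xD, of "\<sigma> i"] Imu \<epsilon>(3) by simp
      have "\<forall>j<n (\<sigma> i). (ftan l ^^ j) y \<in> tan_domain" using h(3)[OF xD, of _ "\<sigma> i"] i(3) by simp
      then have "y \<in> tan_preimages l (n (\<sigma> i)) {z. 0 < Im z}"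
        using Im0 unfolding mem_tan_preimages_iff Fy by simp
      then have "y \<in> upper_basin l" unfolding upper_basin_def by blast
      moreover have "\<sigma> i \<ge> K" using i(1) strict_mono_imp_increasing[OF H(2), of i] by linarith
      ultimately show ?thesis using Dd(2)[OF xD, of "\<sigma> i"] Fy by auto
    qed
    have "filterlim (\<lambda>m. Im ((ftan l ^^ m) y)) at_top sequentially"
      using upper_basin_Im_at_top[OF Im_pos] yU by blast
    then have "\<forall>\<^sub>F m in sequentially. 1 < Im ((ftan l ^^ m) y)"
      unfolding filterlim_at_top_dense by blast
    then obtain M where M: "\<And>m. m \<ge> M \<Longrightarrow> 1 < Im ((ftan l ^^ m) y)" by (auto simp: eventually_sequentially)
    obtain i where i: "i \<ge> M" "Im ((ftan l ^^ n i) y) < 1" using yU by blast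
    have "n i \<ge> M" using i(1) strict_mono_imp_increasing[OF n(1), of i] by linarith
    then show False using M i(2) by fastforce
  qed
  then obtain c where c: "\<And>x. x \<in> S \<Longrightarrow> H x = c" by (auto simp: constant_on_def)
  \<comment> \<open>Constancy spreads from the end \<open>u\<close> of the region to the end
    \<open>w\<close>, where the derivatives of the branches must therefore tend to 0.\<close>
  have cD: "H x = c" if "x \<in> D" for x
    by (rule analytic_continuation_open[of S D H "\<lambda>_. c"])
      (use uS uD opD conD H(1) c that in \<open>auto simp: S_def\<close>)
  have wball: "ball w \<epsilon> \<subseteq> D" using ballD by simp
  have "(\<lambda>i. (deriv ^^ 1) ((h \<circ> \<sigma>) i) w) \<longlonglongrightarrow> (deriv ^^ 1) H w"
  proof (rule higher_deriv_complex_uniform_limit)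
    have "cball w (\<epsilon>/2) \<subseteq> D" using wball \<epsilon>(1) by (auto simp: subset_iff)
    then show "uniform_limit (ball w (\<epsilon>/2)) (h \<circ> \<sigma>) H sequentially"
      using H(4)[of "cball w (\<epsilon>/2)"] uniform_limit_on_subset[OF _ ball_subset_cball] by auto
    have "ball w (\<epsilon>/2) \<subseteq> D" using wball \<epsilon>(1) by (auto simp: subset_iff)
    then show "\<forall>\<^sub>F i in sequentially. (h \<circ> \<sigma>) i holomorphic_on ball w (\<epsilon>/2)"
      by (intro always_eventually allI) (simp add: holomorphic_on_subset[OF h(1)])
  qed (use \<epsilon> in auto)
  moreover have "deriv H w = 0"
  proof (rule DERIV_imp_deriv, rule has_field_derivative_transform_within_open)
    show "((\<lambda>_. c) has_field_derivative 0) (at w)" by simp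
  qed (use opD wD cD in auto)
  ultimately have lim0: "(\<lambda>i. cmod (deriv (h (\<sigma> i)) w)) \<longlonglongrightarrow> 0"
    using tendsto_norm_zero by fastforce
  \<comment> \<open>Bound for the derivative of the iterates at \<open>p\<close>: Cauchy's estimate
    for \<open>exp (- \<i> * F^n)\<close> gives \<open>2 / e\<close> times \<open>exp\<close> of
    minus the height of the iterate, and that height is at least \<open>Im w - \<epsilon>\<close>.
    By the chain rule the branch derivatives then stay above \<open>1 / C\<close>.\<close>
  define C where "C = (2 / e) * exp (\<epsilon> - Im w)"
  have C: "C > 0" using e by (simp add: C_def)
  have lower: "1 / C \<le> cmod (deriv (h i) w)" for i
  proof -
    have holF: "(ftan l ^^ n i) holomorphic_on ball p e" by (rule holomorphic_funpow_ftan[OF e(2)])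
    have dF: "((ftan l ^^ n i) has_field_derivative deriv (ftan l ^^ n i) p) (at p)"
      using holomorphic_derivI[OF holF open_ball ppe] .
    have dh: "(h i has_field_derivative deriv (h i) w) (at w)"
      using holomorphic_derivI[OF h(1) opD wD] .
    have "((ftan l ^^ n i) \<circ> h i has_field_derivative deriv (ftan l ^^ n i) p * deriv (h i) w) (at w)"
      using dF by (intro DERIV_chain dh) (simp add: h(2))
    moreover have "((ftan l ^^ n i) \<circ> h i has_field_derivative 1) (at w)"
    proof (rule has_field_derivative_transform_within_open)
      show "((\<lambda>x. x + d i) has_field_derivative 1) (at w)" by (rule derivative_eq_intros | simp)+
    qed (use opD wD h(4) in auto)
    ultimately have "deriv (ftan l ^^ n i) p * deriv (h i) w = 1" by (rule DERIV_unique)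
    then have prod: "cmod (deriv (ftan l ^^ n i) p) * cmod (deriv (h i) w) = 1"
      by (metis norm_mult norm_one)
    define g where "g = (\<lambda>x. exp (- \<i> * (ftan l ^^ n i) x))"
    have "cmod (deriv g p) \<le> 2 / e"
    proof (rule deriv_bound_if_bounded_1)
      show "g holomorphic_on ball p e" unfolding g_def by (intro holomorphic_intros holF)
    qed (use e Im_le in \<open>auto simp: g_def\<close>)
    moreover have "(g has_field_derivative exp (- \<i> * (ftan l ^^ n i) p) * (- \<i> * deriv (ftan l ^^ n i) p)) (at p)"
      unfolding g_def by (rule derivative_eq_intros dF refl | simp)+
    then have "deriv g p = exp (- \<i> * (ftan l ^^ n i) p) * (- \<i> * deriv (ftan l ^^ n i) p)"
      by (rule DERIV_imp_deriv)
    then have "cmod (deriv g p) = exp (Im ((ftan l ^^ n i) p)) * cmod (deriv (ftan l ^^ n i) p)"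
      by (simp add: norm_mult)
    ultimately have b1: "exp (Im ((ftan l ^^ n i) p)) * cmod (deriv (ftan l ^^ n i) p) \<le> 2 / e" by simp
    have "Im ((ftan l ^^ n i) p) = Im (w + d i)" by (simp add: d_def)
    then have "Im w - \<epsilon> \<le> Im ((ftan l ^^ n i) p)" using Dd(3)[OF wD, of i] by linarith
    then have "exp (Im w - \<epsilon>) * cmod (deriv (ftan l ^^ n i) p) \<le> 2 / e"
      using b1 by (meson exp_le_cancel_iff mult_right_mono norm_ge_zero order_trans)
    then have "exp (\<epsilon> - Im w) * (exp (Im w - \<epsilon>) * cmod (deriv (ftan l ^^ n i) p)) \<le> exp (\<epsilon> - Im w) * (2 / e)"
      by (intro mult_left_mono) auto
    moreover have "exp (\<epsilon> - Im w) * (exp (Im w - \<epsilon>) * cmod (deriv (ftan l ^^ n i) p)) = cmod (deriv (ftan l ^^ n i) p)"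
      by (simp flip: exp_add mult.assoc)
    ultimately have "cmod (deriv (ftan l ^^ n i) p) \<le> C" unfolding C_def by (simp only: mult.commute)
    then have "1 \<le> C * cmod (deriv (h i) w)"
      using prod mult_right_mono[of "cmod (deriv (ftan l ^^ n i) p)" C "cmod (deriv (h i) w)"] by simp
    then show ?thesis using C by (simp add: pos_divide_le_eq mult.commute)
  qed
  have "1 / C \<le> 0"
    by (rule LIMSEQ_le_const[OF lim0]) (use lower in blast)
  then show False using C by simp
qed

end

section \<open>Components of the basins\<close>

context attracting_tan
begin

definition all_basins :: "complex set" where
  "all_basins = upper_basin l \<union> (\<Union>k. basin k)"

lemma fatou_set_eq_basins:
  assumes "m \<noteq> 0"
  shows "fatou_set (ftan (l + of_int m * of_real pi)) tan_domain = all_basins"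
  unfolding all_basins_def
  using fatou_set_subset_interior_orbit_domain[of m] interior_orbit_domain_subset
    upper_basin_subset_fatou_set[of m] basin_subset_fatou_set[OF assms] by blast

abbreviation basin_component :: "int \<Rightarrow> complex \<Rightarrow> complex set" where
  "basin_component k z \<equiv> connected_component_set (basin k) z"

lemma all_basins_component:
  assumes "z \<in> basin k"
  shows "connected_component_set all_basins z = basin_component k z"
proof -
  have eq: "all_basins = basin k \<union> (upper_basin l \<union> (\<Union>j\<in>-{k}. basin j))"
    by (auto simp: all_basins_def)
  have dis: "basin k \<inter> (upper_basin l \<union> (\<Union>j\<in>-{k}. basin j)) = {}"
  proof -
    have "basin k \<inter> basin j = {}" if "j \<in> - {k}" for j using basin_disjoint[of k j] that by simp
    then have "basin k \<inter> (\<Union>j\<in>-{k}. basin j) = {}" by (simp add: Int_UN_distrib)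
    then show ?thesis using basin_upper_basin_disjoint[of k] by (simp add: Int_Un_distrib)
  qed
  show ?thesis unfolding eq
    by (rule connected_component_set_disjoint_Un[OF open_basin _ dis assms])
       (intro open_Un open_upper_basin open_UN ballI open_basin)
qed

lemma all_basins_component_upper:
  assumes "z \<in> upper_basin l"
  shows "connected_component_set all_basins z = upper_basin l"
proof -
  have dis: "upper_basin l \<inter> (\<Union>j. basin j) = {}"
    using basin_upper_basin_disjoint by blast
  have "connected_component_set all_basins z = connected_component_set (upper_basin l) z"
    unfolding all_basins_def
    by (rule connected_component_set_disjoint_Un[OF open_upper_basin _ dis assms]) (intro open_UN ballI open_basin)
  also have "\<dots> = upper_basin l"
    using connected_component_eq_self[OF connected_upper_basin[OF Im_pos] assms] .
  finally show ?thesis .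
qed

lemma connected_subset_basins:
  assumes T: "connected T" "T \<subseteq> (\<Union>k. basin k)" "x \<in> T" "x \<in> basin k"
  shows "T \<subseteq> basin k"
proof -
  have "open (\<Union>j\<in>-{k}. basin j)" by (intro open_UN ballI open_basin)
  moreover have "T \<subseteq> basin k \<union> (\<Union>j\<in>-{k}. basin j)" using T(2) by auto
  moreover have "basin k \<inter> (\<Union>j\<in>-{k}. basin j) \<inter> T = {}"
  proof -
    have "basin k \<inter> basin j = {}" if "j \<in> - {k}" for j using basin_disjoint[of k j] that by simp
    then have "basin k \<inter> (\<Union>j\<in>-{k}. basin j) = {}" by (simp add: Int_UN_distrib)
    then show ?thesis by simp
  qed
  ultimately have "basin k \<inter> T = {} \<or> (\<Union>j\<in>-{k}. basin j) \<inter> T = {}"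
    by (intro connectedD[OF T(1) open_basin])
  then show ?thesis using T \<open>T \<subseteq> basin k \<union> (\<Union>j\<in>-{k}. basin j)\<close> by blast
qed

lemma unbounded_upper_basin: "\<not> bounded (upper_basin l)"
proof
  assume "bounded (upper_basin l)"
  then obtain B where B: "\<And>z. z \<in> upper_basin l \<Longrightarrow> cmod z \<le> B" by (auto simp: bounded_iff)
  have "of_real (\<bar>B\<bar> + 1) * \<i> \<in> upper_basin l"
    using upper_halfplane_subset_upper_basin[of l] by auto
  then have "cmod (of_real (\<bar>B\<bar> + 1) * \<i>) \<le> B" by (rule B)
  then show False by (simp add: norm_mult)
qed

text \<open>The region enclosed by a loop avoids the unbounded connected set \<open>upper_basin l\<close>, hence also
  its accumulation points, the poles.\<close>
lemma inside_subset_basins: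
  assumes S: "compact S" "S \<inter> upper_basin l = {}"
  shows "inside S \<subseteq> (\<Union>k. basin k)"
proof -
  have opI: "open (inside S)" by (rule open_inside[OF compact_imp_closed[OF S(1)]])
  have dis: "inside S \<inter> upper_basin l = {}"
  proof (rule ccontr)
    assume "inside S \<inter> upper_basin l \<noteq> {}"
    then obtain y where y: "y \<in> inside S" "y \<in> upper_basin l" by blast
    have "upper_basin l \<subseteq> connected_component_set (- S) y"
      by (rule connected_component_maximal[OF y(2) connected_upper_basin[OF Im_pos]]) (use S in blast)
    moreover have "bounded (connected_component_set (- S) y)" using y(1) by (simp add: inside_def)
    ultimately show False using unbounded_upper_basin bounded_subset by blast
  qed
  then have "inside S \<inter> closure (upper_basin l) = {}"
    using open_Int_closure_eq_empty[OF opI] by simp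
  then have "inside S \<subseteq> orbit_domain l"
    using orbit_domain_if_notin_closure_upper_basin[OF Im_pos] by blast
  then have "inside S \<subseteq> interior (orbit_domain l)" using opI interior_maximal by blast
  then show ?thesis using interior_orbit_domain_subset dis by blast
qed

text \<open>A loop in the component with nonzero winding number about \<open>x\<close> has
  \<open>x\<close> in its inside. The loop with its inside is connected and covered by basins, so it
  lies in one basin and in the same component.\<close>

lemma simply_connected_basin_component:
  assumes z: "z \<in> basin k"
  shows "simply_connected (basin_component k z)"
proof -
  define Y where "Y = basin_component k z"
  have opY: "open Y" unfolding Y_def by (rule open_connected_component[OF open_basin])
  have conY: "connected Y" unfolding Y_def by simp
  have subY: "Y \<subseteq> basin k" unfolding Y_def by (rule connected_component_subset)
  have "winding_number g x = 0"
    if g: "path g" "path_image g \<subseteq> Y" "pathfinish g = pathstart g" and x: "x \<notin> Y" for g x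
  proof (rule ccontr)
    assume nz: "winding_number g x \<noteq> 0"
    have "x \<notin> path_image g" using x g(2) by blast
    moreover have "x \<notin> outside (path_image g)" using winding_number_zero_in_outside[OF g(1,3)] nz by blast
    ultimately have xin: "x \<in> inside (path_image g)" using inside_Un_outside[of "path_image g"] by blast
    have comp: "compact (path_image g)" using g(1) by (rule compact_path_image)
    have "path_image g \<inter> upper_basin l = {}" using g(2) subY basin_upper_basin_disjoint[of k] by blast
    from inside_subset_basins[OF comp this]
    have sub: "path_image g \<union> inside (path_image g) \<subseteq> (\<Union>k. basin k)" using g(2) subY by blast
    have con: "connected (path_image g \<union> inside (path_image g))"
      by (rule connected_with_inside[OF compact_imp_closed[OF comp] connected_path_image[OF g(1)]])
    have st: "pathstart g \<in> Y" using g(2) pathstart_in_path_image by blast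
    have "path_image g \<union> inside (path_image g) \<subseteq> basin k"
      by (rule connected_subset_basins[OF con sub, of "pathstart g"]) (use st subY in auto)
    then have "path_image g \<union> inside (path_image g) \<subseteq> connected_component_set (basin k) (pathstart g)"
      by (intro connected_component_maximal con) auto
    also have "\<dots> = Y" using st unfolding Y_def by (metis connected_component_eq)
    finally show False using xin x by blast
  qed
  then show ?thesis
    unfolding Y_def[symmetric] simply_connected_eq_winding_number_zero[OF opY] using conY by blast
qed

text \<open>Backward invariance keeps the preimage of the image component inside
  \<open>basin k\<close>, so components of the basin are exactly components of such preimages, and
  the covering results apply to them.\<close>

lemma basin_component_preimage:
  assumes z: "z \<in> basin k"
  shows "basin_component k z \<in> components (tan_preimage l (basin_component k (ftan l z)))"
    and "ftan l ` basin_component k z = basin_component k (ftan l z)"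
proof -
  define Y where "Y = basin_component k z"
  define Z where "Z = basin_component k (ftan l z)"
  have Yb: "Y \<subseteq> basin k" and Zb: "Z \<subseteq> basin k"
    unfolding Y_def Z_def by (rule connected_component_subset)+
  have bd: "basin k \<subseteq> tan_domain" using basin_subset orbit_domain_subset by blast
  have zY: "z \<in> Y" using z by (simp add: Y_def)
  have "connected (ftan l ` Y)"
    using continuous_on_subset[OF continuous_on_ftan] Yb bd
    by (intro connected_continuous_image) (auto simp: Y_def)
  moreover have "ftan l ` Y \<subseteq> basin k" using Yb bd basin_step by blast
  ultimately have "ftan l ` Y \<subseteq> Z"
    unfolding Z_def using zY by (intro connected_component_maximal) auto
  then have YZ: "Y \<subseteq> tan_preimage l Z" using Yb bd by (auto simp: tan_preimage_def)
  have Zp: "tan_preimage l Z \<subseteq> basin k" using Zb basin_step by (auto simp: tan_preimage_def)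
  have "connected_component_set (tan_preimage l Z) z = Y"
  proof
    show "connected_component_set (tan_preimage l Z) z \<subseteq> Y"
      unfolding Y_def by (rule connected_component_mono[OF Zp])
    show "Y \<subseteq> connected_component_set (tan_preimage l Z) z"
      by (rule connected_component_maximal[OF zY _ YZ]) (simp add: Y_def)
  qed
  then have Ycomp: "Y \<in> components (tan_preimage l Z)" using zY YZ componentsI by (metis subsetD)
  then show "basin_component k z \<in> components (tan_preimage l (basin_component k (ftan l z)))"
    by (simp add: Y_def Z_def)
  have "open Z" unfolding Z_def by (rule open_connected_component[OF open_basin])
  then show "ftan l ` basin_component k z = basin_component k (ftan l z)"
    using ftan_component_onto[OF _ _ Ycomp] by (simp add: Y_def Z_def)
qed

section \<open>The translated immediate basins\<close>

definition immediate :: "int \<Rightarrow> complex set" where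
  "immediate k = basin_component k (z0 + of_int k * of_real pi)"

lemma immediate_0: "immediate 0 = immediate_basin"
  by (simp add: immediate_def immediate_basin_def)

lemma immediate_subset: "immediate k \<subseteq> basin k"
  unfolding immediate_def by (rule connected_component_subset)

lemma fixed_point_immediate: "z0 + of_int k * of_real pi \<in> immediate k"
  using z0_basin by (simp add: immediate_def)

lemma open_immediate: "open (immediate k)"
  unfolding immediate_def by (rule open_connected_component[OF open_basin])

lemma immediate_eq_component: "z \<in> immediate k \<Longrightarrow> basin_component k z = immediate k"
  unfolding immediate_def by (metis connected_component_eq)

lemma immediate_add_subset: "(\<lambda>z. z + of_int j * of_real pi) ` immediate k \<subseteq> immediate (k + j)"
proof -
  have "(\<lambda>z. z + of_int j * of_real pi) ` immediate k \<subseteq> basin (k + j)"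
    using immediate_subset[of k] basin_add_int_pi by blast
  moreover have "connected ((\<lambda>z. z + of_int j * of_real pi) ` immediate k)"
    by (intro connected_continuous_image continuous_intros) (simp add: immediate_def)
  moreover have "z0 + of_int (k + j) * of_real pi \<in> (\<lambda>z. z + of_int j * of_real pi) ` immediate k"
    using fixed_point_immediate[of k] by (force simp: algebra_simps)
  ultimately show ?thesis unfolding immediate_def[of "k + j"] by (intro connected_component_maximal)
qed

lemma immediate_add_iff: "z + of_int j * of_real pi \<in> immediate (k + j) \<longleftrightarrow> z \<in> immediate k"
proof
  assume "z \<in> immediate k"
  then show "z + of_int j * of_real pi \<in> immediate (k + j)" using immediate_add_subset by blast
next
  assume "z + of_int j * of_real pi \<in> immediate (k + j)"
  then have "z + of_int j * of_real pi + of_int (- j) * of_real pi \<in> immediate (k + j + (- j))"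
    using immediate_add_subset by blast
  then show "z \<in> immediate k" by simp
qed

lemma immediate_iff: "z \<in> immediate k \<longleftrightarrow> z - of_int k * of_real pi \<in> immediate_basin"
  using immediate_add_iff[of "z - of_int k * of_real pi" k 0] by (simp add: immediate_0)

lemma immediate_eq_iff: "immediate j = immediate k \<longleftrightarrow> j = k"
  using fixed_point_immediate[of j] immediate_subset[of j] immediate_subset[of k] basin_disjoint[of j k] by blast

text \<open>The translate of \<open>crit\<close> by \<open>j * pi\<close> lies in
  \<open>basin j\<close>, so disjointness forces \<open>j = k\<close>. Thus a whole basin, not only
  its immediate component, has a single critical point.\<close>

lemma critical_point_in_component:
  assumes z: "z \<in> basin k" "2 + (tan z)\<^sup>2 = 0"
  shows "z = crit + of_int k * of_real pi"
proof -
  have zd: "z \<in> tan_domain" using z basin_subset orbit_domain_subset by blast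
  obtain j :: int where j: "z = crit + of_int j * of_real pi"
    using critical_points[OF zd z(2) Im_basin[OF z(1)]] by blast
  then have "z \<in> basin j" using basin_add_int_pi[of crit j 0] crit_basin by simp
  then have "j = k" using basin_disjoint[of j k] z(1) by blast
  then show ?thesis using j by simp
qed

lemma ftan_inj_on_nonimmediate:
  assumes z: "z \<in> basin k" and ne: "basin_component k z \<noteq> immediate k"
  shows "inj_on (ftan l) (basin_component k z)"
proof (rule ftan_inj_on_component)
  have Fz: "ftan l z \<in> basin k" using z basin_step basin_subset orbit_domain_subset by blast
  show "open (basin_component k (ftan l z))" by (rule open_connected_component[OF open_basin])
  show "simply_connected (basin_component k (ftan l z))" by (rule simply_connected_basin_component[OF Fz])
  show "basin_component k z \<in> components (tan_preimage l (basin_component k (ftan l z)))"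
    by (rule basin_component_preimage(1)[OF z])
  fix w assume w: "w \<in> basin_component k z"
  show "2 + (tan w)\<^sup>2 \<noteq> 0"
  proof
    assume "2 + (tan w)\<^sup>2 = 0"
    then have "w = crit + of_int k * of_real pi"
      using critical_point_in_component w connected_component_subset by blast
    then have "w \<in> immediate k" using crit(1) by (simp add: immediate_iff)
    then have "basin_component k w = immediate k" by (rule immediate_eq_component)
    moreover have "basin_component k w = basin_component k z"
      using w by (metis connected_component_eq)
    ultimately show False using ne by simp
  qed
qed

end

section \<open>Double covers\<close>

text \<open>A Riemann map followed by the disc automorphism that sends the image of \<open>v\<close>
  to 0.\<close>

lemma Riemann_map_at:
  assumes T: "open T" "simply_connected T" "T \<noteq> UNIV" and v: "v \<in> T"
  obtains R \<phi> where "R holomorphic_on ball 0 1" "\<phi> holomorphic_on T" "R 0 = v"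
    "\<And>z. z \<in> T \<Longrightarrow> \<phi> z \<in> ball 0 1 \<and> R (\<phi> z) = z"
    "\<And>x. x \<in> ball 0 1 \<Longrightarrow> R x \<in> T \<and> \<phi> (R x) = x"
proof -
  obtain f g where fg: "f holomorphic_on T" "g holomorphic_on ball 0 1"
    "\<And>z. z \<in> T \<Longrightarrow> f z \<in> ball 0 1 \<and> g (f z) = z"
    "\<And>z. z \<in> ball 0 1 \<Longrightarrow> g z \<in> T \<and> f (g z) = z"
    using simply_connected_eq_biholomorphic_to_disc[OF T(1)] T v by blast
  obtain a b where ab: "a (f v) = 0" "a holomorphic_on ball 0 1" "a ` ball 0 1 \<subseteq> ball 0 1"
    "b holomorphic_on ball 0 1" "b ` ball 0 1 \<subseteq> ball 0 1"
    "\<And>z. z \<in> ball 0 1 \<Longrightarrow> a (b z) = z" "\<And>z. z \<in> ball 0 1 \<Longrightarrow> b (a z) = z"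
    using ball_biholomorphism_exists[of "f v"] fg(3)[OF v] by metis
  have b0: "b 0 = f v" using ab(7)[of "f v"] ab(1) fg(3)[OF v] by simp
  show ?thesis
  proof (rule that[of "g \<circ> b" "a \<circ> f"])
    show "g \<circ> b holomorphic_on ball 0 1"
      using holomorphic_on_compose[OF ab(4)] holomorphic_on_subset[OF fg(2) ab(5)] by blast
    have "f ` T \<subseteq> ball 0 1" using fg(3) by blast
    then show "a \<circ> f holomorphic_on T"
      using holomorphic_on_compose[OF fg(1)] holomorphic_on_subset[OF ab(2)] by blast
    show "(g \<circ> b) 0 = v" using b0 fg(3)[OF v] by simp
    show "(a \<circ> f) z \<in> ball 0 1 \<and> (g \<circ> b) ((a \<circ> f) z) = z" if z: "z \<in> T" for z
    proof -
      have fz: "f z \<in> ball 0 1" using fg(3)[OF z] by blast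
      then have "a (f z) \<in> ball 0 1" using ab(3) by blast
      then show ?thesis using ab(7)[OF fz] fg(3)[OF z] by simp
    qed
    show "(g \<circ> b) x \<in> T \<and> (a \<circ> f) ((g \<circ> b) x) = x" if x: "x \<in> ball 0 1" for x
    proof -
      have "b x \<in> ball 0 1" using ab(5) x by blast
      then show ?thesis using fg(4)[of "b x"] ab(6)[OF x] by auto
    qed
  qed
qed

text \<open>At a zero of order exactly 2 one has \<open>G w = ((w - c) * g w)^2\<close> with
  \<open>g\<close> zero-free. The base of this square has derivative \<open>g c\<close> at
  \<open>c\<close>, so it is locally invertible, and its inverse is \<open>k\<close>.\<close>

lemma local_square_root_chart:
  assumes W: "open W" "c \<in> W" and hol: "G holomorphic_on W" and G0: "G c = 0"
    and d1: "deriv G c = 0" and d2: "deriv (deriv G) c \<noteq> 0"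
  obtains k \<epsilon> where "0 < \<epsilon>" "\<epsilon> \<le> (1::real)" "k holomorphic_on ball 0 \<epsilon>" "k 0 = c" "inj_on k (ball 0 \<epsilon>)"
    "\<And>x. x \<in> ball 0 \<epsilon> \<Longrightarrow> k x \<in> W \<and> G (k x) = x\<^sup>2"
proof -
  have d2': "(deriv ^^ 2) G c \<noteq> 0" using d2 by (simp add: numeral_2_eq_2)
  have "(deriv ^^ i) G c = 0" if "0 < i" "i < 2" for i :: nat
  proof -
    have "i = 1" using that by simp
    then show ?thesis using d1 by simp
  qed
  then obtain g r where gr: "0 < r" "g holomorphic_on ball c r"
    "\<And>w. w \<in> ball c r \<Longrightarrow> G w - G c = ((w - c) * g w)\<^sup>2" "\<And>w. w \<in> ball c r \<Longrightarrow> g w \<noteq> 0"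
    using holomorphic_factor_order_of_zero_strong[OF hol W, of 2] d2' by (metis zero_less_numeral)
  obtain s where s: "0 < s" "ball c s \<subseteq> W" using W open_contains_ball by blast
  define B where "B = ball c (min r s)"
  have B: "open B" "c \<in> B" "B \<subseteq> W" "B \<subseteq> ball c r" using gr(1) s by (auto simp: B_def)
  define \<kappa> where "\<kappa> = (\<lambda>w. (w - c) * g w)"
  have gB: "g holomorphic_on B" using gr(2) B(4) by (rule holomorphic_on_subset)
  have hol\<kappa>: "\<kappa> holomorphic_on B"
    unfolding \<kappa>_def by (intro holomorphic_intros gB)
  have "(g has_field_derivative deriv g c) (at c)" by (rule holomorphic_derivI[OF gB B(1,2)])
  then have "(\<kappa> has_field_derivative (1 * g c + deriv g c * (c - c))) (at c)"
    unfolding \<kappa>_def by (intro DERIV_mult) (auto intro!: derivative_eq_intros)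
  then have "deriv \<kappa> c = g c" using DERIV_imp_deriv by fastforce
  then have "deriv \<kappa> c \<noteq> 0" using gr(4) B by auto
  then obtain t where t: "t > 0" "ball c t \<subseteq> B" "inj_on \<kappa> (ball c t)"
    using has_complex_derivative_locally_injective[OF hol\<kappa> B(2,1)] by metis
  have holt: "\<kappa> holomorphic_on ball c t" using hol\<kappa> t(2) by (rule holomorphic_on_subset)
  obtain k where k: "k holomorphic_on \<kappa> ` ball c t" "\<And>z. z \<in> ball c t \<Longrightarrow> k (\<kappa> z) = z"
    using holomorphic_inverse_exists[OF holt open_ball t(3)] by blast
  have "open (\<kappa> ` ball c t)"
    using invariance_of_domain[OF holomorphic_on_imp_continuous_on[OF holt] open_ball t(3)] .
  moreover have "\<kappa> c \<in> \<kappa> ` ball c t" using t(1) by simp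
  moreover have \<kappa>c: "\<kappa> c = 0" by (simp add: \<kappa>_def)
  ultimately obtain \<epsilon>0 where \<epsilon>0: "\<epsilon>0 > 0" "ball 0 \<epsilon>0 \<subseteq> \<kappa> ` ball c t"
    by (metis open_contains_ball)
  define \<epsilon> where "\<epsilon> = min \<epsilon>0 1"
  have \<epsilon>: "0 < \<epsilon>" "\<epsilon> \<le> 1" "ball 0 \<epsilon> \<subseteq> \<kappa> ` ball c t" using \<epsilon>0 by (auto simp: \<epsilon>_def)
  have kx: "k x \<in> ball c t \<and> \<kappa> (k x) = x" if x: "x \<in> ball 0 \<epsilon>" for x :: complex
  proof -
    obtain z where "z \<in> ball c t" "x = \<kappa> z" using x \<epsilon>(3) by blast
    then show ?thesis using k(2) by simp
  qed
  show ?thesis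
  proof (rule that[OF \<epsilon>(1,2)])
    show "k holomorphic_on ball 0 \<epsilon>" using k(1) \<epsilon>(3) by (rule holomorphic_on_subset)
    show "k 0 = c" using k(2)[of c] t(1) \<kappa>c by simp
    show "inj_on k (ball 0 \<epsilon>)" using kx by (intro inj_on_inverseI[of _ \<kappa>]) blast
    fix x :: complex assume x: "x \<in> ball 0 \<epsilon>"
    have "k x \<in> B" using kx[OF x] t(2) by blast
    moreover have "G (k x) - G c = (\<kappa> (k x))\<^sup>2" using gr(3)[of "k x"] \<open>k x \<in> B\<close> B(4) by (auto simp: \<kappa>_def)
    ultimately show "k x \<in> W \<and> G (k x) = x\<^sup>2" using B(3) kx[OF x] G0 by auto
  qed
qed

text \<open>Lift \<open>R (exp (2 * \<zeta>))\<close> from the left half-plane through the covering.  Near minus infinity the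
  lift agrees with a local square root at the critical point, so it is periodic and descends to the
  disc.\<close>
lemma branched_double_cover:
  assumes W: "open W" "connected W" and T: "open T" "simply_connected T" "T \<noteq> UNIV"
    and hol: "f holomorphic_on W" and fW: "f ` W \<subseteq> T" and c: "c \<in> W"
    and cov: "covering_space {z \<in> W. f z \<noteq> f c} f (T - {f c})"
    and d1: "deriv f c = 0" and d2: "deriv (deriv f) c \<noteq> 0"
  obtains R \<phi> h where "R holomorphic_on ball 0 1" "\<phi> holomorphic_on T" "R 0 = f c"
    "\<And>z. z \<in> T \<Longrightarrow> \<phi> z \<in> ball 0 1 \<and> R (\<phi> z) = z"
    "\<And>x. x \<in> ball 0 1 \<Longrightarrow> R x \<in> T \<and> \<phi> (R x) = x"
    "h holomorphic_on ball 0 1" "inj_on h (ball 0 1)" "h ` ball 0 1 = W" "h 0 = c"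
    "\<And>x. x \<in> ball 0 1 \<Longrightarrow> f (h x) = R (x\<^sup>2)"
proof -
  have vT: "f c \<in> T" using fW c by blast
  obtain R \<phi> where R: "R holomorphic_on ball 0 1" "\<phi> holomorphic_on T" "R 0 = f c"
    "\<And>z. z \<in> T \<Longrightarrow> \<phi> z \<in> ball 0 1 \<and> R (\<phi> z) = z"
    "\<And>x. x \<in> ball 0 1 \<Longrightarrow> R x \<in> T \<and> \<phi> (R x) = x"
    using Riemann_map_at[OF T vT] by metis
  have \<phi>v: "\<phi> (f c) = 0" using R(5)[of 0] R(3) by simp
  \<comment> \<open>In the disc coordinate of the target the critical value becomes 0, so
    \<open>G\<close> has a double zero at \<open>c\<close> and possesses a local square
    root.\<close>
  define G where "G = \<phi> \<circ> f"
  have holG: "G holomorphic_on W"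
    unfolding G_def using holomorphic_on_compose[OF hol] holomorphic_on_subset[OF R(2) fW] by blast
  have dG: "deriv G z = deriv \<phi> (f z) * deriv f z" if z: "z \<in> W" for z
  proof -
    have "(\<phi> has_field_derivative deriv \<phi> (f z)) (at (f z))"
      using holomorphic_derivI[OF R(2) T(1)] fW z by blast
    moreover have "(f has_field_derivative deriv f z) (at z)"
      using holomorphic_derivI[OF hol W(1) z] .
    ultimately show ?thesis unfolding G_def by (intro DERIV_imp_deriv DERIV_chain)
  qed
  have nz\<phi>: "deriv \<phi> (f c) \<noteq> 0"
  proof -
    have "(R has_field_derivative deriv R (\<phi> (f c))) (at (\<phi> (f c)))"
      by (rule holomorphic_derivI[OF R(1)]) (simp_all add: \<phi>v)
    then have "(R \<circ> \<phi> has_field_derivative deriv R (\<phi> (f c)) * deriv \<phi> (f c)) (at (f c))"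
      by (rule DERIV_chain) (rule holomorphic_derivI[OF R(2) T(1) vT])
    moreover have "(R \<circ> \<phi> has_field_derivative 1) (at (f c))"
    proof (rule has_field_derivative_transform_within_open)
      show "((\<lambda>x. x) has_field_derivative 1) (at (f c))" by simp
    qed (use T(1) vT R(4) in auto)
    ultimately have "deriv R (\<phi> (f c)) * deriv \<phi> (f c) = 1" by (rule DERIV_unique)
    then show ?thesis by auto
  qed
  have ddG: "deriv (deriv G) c \<noteq> 0"
  proof -
    have df: "(f has_field_derivative deriv f c) (at c)" by (rule holomorphic_derivI[OF hol W(1) c])
    have ddf: "(deriv f has_field_derivative deriv (deriv f) c) (at c)"
      by (rule holomorphic_derivI[OF holomorphic_deriv[OF hol W(1)] W(1) c])
    have dd\<phi>: "(deriv \<phi> has_field_derivative deriv (deriv \<phi>) (f c)) (at (f c))"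
      by (rule holomorphic_derivI[OF holomorphic_deriv[OF R(2) T(1)] T(1) vT])
    have "((\<lambda>z. (deriv \<phi> \<circ> f) z * deriv f z) has_field_derivative
        (deriv (deriv \<phi>) (f c) * deriv f c) * deriv f c + deriv (deriv f) c * (deriv \<phi> \<circ> f) c) (at c)"
      by (rule DERIV_mult[OF DERIV_chain[OF dd\<phi> df] ddf])
    then have "(deriv G has_field_derivative
        (deriv (deriv \<phi>) (f c) * deriv f c) * deriv f c + deriv (deriv f) c * (deriv \<phi> \<circ> f) c) (at c)"
      by (rule has_field_derivative_transform_within_open[OF _ W(1) c]) (simp add: dG)
    then have "deriv (deriv G) c = deriv (deriv f) c * deriv \<phi> (f c)"
      using DERIV_imp_deriv d1 by fastforce
    then show ?thesis using d2 nz\<phi> by simp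
  qed
  have "deriv G c = 0" using dG[OF c] d1 by simp
  moreover have "G c = 0" by (simp add: G_def \<phi>v)
  ultimately obtain k \<epsilon> where k: "0 < \<epsilon>" "\<epsilon> \<le> 1" "k holomorphic_on ball 0 \<epsilon>" "k 0 = c" "inj_on k (ball 0 \<epsilon>)"
    "\<And>x. x \<in> ball 0 \<epsilon> \<Longrightarrow> k x \<in> W \<and> G (k x) = x\<^sup>2"
    using local_square_root_chart[OF W(1) c holG _ _ ddG] by metis
  have sqball: "x\<^sup>2 \<in> ball 0 1" if "x \<in> ball 0 1" for x :: complex
    using that by (simp add: norm_power power_less_one_iff)
  have fk: "f (k x) = R (x\<^sup>2)" if x: "x \<in> ball 0 \<epsilon>" for x
  proof -
    have "f (k x) \<in> T" using k(6)[OF x] fW by blast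
    then have "R (\<phi> (f (k x))) = f (k x)" using R(4) by blast
    then show ?thesis using k(6)[OF x] by (simp add: G_def)
  qed
  have R_inj: "R x = R y \<longleftrightarrow> x = y" if "x \<in> ball 0 1" "y \<in> ball 0 1" for x y
    using R(5) that by metis
  define V where "V = {z \<in> W. f z \<noteq> f c}"
  have covV: "covering_space V f (T - {f c})" using cov by (simp add: V_def)
  have V_eq: "V = W \<inter> f -` (- {f c})" by (auto simp: V_def)
  have opV: "open V" unfolding V_eq
    using continuous_open_preimage[OF holomorphic_on_imp_continuous_on[OF hol] W(1)] by (simp add: open_Compl)
  have holV: "f holomorphic_on V" by (rule holomorphic_on_subset[OF hol]) (auto simp: V_def)
  \<comment> \<open>\<open>exp\<close> presents the left half-plane as universal cover of the
    punctured disc. In terms of \<open>x = exp \<zeta>\<close> the map \<open>q\<close> is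
    \<open>R (x^2)\<close>, and it lifts because \<open>L\<close> is simply connected.\<close>
  define L where "L = {\<zeta>::complex. Re \<zeta> < 0}"
  define q where "q = (\<lambda>\<zeta>. R (exp (2 * \<zeta>)))"
  have expL: "exp \<zeta> \<in> ball 0 1" if "\<zeta> \<in> L" for \<zeta> using that by (simp add: L_def)
  have exp2L: "exp (2 * \<zeta>) \<in> ball 0 1" if "\<zeta> \<in> L" for \<zeta> using that by (simp add: L_def)
  have holq: "q holomorphic_on L"
  proof -
    have "R \<circ> (\<lambda>\<zeta>. exp (2 * \<zeta>)) holomorphic_on L"
      using exp2L by (intro holomorphic_on_compose holomorphic_on_subset[OF R(1)] holomorphic_intros) auto
    then show ?thesis by (simp add: q_def o_def)
  qed
  have contq: "continuous_on L q" using holq by (rule holomorphic_on_imp_continuous_on)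
  have qim: "q \<in> L \<rightarrow> T - {f c}"
  proof
    fix \<zeta> assume z: "\<zeta> \<in> L"
    have "R (exp (2 * \<zeta>)) \<noteq> R 0" using R_inj[OF exp2L[OF z], of 0] by simp
    then show "q \<zeta> \<in> T - {f c}" using R(5)[OF exp2L[OF z]] R(3) by (simp add: q_def)
  qed
  have cvL: "convex L" unfolding L_def by (rule convex_halfspace_Re_lt)
  have opL: "open L" unfolding L_def by (rule open_halfspace_Re_lt)
  have kV: "k x \<in> V" if x: "x \<in> ball 0 \<epsilon>" "x \<noteq> 0" for x
  proof -
    have "x \<in> ball 0 1" using x k(2) by simp
    then have "R (x\<^sup>2) \<noteq> R 0" using R_inj[of "x\<^sup>2" 0] sqball x(2) by simp
    then show ?thesis using fk[OF x(1)] k(6)[OF x(1)] R(3) by (simp add: V_def)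
  qed
  define \<zeta>0 :: complex where "\<zeta>0 = of_real (ln \<epsilon> - 1)"
  \<comment> \<open>On this smaller half-plane \<open>exp\<close> lands in the domain of the chart
    \<open>k\<close>, so \<open>k (exp \<zeta>)\<close> is a lift of \<open>q\<close> there. The
    point \<open>\<zeta>0\<close> is just some point of it, used to normalise the global
    lift.\<close>
  define L' where "L' = {\<zeta>::complex. Re \<zeta> < ln \<epsilon>}"
  have lnle: "ln \<epsilon> \<le> 0" using k(1,2) by simp
  have L'L: "L' \<subseteq> L" using lnle by (auto simp: L'_def L_def)
  have \<zeta>0: "\<zeta>0 \<in> L'" "\<zeta>0 \<in> L" using L'L by (auto simp: L'_def \<zeta>0_def)
  have expL': "exp \<zeta> \<in> ball 0 \<epsilon>" if "\<zeta> \<in> L'" for \<zeta>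
  proof -
    have "exp (Re \<zeta>) < exp (ln \<epsilon>)" using that by (simp only: L'_def exp_less_cancel_iff mem_Collect_eq)
    then show ?thesis using k(1) by simp
  qed
  have qk: "q \<zeta> = f (k (exp \<zeta>))" if "\<zeta> \<in> L'" for \<zeta>
    using fk[OF expL'[OF that]] by (simp add: q_def exp_double)
  have uniq: "E1 \<zeta> = E2 \<zeta>"
    if "connected X" "X \<subseteq> L" "a \<in> X" "E1 a = E2 a" "continuous_on X E1" "E1 \<in> X \<rightarrow> V"
      "\<And>\<zeta>. \<zeta> \<in> X \<Longrightarrow> q \<zeta> = f (E1 \<zeta>)" "continuous_on X E2" "E2 \<in> X \<rightarrow> V"
      "\<And>\<zeta>. \<zeta> \<in> X \<Longrightarrow> q \<zeta> = f (E2 \<zeta>)" "\<zeta> \<in> X" for E1 E2 :: "complex \<Rightarrow> complex" and X a \<zeta>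
  proof (rule covering_space_lift_unique[where ?g1.0 = E1 and ?g2.0 = E2, OF covV that(4)])
    show "continuous_on X q" using contq that(2) by (rule continuous_on_subset)
    show "q \<in> X \<rightarrow> T - {f c}" using qim that(2) by blast
  qed (use that in auto)
  obtain E where E: "continuous_on L E" "E \<in> L \<rightarrow> V" "E \<zeta>0 = k (exp \<zeta>0)" "\<And>\<zeta>. \<zeta> \<in> L \<Longrightarrow> f (E \<zeta>) = q \<zeta>"
  proof (rule covering_space_lift_strong[OF covV])
    show "k (exp \<zeta>0) \<in> V" using kV[OF expL'[OF \<zeta>0(1)]] by simp
    show "\<zeta>0 \<in> L" by fact
    show "simply_connected L" using cvL by (rule convex_imp_simply_connected)
    show "locally path_connected L" using opL by (rule open_imp_locally_path_connected)
    show "q \<zeta>0 = f (k (exp \<zeta>0))" by (rule qk[OF \<zeta>0(1)])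
  qed (use contq qim in auto)
  have Ek: "E \<zeta> = k (exp \<zeta>)" if "\<zeta> \<in> L'" for \<zeta>
  proof (rule uniq[where ?E1.0 = E and ?E2.0 = "\<lambda>\<zeta>. k (exp \<zeta>)", OF _ L'L \<zeta>0(1) E(3)])
    show "connected L'" unfolding L'_def by (intro convex_connected convex_halfspace_Re_lt)
    show "continuous_on L' E" using E(1) L'L by (rule continuous_on_subset)
    show "E \<in> L' \<rightarrow> V" using E(2) L'L by blast
    show "continuous_on L' (\<lambda>\<zeta>. k (exp \<zeta>))"
      using continuous_on_compose2[OF holomorphic_on_imp_continuous_on[OF k(3)] continuous_on_exp[OF continuous_on_id]] expL'
      by (metis (no_types, lifting) image_subsetI continuous_on_cong id_apply)
    show "(\<lambda>\<zeta>. k (exp \<zeta>)) \<in> L' \<rightarrow> V" using kV expL' by auto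
  qed (use E(4) qk L'L that in auto)
  have shift_cont: "continuous_on L (\<lambda>\<zeta>. E (\<zeta> + of_real t * \<i>))"
    and shift_im: "(\<lambda>\<zeta>. E (\<zeta> + of_real t * \<i>)) \<in> L \<rightarrow> V" for t :: real
  proof -
    have sub: "(\<lambda>\<zeta>. \<zeta> + of_real t * \<i>) ` L \<subseteq> L" by (auto simp: L_def)
    show "continuous_on L (\<lambda>\<zeta>. E (\<zeta> + of_real t * \<i>))"
      by (rule continuous_on_compose2[OF E(1) _ sub]) (intro continuous_intros)
    show "(\<lambda>\<zeta>. E (\<zeta> + of_real t * \<i>)) \<in> L \<rightarrow> V" using E(2) sub by blast
  qed
  have shift_L: "\<zeta> + of_real t * \<i> \<in> L" if "\<zeta> \<in> L" for \<zeta> and t :: real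
    using that by (simp add: L_def)
  \<comment> \<open>The shifted lift covers the same map and agrees with \<open>E\<close> at
    \<open>\<zeta>0\<close>, since on \<open>L'\<close> both are functions of \<open>exp\<close>;
    uniqueness of lifts does the rest.\<close>
  have periodic: "E (\<zeta> + of_int n * (2 * of_real pi * \<i>)) = E \<zeta>" if z: "\<zeta> \<in> L" for \<zeta> and n :: int
  proof -
    define t where "t = of_int n * (2 * pi)"
    have t: "of_int n * (2 * of_real pi * \<i>) = of_real t * \<i>" by (simp add: t_def)
    have ex: "exp (\<zeta> + of_real t * \<i>) = exp \<zeta>" for \<zeta>
      unfolding t[symmetric] by (subst exp_eq) (auto simp: algebra_simps)
    have "E (\<zeta> + of_real t * \<i>) = E \<zeta>"
    proof (rule uniq[where ?E1.0 = "\<lambda>\<zeta>. E (\<zeta> + of_real t * \<i>)" and ?E2.0 = E,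
          OF convex_connected[OF cvL] order_refl \<zeta>0(2)])
      show "E (\<zeta>0 + of_real t * \<i>) = E \<zeta>0"
        using Ek[of "\<zeta>0 + of_real t * \<i>"] Ek[OF \<zeta>0(1)] \<zeta>0(1) by (simp add: ex L'_def)
      show "q \<zeta> = f (E (\<zeta> + of_real t * \<i>))" if "\<zeta> \<in> L" for \<zeta>
        using E(4)[OF shift_L[OF that]] ex[of \<zeta>] by (simp add: q_def exp_double)
    qed (use shift_cont shift_im E z in auto)
    then show ?thesis by (simp only: t)
  qed
  define h where "h = (\<lambda>x. if x = 0 then c else E (Ln x))"
  have h0: "h 0 = c" by (simp add: h_def)
  have LnL: "Ln x \<in> L" if "x \<in> ball 0 1" "x \<noteq> 0" for x
    using that by (simp add: L_def)
  have h_exp: "h (exp \<zeta>) = E \<zeta>" if z: "\<zeta> \<in> L" for \<zeta>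
  proof -
    have "exp (Ln (exp \<zeta>)) = exp \<zeta>" by simp
    then obtain n :: int where "Ln (exp \<zeta>) = \<zeta> + of_int n * (2 * of_real pi * \<i>)"
      unfolding exp_eq by (auto simp: algebra_simps)
    then show ?thesis using periodic[OF z] by (simp add: h_def)
  qed
  have hk: "h x = k x" if x: "x \<in> ball 0 \<epsilon>" for x
  proof (cases "x = 0")
    case False
    then have "Re (Ln x) < ln \<epsilon>" using x k(1) by simp
    then have "Ln x \<in> L'" by (simp add: L'_def)
    then show ?thesis using Ek False by (simp add: h_def)
  qed (simp add: h_def k(4))
  have fh: "f (h x) = R (x\<^sup>2)" if x: "x \<in> ball 0 1" for x
  proof (cases "x = 0")
    case False
    then show ?thesis using E(4)[OF LnL[OF x False]] by (simp add: h_def q_def exp_double)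
  qed (simp add: h_def R(3))
  have hW: "h x \<in> W" if x: "x \<in> ball 0 1" for x
    using E(2) LnL[OF x] c by (auto simp: h_def V_def)
  have holE: "E holomorphic_on L"
    by (rule covering_space_lift_is_holomorphic[OF covV opV holV holq qim E(2,1,4)])
  have holh: "h holomorphic_on ball 0 1"
  proof -
    have "h field_differentiable (at x)" if x: "x \<in> ball 0 1" for x
    proof (cases "x = 0")
      case True
      have "h holomorphic_on ball 0 \<epsilon>" using k(3) hk holomorphic_cong by metis
      then show ?thesis using True k(1) holomorphic_on_imp_differentiable_at by fastforce
    next
      case False
      \<comment> \<open>A logarithm recentred at \<open>x\<close>, hence holomorphic near
        \<open>x\<close> even when \<open>x\<close> lies on the principal cut; by periodicity
        \<open>h\<close> is \<open>E\<close> composed with any logarithm.\<close>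
      define \<Lambda> where "\<Lambda> = (\<lambda>y. Ln (y / x) + Ln x)"
      define N where "N = {y. y / x \<notin> \<real>\<^sub>\<le>\<^sub>0} \<inter> ball 0 1"
      have opN: "open N"
      proof -
        have "open ((\<lambda>y. y / x) -` (- \<real>\<^sub>\<le>\<^sub>0))"
          by (intro open_vimage open_Compl closed_nonpos_Reals_complex continuous_intros) (use False in auto)
        then show ?thesis unfolding N_def by (simp add: vimage_def open_Int Collect_neg_eq)
      qed
      have xN: "x \<in> N" using False x by (simp add: N_def)
      have exp\<Lambda>: "exp (\<Lambda> y) = y" if "y \<in> N" for y
      proof -
        have "y / x \<noteq> 0" using that by (auto simp: N_def)
        then show ?thesis using False by (simp add: \<Lambda>_def exp_add)
      qed
      have \<Lambda>L: "\<Lambda> y \<in> L" if "y \<in> N" for y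
      proof -
        have "exp (Re (\<Lambda> y)) < exp 0"
          using exp\<Lambda>[OF that] that unfolding norm_exp_eq_Re[symmetric] by (simp add: N_def)
        then show ?thesis unfolding exp_less_cancel_iff by (simp add: L_def)
      qed
      have "\<Lambda> holomorphic_on N"
        unfolding \<Lambda>_def using False by (intro holomorphic_intros) (auto simp: N_def)
      then have "E \<circ> \<Lambda> holomorphic_on N"
        using \<Lambda>L by (intro holomorphic_on_compose holomorphic_on_subset[OF holE]) auto
      moreover have "(E \<circ> \<Lambda>) y = h y" if "y \<in> N" for y
        using h_exp[OF \<Lambda>L[OF that]] exp\<Lambda>[OF that] by simp
      ultimately have "h holomorphic_on N" using holomorphic_cong by metis
      then show ?thesis using opN xN holomorphic_on_imp_differentiable_at by blast
    qed
    then show ?thesis unfolding holomorphic_on_def using field_differentiable_at_within by blast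
  qed
  have injh: "inj_on h (ball 0 1)"
  proof (rule inj_onI)
    fix x y assume xy: "x \<in> ball 0 1" "y \<in> ball 0 1" "h x = h y"
    have "x\<^sup>2 = y\<^sup>2" using fh[OF xy(1)] fh[OF xy(2)] xy(3) R_inj[OF sqball sqball] xy by metis
    then consider "x = y" | "y = - x" "x \<noteq> 0" by (metis power2_eq_iff minus_zero minus_minus)
    then show "x = y"
    proof cases
      case 2
      define \<zeta> where "\<zeta> = Ln x"
      have zL: "\<zeta> \<in> L" unfolding \<zeta>_def using LnL[OF xy(1) 2(2)] .
      have em: "exp (\<zeta> + of_real pi * \<i>) = - exp \<zeta>" for \<zeta> by (simp add: exp_add mult.commute)
      have ex: "exp \<zeta> = x" using 2(2) by (simp add: \<zeta>_def)
      \<comment> \<open>If \<open>h x = h (- x)\<close>, the lift and its shift by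
        \<open>\<i> * pi\<close> agree at one point, hence everywhere. Near minus infinity this
        contradicts injectivity of the chart \<open>k\<close>.\<close>
      have eqz: "E (\<zeta> + of_real pi * \<i>) = E \<zeta>"
        using xy(3) h_exp[OF zL] h_exp[OF shift_L[OF zL, of pi]] 2(1) em[of \<zeta>] ex by simp
      have "E (\<zeta>0 + of_real pi * \<i>) = E \<zeta>0"
      proof (rule uniq[where ?E1.0 = "\<lambda>\<zeta>. E (\<zeta> + of_real pi * \<i>)" and ?E2.0 = E,
            OF convex_connected[OF cvL] order_refl zL eqz shift_cont shift_im _ E(1,2) _ \<zeta>0(2)])
        show "q \<xi> = f (E (\<xi> + of_real pi * \<i>))" if "\<xi> \<in> L" for \<xi>
          using E(4)[OF shift_L[OF that]] em[of \<xi>] by (simp add: q_def exp_double)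
      qed (use E(4) in auto)
      moreover have "\<zeta>0 + of_real pi * \<i> \<in> L'" using \<zeta>0(1) by (simp add: L'_def)
      ultimately have "k (- exp \<zeta>0) = k (exp \<zeta>0)" using Ek em \<zeta>0(1) by metis
      moreover have "exp \<zeta>0 \<in> ball 0 \<epsilon>" "- exp \<zeta>0 \<in> ball 0 \<epsilon>" using expL'[OF \<zeta>0(1)] by auto
      ultimately have "- exp \<zeta>0 = exp \<zeta>0" using k(5) by (metis inj_onD)
      then have "exp \<zeta>0 = 0" by (simp add: equation_minus_iff[symmetric] eq_neg_iff_add_eq_0)
      then show ?thesis by simp
    qed
  qed
  have onto: "h ` ball 0 1 = W"
  proof (rule GPicard2)
    show "h ` ball 0 1 \<subseteq> W" using hW by blast
    show "connected W" by fact
    show "h ` ball 0 1 \<noteq> {}" by simp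
    show "open (h ` ball 0 1)"
      using invariance_of_domain[OF holomorphic_on_imp_continuous_on[OF holh] open_ball injh] .
    fix z assume z: "z islimpt h ` ball 0 1" "z \<in> W"
    obtain s where s: "\<And>n. s n \<in> h ` ball 0 1" "s \<longlonglongrightarrow> z"
      using z(1) unfolding islimpt_sequential by blast
    have "\<forall>n. \<exists>y. y \<in> ball 0 1 \<and> s n = h y" using s(1) by blast
    from choice[OF this] obtain x where x: "\<And>n. x n \<in> ball 0 1" "\<And>n. s n = h (x n)" by blast
    have "isCont G z" using holG W(1) z(2) holomorphic_on_imp_continuous_on continuous_on_eq_continuous_at by blast
    then have "(\<lambda>n. G (s n)) \<longlonglongrightarrow> G z" using s(2) isCont_tendsto_compose by blast
    moreover have "G (s n) = (x n)\<^sup>2" for n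
      using fh[OF x(1)[of n]] x(2)[of n] R(5)[OF sqball[OF x(1)[of n]]] by (simp add: G_def)
    \<comment> \<open>The squares converge to a point of the open disc, so no subsequence of the
      \<open>x n\<close> can approach the unit circle.\<close>
    ultimately have lim: "(\<lambda>n. (x n)\<^sup>2) \<longlonglongrightarrow> G z" by simp
    have Gz: "G z \<in> ball 0 1" using R(4)[of "f z"] fW z(2) by (auto simp: G_def)
    have "bounded (range x)" using x(1) by (intro boundedI[of _ 1]) (auto intro: less_imp_le)
    then obtain y r where r: "strict_mono r" "(x \<circ> r) \<longlonglongrightarrow> y"
      using bounded_imp_convergent_subsequence by blast
    have "(\<lambda>n. (x (r n))\<^sup>2) \<longlonglongrightarrow> y\<^sup>2" using r(2) by (intro tendsto_intros) (simp add: o_def)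
    moreover have "(\<lambda>n. (x (r n))\<^sup>2) \<longlonglongrightarrow> G z"
      using LIMSEQ_subseq_LIMSEQ[OF lim r(1)] by (simp add: o_def)
    ultimately have "y\<^sup>2 = G z" using LIMSEQ_unique by blast
    then have "cmod y ^ 2 < 1" using Gz by (metis mem_ball_0 norm_power)
    then have y: "y \<in> ball 0 1" by (simp add: power_less_one_iff)
    have "isCont h y" using holh y holomorphic_on_imp_continuous_on continuous_on_eq_continuous_at open_ball by blast
    then have "(\<lambda>n. h ((x \<circ> r) n)) \<longlonglongrightarrow> h y" using r(2) isCont_tendsto_compose by blast
    moreover have "(\<lambda>n. h ((x \<circ> r) n)) \<longlonglongrightarrow> z"
      using LIMSEQ_subseq_LIMSEQ[OF s(2) r(1)] x(2) by (simp add: o_def)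
    ultimately have "h y = z" using LIMSEQ_unique by blast
    then show "z \<in> h ` ball 0 1" using y by blast
  qed
  show ?thesis using that[OF R holh injh onto h0 fh] .
qed

section \<open>Blaschke products and boundary behaviour\<close>

text \<open>Schwarz's lemma for \<open>P\<close> and for its inverse gives equality of moduli at one
  nonzero point, here \<open>1/2\<close>, and the equality case makes \<open>P\<close> a
  rotation.\<close>

lemma disc_automorphism_fixing_0:
  assumes P: "P holomorphic_on ball 0 1" "\<And>z. z \<in> ball 0 1 \<Longrightarrow> P z \<in> ball 0 1" "P 0 = 0"
    and Q: "Q holomorphic_on ball 0 1" "\<And>z. z \<in> ball 0 1 \<Longrightarrow> Q z \<in> ball 0 1"
    and QP: "\<And>z. z \<in> ball 0 1 \<Longrightarrow> Q (P z) = z"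
  shows "\<exists>\<omega>. cmod \<omega> = 1 \<and> (\<forall>z\<in>ball 0 1. P z = \<omega> * z)"
proof -
  have Q0: "Q 0 = 0" using QP[of 0] P(3) by simp
  have P1: "cmod (P z) < 1" if "cmod z < 1" for z using P(2)[of z] that by simp
  have Q1: "cmod (Q z) < 1" if "cmod z < 1" for z using Q(2)[of z] that by simp
  have half: "cmod (1/2 :: complex) < 1" by (simp add: norm_divide)
  have "cmod (P (1/2)) \<le> cmod (1/2)" by (rule Schwarz_Lemma(1)[OF P(1,3) P1 half])
  moreover have "cmod (Q (P (1/2))) \<le> cmod (P (1/2))"
    by (rule Schwarz_Lemma(1)[OF Q(1) Q0 Q1 P1[OF half]])
  ultimately have eq: "cmod (P (1/2)) = cmod (1/2)" using QP[of "1/2"] half by simp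
  have "(\<exists>z. cmod z < 1 \<and> z \<noteq> 0 \<and> cmod (P z) = cmod z) \<or> cmod (deriv P 0) = 1"
    by (intro disjI1 exI[of _ "1/2"] conjI half eq) simp
  from Schwarz_Lemma(3)[OF P(1,3) P1 half this]
  obtain \<alpha> where "\<forall>z. cmod z < 1 \<longrightarrow> P z = \<alpha> * z" "cmod \<alpha> = 1" by blast
  then show ?thesis by auto
qed

text \<open>A rotated square followed by the disc automorphism
  \<open>x \<mapsto> (x + a) / (1 + cnj a * x)\<close>: for \<open>cmod a < 1\<close> and
  \<open>cmod \<omega> = 1\<close>, the Blaschke products of degree 2 with critical point 0.\<close>

definition blaschke2 :: "complex \<Rightarrow> complex \<Rightarrow> complex \<Rightarrow> complex" where
  "blaschke2 a \<omega> \<zeta> = (\<omega> * \<zeta>\<^sup>2 + a) / (1 + cnj a * (\<omega> * \<zeta>\<^sup>2))"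

lemma Re_one_plus_pos: "cmod z < 1 \<Longrightarrow> 0 < Re (1 + z)"
  using abs_Re_le_cmod[of z] by simp

text \<open>On the circle the map acts on the angle by \<open>t \<mapsto> \<theta> + 2 * t - 2 * Arg q\<close> with \<open>Re q > 0\<close>,
  so the displacement increases by \<open>2 * pi\<close> over one turn.\<close>
lemma blaschke2_fixed_point:
  assumes a: "cmod a < 1" and \<omega>: "cmod \<omega> = 1"
  obtains \<xi> where "cmod \<xi> = 1" "blaschke2 a \<omega> \<xi> = \<xi>"
proof -
  define q where "q = (\<lambda>t::real. 1 + cnj a * (\<omega> * (cis t)\<^sup>2))"
  have small: "cmod (cnj a * (\<omega> * (cis t)\<^sup>2)) < 1" for t
    using a \<omega> by (simp add: norm_mult norm_power)
  have q: "0 < Re (q t)" for t unfolding q_def using small by (rule Re_one_plus_pos)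
  have q0: "q t \<noteq> 0" for t using q[of t] by auto
  obtain \<theta> where \<theta>: "\<omega> = cis \<theta>" using \<omega> by (metis cis_Arg complex_sgn_def divide_self_if norm_zero scaleR_one sgn_div_norm inverse_1 zero_neq_one)
  \<comment> \<open>\<open>g t\<close> is the angle of the image point minus \<open>t\<close>;
    positivity of \<open>Re (q t)\<close> keeps \<open>Ln\<close> continuous. A zero displacement
    means that \<open>g t\<close> is a multiple of \<open>2 * pi\<close>.\<close>
  define g where "g = (\<lambda>t. \<theta> + t - 2 * Im (Ln (q t)))"
  have contq: "continuous_on {0..2*pi} q" unfolding q_def by (intro continuous_intros)
  have contg: "continuous_on {0..2*pi} g" unfolding g_def
    by (intro continuous_intros contq) (metis complex_nonpos_Reals_iff not_le q)
  have "q (2*pi) = q 0" by (simp add: q_def)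
  then have gper: "g (2*pi) = g 0 + 2 * pi" by (simp add: g_def)
  define k where "k = \<lceil>g 0 / (2*pi)\<rceil>"
  have k: "g 0 \<le> of_int k * (2*pi)" "of_int k * (2*pi) \<le> g (2*pi)"
  proof -
    have "g 0 / (2*pi) \<le> of_int k" "of_int k \<le> g 0 / (2*pi) + 1" unfolding k_def by linarith+
    then show "g 0 \<le> of_int k * (2*pi)" "of_int k * (2*pi) \<le> g (2*pi)"
      unfolding gper using pi_gt_zero by (simp_all add: field_simps)
  qed
  obtain t where t: "g t = of_int k * (2*pi)"
    using IVT'[of g 0 "of_int k * (2*pi)" "2*pi"] k contg by auto
  have cnjq: "cnj (q t) / q t = cis (- 2 * Im (Ln (q t)))"
  proof -
    have "cnj (q t) / q t = exp (cnj (Ln (q t)) - Ln (q t))"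
    proof -
      have "exp (cnj (Ln (q t))) = cnj (exp (Ln (q t)))" by (simp only: exp_cnj)
      then show ?thesis using q0[of t] by (simp add: exp_diff)
    qed
    also have "cnj (Ln (q t)) - Ln (q t) = \<i> * of_real (- 2 * Im (Ln (q t)))"
      by (simp add: complex_eq_iff)
    finally show ?thesis by (simp only: cis_conv_exp)
  qed
  define \<xi> where "\<xi> = cis t"
  have x1: "(cis t)\<^sup>2 * cnj ((cis t)\<^sup>2) = 1" "\<omega> * cnj \<omega> = 1"
    unfolding complex_norm_square[symmetric] norm_power using \<omega> by simp_all
  have "\<omega> * \<xi>\<^sup>2 * cnj (q t) = \<omega> * \<xi>\<^sup>2 + a * ((\<omega> * cnj \<omega>) * ((cis t)\<^sup>2 * cnj ((cis t)\<^sup>2)))"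
    by (simp add: q_def \<xi>_def algebra_simps)
  then have num: "\<omega> * \<xi>\<^sup>2 + a = \<omega> * \<xi>\<^sup>2 * cnj (q t)" unfolding x1 by simp
  have "blaschke2 a \<omega> \<xi> = \<omega> * \<xi>\<^sup>2 * (cnj (q t) / q t)"
    unfolding blaschke2_def num by (simp add: q_def \<xi>_def)
  also have "\<dots> = cis (\<theta> + 2 * t - 2 * Im (Ln (q t)))"
    unfolding cnjq \<theta> \<xi>_def power2_eq_square cis_mult by (simp add: algebra_simps)
  also have "\<theta> + 2 * t - 2 * Im (Ln (q t)) = t + 2 * pi * of_int k"
    using t by (simp add: g_def algebra_simps)
  also have "cis (t + 2 * pi * of_int k) = cis t"
    by (simp flip: cis_mult add: cis_multiple_2pi)
  finally have "blaschke2 a \<omega> \<xi> = \<xi>" by (simp add: \<xi>_def)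
  moreover have "cmod \<xi> = 1" by (simp add: \<xi>_def)
  ultimately show ?thesis using that by blast
qed

lemma moebius_norm_identity:
  "(cmod (1 + cnj a * x))\<^sup>2 - (cmod (x + a))\<^sup>2 = (1 - (cmod a)\<^sup>2) * (1 - (cmod x)\<^sup>2)"
  unfolding cmod_power2 by (simp add: power2_eq_square algebra_simps)

text \<open>Along the radius to the boundary fixed point, a point moves by a distance comparable at
  most to \<open>1 - r\<close>, and its image keeps a distance of that order from the circle. So the
  segment between them lies in a region where
  \<open>(1 - cmod \<eta>) * cmod (deriv h \<eta>)\<close> controls how far \<open>h\<close>
  moves.\<close>

lemma blaschke2_near_boundary:
  assumes a: "cmod a < 1" and \<omega>: "cmod \<omega> = 1" and \<xi>: "cmod \<xi> = 1" "blaschke2 a \<omega> \<xi> = \<xi>"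
  obtains C c where "0 < C" "0 < c" "c \<le> (1::real)"
    "\<And>r. 0 < r \<Longrightarrow> r < 1 \<Longrightarrow> cmod (blaschke2 a \<omega> (of_real r * \<xi>) - of_real r * \<xi>) \<le> C * (1 - r)"
    "\<And>r. 0 < r \<Longrightarrow> r < 1 \<Longrightarrow> c * (1 - r) \<le> 1 - cmod (blaschke2 a \<omega> (of_real r * \<xi>))"
proof -
  define A where "A = 1 - cmod a"
  have A: "0 < A" "A \<le> 1" using a by (auto simp: A_def)
  define D where "D = (\<lambda>x. 1 + cnj a * x)"
  have Dlow: "A \<le> cmod (D x)" if "cmod x \<le> 1" for x
  proof -
    have "cmod (cnj a * x) \<le> cmod a * 1" unfolding norm_mult using that by (intro mult_mono) auto
    then show ?thesis using norm_diff_ineq[of 1 "cnj a * x"] by (simp add: D_def A_def)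
  qed
  have Dup: "cmod (D x) \<le> 2" if "cmod x \<le> 1" for x
  proof -
    have "cmod (cnj a * x) \<le> 1 * 1" unfolding norm_mult using that a by (intro mult_mono) auto
    then show ?thesis using norm_triangle_ineq[of 1 "cnj a * x"] by (simp add: D_def)
  qed
  define m where "m = (\<lambda>x. (x + a) / D x)"
  have b_eq: "blaschke2 a \<omega> \<zeta> = m (\<omega> * \<zeta>\<^sup>2)" for \<zeta> by (simp add: blaschke2_def m_def D_def)
  have lip: "cmod (m x - m y) \<le> cmod (x - y) / A\<^sup>2" if x: "cmod x \<le> 1" and y: "cmod y \<le> 1" for x y
  proof -
    have nz: "D x \<noteq> 0" "D y \<noteq> 0" using Dlow[OF x] Dlow[OF y] A by auto
    have "m x - m y = (x - y) * (1 - a * cnj a) / (D x * D y)"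
      using nz unfolding m_def by (simp add: diff_frac_eq) (simp add: D_def algebra_simps)
    moreover have "a * cnj a = of_real ((cmod a)\<^sup>2)" by (simp flip: complex_norm_square)
    ultimately have "m x - m y = (x - y) * of_real (1 - (cmod a)\<^sup>2) / (D x * D y)" by simp
    then have "cmod (m x - m y) = cmod (x - y) * \<bar>1 - (cmod a)\<^sup>2\<bar> / (cmod (D x) * cmod (D y))"
      by (simp only: norm_mult norm_divide norm_of_real)
    also have "\<dots> \<le> cmod (x - y) * 1 / (cmod (D x) * cmod (D y))"
    proof (intro divide_right_mono mult_left_mono)
      have "(cmod a)\<^sup>2 \<le> 1" using a by (simp add: power_le_one)
      then show "\<bar>1 - (cmod a)\<^sup>2\<bar> \<le> 1" by simp
    qed auto
    also have "\<dots> \<le> cmod (x - y) * 1 / (A * A)"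
      using Dlow[OF x] Dlow[OF y] A by (intro divide_left_mono mult_mono mult_pos_pos) auto
    finally show ?thesis by (simp add: power2_eq_square)
  qed
  have gap: "(1 - (cmod a)\<^sup>2) * (1 - (cmod x)\<^sup>2) / 4 \<le> 1 - (cmod (m x))\<^sup>2" if x: "cmod x \<le> 1" for x
  proof -
    have nz: "0 < cmod (D x)" using Dlow[OF x] A by linarith
    have "1 - (cmod (m x))\<^sup>2 = ((cmod (D x))\<^sup>2 - (cmod (x + a))\<^sup>2) / (cmod (D x))\<^sup>2"
      using nz by (simp add: m_def norm_divide power_divide field_simps)
    also have "\<dots> = (1 - (cmod a)\<^sup>2) * (1 - (cmod x)\<^sup>2) / (cmod (D x))\<^sup>2"
      unfolding D_def moebius_norm_identity ..
    also have "\<dots> \<ge> (1 - (cmod a)\<^sup>2) * (1 - (cmod x)\<^sup>2) / 4"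
    proof (rule divide_left_mono)
      have "(cmod (D x))\<^sup>2 \<le> 2\<^sup>2" using Dup[OF x] by (intro power_mono) auto
      then show "(cmod (D x))\<^sup>2 \<le> 4" by simp
      have "(cmod a)\<^sup>2 \<le> 1" "(cmod x)\<^sup>2 \<le> 1" using a x by (simp_all add: power_le_one)
      then show "0 \<le> (1 - (cmod a)\<^sup>2) * (1 - (cmod x)\<^sup>2)" by (intro mult_nonneg_nonneg) auto
      show "0 < 4 * (cmod (D x))\<^sup>2" using nz by simp
    qed
    finally show ?thesis .
  qed
  have normx: "cmod (\<omega> * (of_real r * \<xi>)\<^sup>2) = r\<^sup>2" if "0 < r" for r
    using \<omega> \<xi> that by (simp add: norm_mult norm_power power_mult_distrib)
  \<comment> \<open>A factor \<open>1/4\<close> comes from \<open>cmod (D x) <= 2\<close>, another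
    \<open>1/2\<close> from \<open>1 - u^2 <= 2 * (1 - u)\<close>.\<close>
  define c where "c = (1 - (cmod a)\<^sup>2) / 8"
  have a2: "(cmod a)\<^sup>2 < 1" using a by (simp add: power_less_one_iff)
  moreover have "0 < (1 - q) / 8 \<and> (1 - q) / 8 \<le> 1" if "0 \<le> q" "q < 1" for q :: real
    using that by simp
  ultimately have c: "0 < c" "c \<le> 1" unfolding c_def by (simp_all only: zero_le_power2)
  show ?thesis
  proof (rule that[of "2 / A\<^sup>2 + 1" c])
    show "0 < 2 / A\<^sup>2 + 1" using A by (intro add_pos_pos) auto
    show "0 < c" "c \<le> 1" by fact+
    fix r :: real assume r: "0 < r" "r < 1"
    have r2: "r\<^sup>2 \<le> r" "r\<^sup>2 \<le> 1" using r by (simp_all add: power2_eq_square mult_le_one mult_left_le)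
    have "cmod (blaschke2 a \<omega> (of_real r * \<xi>) - \<xi>) = cmod (m (\<omega> * (of_real r * \<xi>)\<^sup>2) - m (\<omega> * \<xi>\<^sup>2))"
      using \<xi>(2) unfolding b_eq by simp
    also have "\<dots> \<le> cmod (\<omega> * (of_real r * \<xi>)\<^sup>2 - \<omega> * \<xi>\<^sup>2) / A\<^sup>2"
    proof (rule lip)
      show "cmod (\<omega> * (of_real r * \<xi>)\<^sup>2) \<le> 1" using normx[OF r(1)] r2 by simp
      show "cmod (\<omega> * \<xi>\<^sup>2) \<le> 1" using \<omega> \<xi> by (simp add: norm_mult norm_power)
    qed
    also have "\<omega> * (of_real r * \<xi>)\<^sup>2 - \<omega> * \<xi>\<^sup>2 = of_real (r\<^sup>2 - 1) * (\<omega> * \<xi>\<^sup>2)"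
      by (simp add: power_mult_distrib algebra_simps)
    also have "cmod (of_real (r\<^sup>2 - 1) * (\<omega> * \<xi>\<^sup>2)) = 1 - r\<^sup>2"
      unfolding norm_mult norm_power norm_of_real using \<omega> \<xi> r2 by simp
    also have "(1 - r\<^sup>2) / A\<^sup>2 \<le> 2 * (1 - r) / A\<^sup>2"
    proof (rule divide_right_mono)
      have "0 \<le> (1 - r) * (1 - r)" by simp
      then show "1 - r\<^sup>2 \<le> 2 * (1 - r)" by (simp add: power2_eq_square algebra_simps)
    qed simp
    finally have one: "cmod (blaschke2 a \<omega> (of_real r * \<xi>) - \<xi>) \<le> 2 / A\<^sup>2 * (1 - r)" by simp
    have "\<xi> - of_real r * \<xi> = of_real (1 - r) * \<xi>" by (simp add: algebra_simps)
    then have two: "cmod (\<xi> - of_real r * \<xi>) = 1 - r" using \<xi> r by (simp add: norm_mult del: of_real_diff)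
    show "cmod (blaschke2 a \<omega> (of_real r * \<xi>) - of_real r * \<xi>) \<le> (2 / A\<^sup>2 + 1) * (1 - r)"
      using norm_triangle_ineq[of "blaschke2 a \<omega> (of_real r * \<xi>) - \<xi>" "\<xi> - of_real r * \<xi>"] one two
      by (simp add: distrib_right)
    define u where "u = cmod (blaschke2 a \<omega> (of_real r * \<xi>))"
    have "(1 - (cmod a)\<^sup>2) * (1 - (r\<^sup>2)\<^sup>2) / 4 \<le> 1 - u\<^sup>2"
      using gap[of "\<omega> * (of_real r * \<xi>)\<^sup>2"] r2(2) unfolding u_def b_eq normx[OF r(1)] by simp
    moreover have "(1 - (cmod a)\<^sup>2) * (1 - r) / 4 \<le> (1 - (cmod a)\<^sup>2) * (1 - (r\<^sup>2)\<^sup>2) / 4"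
    proof (intro divide_right_mono mult_left_mono)
      have "(r\<^sup>2)\<^sup>2 \<le> r\<^sup>2" unfolding power2_eq_square[of "r\<^sup>2"] by (intro mult_left_le r2(2)) simp
      then show "1 - r \<le> 1 - (r\<^sup>2)\<^sup>2" using r2 by linarith
    qed (use a2 in auto)
    moreover have "1 - u\<^sup>2 \<le> 2 * (1 - u)"
    proof -
      have "0 \<le> (1 - u) * (1 - u)" by simp
      then show ?thesis by (simp add: power2_eq_square algebra_simps)
    qed
    ultimately have "(1 - (cmod a)\<^sup>2) * (1 - r) / 4 \<le> 2 * (1 - u)" by linarith
    then show "c * (1 - r) \<le> 1 - cmod (blaschke2 a \<omega> (of_real r * \<xi>))"
      unfolding u_def[symmetric] c_def by simp
  qed
qed

text \<open>Otherwise Bloch's theorem provides discs of a fixed size covered by images of discs tending to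
  the boundary, contradicting injectivity.\<close>
lemma bounded_univalent_little_bloch:
  assumes hol: "h holomorphic_on ball 0 1" and inj: "inj_on h (ball 0 1)"
    and bd: "bounded (h ` ball 0 1)" and e: "e > 0"
  obtains \<rho> where "\<rho> < 1" "\<And>\<eta>. \<rho> < cmod \<eta> \<Longrightarrow> cmod \<eta> < 1 \<Longrightarrow> (1 - cmod \<eta>) * cmod (deriv h \<eta>) \<le> e"
proof (rule ccontr)
  assume neg: "\<not> thesis"
  have "\<exists>\<eta>. 1 - inverse (Suc n) < cmod \<eta> \<and> cmod \<eta> < 1 \<and> e < (1 - cmod \<eta>) * cmod (deriv h \<eta>)" for n
  proof (rule ccontr)
    assume "\<not> ?thesis"
    then have "\<And>\<eta>. 1 - inverse (Suc n) < cmod \<eta> \<Longrightarrow> cmod \<eta> < 1 \<Longrightarrow> (1 - cmod \<eta>) * cmod (deriv h \<eta>) \<le> e"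
      by force
    then show False using neg that[of "1 - inverse (Suc n)"] by simp
  qed
  then obtain \<eta> where \<eta>: "\<And>n. 1 - inverse (Suc n) < cmod (\<eta> n)" "\<And>n. cmod (\<eta> n) < 1"
    "\<And>n. e < (1 - cmod (\<eta> n)) * cmod (deriv h (\<eta> n))" by metis
  \<comment> \<open>Half the distance to the circle keeps the balls inside the disc and shrinking to
    its boundary. This 2 and the constant 12 in Bloch's theorem give the radius
    \<open>e / 24\<close> below.\<close>
  define s where "s = (\<lambda>n. (1 - cmod (\<eta> n)) / 2)"
  have s: "0 < s n" "s n < inverse (Suc n) / 2" for n using \<eta>(1,2)[of n] by (auto simp: s_def)
  have sub: "ball (\<eta> n) (s n) \<subseteq> ball 0 1" for n
  proof
    fix x assume "x \<in> ball (\<eta> n) (s n)"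
    then have "cmod x \<le> cmod (\<eta> n) + s n"
      using norm_triangle_ineq2[of x "\<eta> n"] by (simp add: dist_norm norm_minus_commute)
    then show "x \<in> ball 0 1" using \<eta>(2)[of n] by (simp add: s_def field_simps)
  qed
  have "\<exists>b. ball b (e / 24) \<subseteq> h ` ball (\<eta> n) (s n)" for n
  proof -
    have "e / 24 \<le> s n * cmod (deriv h (\<eta> n)) / 12" using \<eta>(3)[of n] by (simp add: s_def)
    then show ?thesis using Bloch[OF holomorphic_on_subset[OF hol sub] s(1)] by metis
  qed
  then obtain b where b: "\<And>n. ball (b n) (e / 24) \<subseteq> h ` ball (\<eta> n) (s n)" by metis
  have "b n \<in> h ` ball 0 1" for n using b[of n] sub[of n] e by (force simp: subset_iff)
  then have "range b \<subseteq> h ` ball 0 1" by blast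
  then have "bounded (range b)" by (rule bounded_subset[OF bd])
  then obtain \<beta> r where r: "strict_mono r" "(b \<circ> r) \<longlonglongrightarrow> \<beta>"
    using bounded_imp_convergent_subsequence by blast
  have "\<forall>\<^sub>F n in sequentially. dist ((b \<circ> r) n) \<beta> < e / 24"
    by (rule tendstoD[OF r(2)]) (use e in simp)
  then obtain N where N: "\<And>n. n \<ge> N \<Longrightarrow> dist (b (r n)) \<beta> < e / 24"
    by (auto simp: eventually_sequentially)
  have ex: "\<exists>x. x \<in> ball (\<eta> (r n)) (s (r n)) \<and> h x = \<beta>" if "n \<ge> N" for n
  proof -
    have "\<beta> \<in> ball (b (r n)) (e / 24)" using N[OF that] by simp
    then have "\<beta> \<in> h ` ball (\<eta> (r n)) (s (r n))" using b by blast
    then show ?thesis by blast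
  qed
  \<comment> \<open>\<open>\<beta>\<close> is attained in every late ball; by injectivity always at
    the same \<open>x\<close>, although these balls approach the circle.\<close>
  obtain x where x: "x \<in> ball (\<eta> (r N)) (s (r N))" "h x = \<beta>" using ex by blast
  have x1: "x \<in> ball 0 1" using x(1) sub by blast
  have "1 - 2 * inverse (Suc n) < cmod x" if n: "n \<ge> N" for n
  proof -
    obtain y where y: "y \<in> ball (\<eta> (r n)) (s (r n))" "h y = \<beta>" using ex[OF n] by blast
    then have "y \<in> ball 0 1" using sub by blast
    then have "y = x" using inj x(2) y(2) x1 by (metis inj_onD)
    then have "cmod (\<eta> (r n)) - cmod x < s (r n)"
      using y(1) norm_triangle_ineq2[of "\<eta> (r n)" x] by (simp add: dist_norm)
    moreover have "inverse (real (Suc (r n))) \<le> inverse (real (Suc n))"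
      using strict_mono_imp_increasing[OF r(1), of n] by (intro le_imp_inverse_le) auto
    moreover have "0 < inverse (real (Suc n))" by simp
    ultimately show ?thesis using \<eta>(1)[of "r n"] s(2)[of "r n"] by linarith
  qed
  moreover have "(\<lambda>n. 1 - 2 * inverse (real (Suc n))) \<longlonglongrightarrow> 1 - 2 * 0"
    by (intro tendsto_intros LIMSEQ_inverse_real_of_nat)
  ultimately have "1 - 2 * 0 \<le> cmod x"
    by (intro LIMSEQ_le_const2) (auto intro!: exI[of _ N] less_imp_le)
  then show False using x1 by simp
qed

section \<open>The immediate basin\<close>

context attracting_tan
begin

lemma immediate_basin_preimage:
  "immediate_basin \<in> components (tan_preimage l immediate_basin)"
  "ftan l ` immediate_basin = immediate_basin"
  using basin_component_preimage[OF z0_basin0] by (simp_all add: ftan_z0 immediate_basin_def)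

lemma immediate_basin_dom: "immediate_basin \<subseteq> tan_domain"
  using immediate_basin_subset basin_subset orbit_domain_subset by blast

lemma immediate_basin_step: "z \<in> immediate_basin \<Longrightarrow> ftan l z \<in> immediate_basin"
  using immediate_basin_preimage(2) by blast

lemma simply_connected_immediate_basin: "simply_connected immediate_basin"
  unfolding immediate_basin_def by (rule simply_connected_basin_component[OF z0_basin0])

lemma Im_immediate_basin: "z \<in> immediate_basin \<Longrightarrow> Im z \<le> 0"
  using immediate_basin_subset Im_basin by blast

section \<open>The immediate basin modelled by squaring on the disc\<close>

text \<open>\<open>h\<close> and \<open>R\<close> both parametrise the immediate basin by the disc,
  centred at the critical point and at the critical value; between these two coordinates
  \<open>ftan l\<close> is squaring.\<close>

definition square_model :: "(complex \<Rightarrow> complex) \<Rightarrow> (complex \<Rightarrow> complex) \<Rightarrow> (complex \<Rightarrow> complex) \<Rightarrow> bool" where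
  "square_model R \<phi> h \<longleftrightarrow>
    R holomorphic_on ball 0 1 \<and> \<phi> holomorphic_on immediate_basin \<and> R 0 = ftan l crit \<and>
    (\<forall>z\<in>immediate_basin. \<phi> z \<in> ball 0 1 \<and> R (\<phi> z) = z) \<and>
    (\<forall>x\<in>ball 0 1. R x \<in> immediate_basin \<and> \<phi> (R x) = x) \<and>
    h holomorphic_on ball 0 1 \<and> inj_on h (ball 0 1) \<and> h ` ball 0 1 = immediate_basin \<and> h 0 = crit \<and>
    (\<forall>x\<in>ball 0 1. ftan l (h x) = R (x\<^sup>2))"

lemma square_modelD:
  assumes "square_model R \<phi> h"
  shows "R holomorphic_on ball 0 1" "\<phi> holomorphic_on immediate_basin" "R 0 = ftan l crit"
    "\<And>z. z \<in> immediate_basin \<Longrightarrow> \<phi> z \<in> ball 0 1 \<and> R (\<phi> z) = z"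
    "\<And>x. x \<in> ball 0 1 \<Longrightarrow> R x \<in> immediate_basin \<and> \<phi> (R x) = x"
    "h holomorphic_on ball 0 1" "inj_on h (ball 0 1)" "h ` ball 0 1 = immediate_basin" "h 0 = crit"
    "\<And>x. x \<in> ball 0 1 \<Longrightarrow> ftan l (h x) = R (x\<^sup>2)"
  using assms unfolding square_model_def by blast+

lemma immediate_basin_model: "\<exists>R \<phi> h. square_model R \<phi> h"
proof (rule branched_double_cover)
  show "\<exists>R \<phi> h. square_model R \<phi> h" if "R holomorphic_on ball 0 1" "\<phi> holomorphic_on immediate_basin" "R 0 = ftan l crit"
    "\<And>z. z \<in> immediate_basin \<Longrightarrow> \<phi> z \<in> ball 0 1 \<and> R (\<phi> z) = z"
    "\<And>x. x \<in> ball 0 1 \<Longrightarrow> R x \<in> immediate_basin \<and> \<phi> (R x) = x"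
    "h holomorphic_on ball 0 1" "inj_on h (ball 0 1)" "h ` ball 0 1 = immediate_basin" "h 0 = crit"
    "\<And>x. x \<in> ball 0 1 \<Longrightarrow> ftan l (h x) = R (x\<^sup>2)"
    for R \<phi> h
    using that unfolding square_model_def by (intro exI[of _ R] exI[of _ \<phi>] exI[of _ h] conjI ballI) auto
  have cd: "crit \<in> tan_domain" using crit(1) immediate_basin_dom by blast
  have "\<i> \<notin> immediate_basin" using Im_immediate_basin[of \<i>] by auto
  then show "immediate_basin \<noteq> UNIV" by blast
  show "ftan l holomorphic_on immediate_basin"
    using holomorphic_ftan immediate_basin_dom by (rule holomorphic_on_subset)
  show "covering_space {z \<in> immediate_basin. ftan l z \<noteq> ftan l crit} (ftan l) (immediate_basin - {ftan l crit})"
  proof (rule ftan_covering_space)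
    show "open (immediate_basin - {ftan l crit})" by (intro open_delete open_immediate_basin)
    show "ftan l ` {z \<in> immediate_basin. ftan l z \<noteq> ftan l crit} = immediate_basin - {ftan l crit}"
    proof -
      have "ftan l ` {z \<in> A. ftan l z \<noteq> v} = ftan l ` A - {v}" for A v by blast
      from this[of immediate_basin "ftan l crit"] show ?thesis
        by (simp only: immediate_basin_preimage(2))
    qed
    show "{z \<in> immediate_basin. ftan l z \<noteq> ftan l crit} \<subseteq> tan_preimage l (immediate_basin - {ftan l crit})"
      using immediate_basin_dom immediate_basin_step by (auto simp: tan_preimage_def)
    show "C \<subseteq> {z \<in> immediate_basin. ftan l z \<noteq> ftan l crit}"
      if C: "connected C" "C \<subseteq> tan_preimage l (immediate_basin - {ftan l crit})"
        "C \<inter> {z \<in> immediate_basin. ftan l z \<noteq> ftan l crit} \<noteq> {}" for C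
    proof -
      have "C \<subseteq> tan_preimage l immediate_basin" using C(2) tan_preimage_mono[of "immediate_basin - {ftan l crit}"] by blast
      then have "C \<subseteq> immediate_basin"
        using components_maximal[OF immediate_basin_preimage(1) C(1)] C(3) by blast
      then show ?thesis using C(2) by (auto simp: tan_preimage_def)
    qed
    show "2 + (tan z)\<^sup>2 \<noteq> 0" if z: "z \<in> {z \<in> immediate_basin. ftan l z \<noteq> ftan l crit}" for z
    proof
      assume "2 + (tan z)\<^sup>2 = 0"
      then have "z = crit + of_int 0 * of_real pi"
        using critical_point_in_component[of z 0] z immediate_basin_subset by blast
      then show False using z by simp
    qed
  qed
  show "deriv (ftan l) crit = 0" using deriv_ftan[OF cd] crit(2) by simp
  have t2: "(tan crit)\<^sup>2 = - 2" using crit(2) by (simp add: add_eq_0_iff)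
  then have "tan crit \<noteq> 0" by auto
  then show "deriv (deriv (ftan l)) crit \<noteq> 0" unfolding deriv_deriv_ftan[OF cd] t2 by simp
qed (use open_immediate_basin connected_immediate_basin simply_connected_immediate_basin crit(1)
      immediate_basin_preimage(2) in auto)

text \<open>In the model the fibre over \<open>w\<close> consists of the square roots of
  \<open>\<phi> w\<close>, which coincide only at 0, the coordinate of \<open>crit\<close>.\<close>

lemma immediate_basin_fibre:
  assumes w: "w \<in> immediate_basin"
  shows "(w = ftan l crit \<and> {z \<in> immediate_basin. ftan l z = w} = {crit}) \<or>
    (card {z \<in> immediate_basin. ftan l z = w} = 2 \<and> crit \<notin> {z \<in> immediate_basin. ftan l z = w})"
proof -
  obtain R \<phi> h where "square_model R \<phi> h" using immediate_basin_model by blast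
  note M = square_modelD[OF this]
  define y where "y = csqrt (\<phi> w)"
  have y2: "y\<^sup>2 = \<phi> w" by (simp add: y_def)
  have "cmod y ^ 2 < 1" using M(4)[OF w] by (metis mem_ball_0 norm_power y2)
  then have y: "y \<in> ball 0 1" "- y \<in> ball 0 1" by (simp_all add: power_less_one_iff)
  have sq: "x\<^sup>2 \<in> ball 0 1" if "x \<in> ball 0 1" for x :: complex
    using that by (simp add: norm_power power_less_one_iff)
  have eq: "{z \<in> immediate_basin. ftan l z = w} = {h y, h (- y)}"
  proof
    show "{h y, h (- y)} \<subseteq> {z \<in> immediate_basin. ftan l z = w}"
      using M(8) M(10)[OF y(1)] M(10)[OF y(2)] y y2 M(4)[OF w] by auto
    show "{z \<in> immediate_basin. ftan l z = w} \<subseteq> {h y, h (- y)}"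
    proof
      fix z assume z: "z \<in> {z \<in> immediate_basin. ftan l z = w}"
      then obtain x where x: "x \<in> ball 0 1" "z = h x" using M(8) by blast
      then have "R (x\<^sup>2) = w" using M(10) z by simp
      then have "x\<^sup>2 = y\<^sup>2" using M(5)[OF sq[OF x(1)]] y2 by simp
      then have "x = y \<or> x = - y" by (simp add: power2_eq_iff)
      then show "z \<in> {h y, h (- y)}" using x(2) by blast
    qed
  qed
  show ?thesis
  proof (cases "y = 0")
    case True
    then have "\<phi> w = 0" using y2 by simp
    then have "w = ftan l crit" using M(3) M(4)[OF w] by simp
    then show ?thesis using eq True M(9) by simp
  next
    case False
    have "h y \<noteq> h (- y)" using inj_onD[OF M(7) _ y] False by force
    moreover have "h y \<noteq> h 0" "h (- y) \<noteq> h 0"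
      using inj_onD[OF M(7), of y 0] inj_onD[OF M(7), of "- y" 0] False y by auto
    ultimately show ?thesis unfolding eq using M(9) by auto
  qed
qed

text \<open>\<open>proper_ftan_component\<close> asks for a bounded target, and the immediate basin
  is unbounded. In the model, properness reduces to that of squaring on the disc.\<close>

lemma immediate_basin_proper:
  assumes K: "compact K" "K \<subseteq> immediate_basin"
  shows "compact {z \<in> immediate_basin. ftan l z \<in> K}"
proof -
  obtain R \<phi> h where "square_model R \<phi> h" using immediate_basin_model by blast
  note M = square_modelD[OF this]
  define S where "S = (\<lambda>x::complex. x\<^sup>2) -` (\<phi> ` K)"
  have "compact (\<phi> ` K)"
    using continuous_on_subset[OF holomorphic_on_imp_continuous_on[OF M(2)] K(2)] K(1)
    by (rule compact_continuous_image)
  then have "closed S" unfolding S_def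
    by (intro closed_vimage compact_imp_closed continuous_intros)
  have KB: "\<phi> ` K \<subseteq> ball 0 1" using M(4) K(2) by blast
  have SB: "S \<subseteq> ball 0 1"
  proof
    fix x assume "x \<in> S"
    then have "x\<^sup>2 \<in> ball 0 1" using KB by (auto simp: S_def)
    then show "x \<in> ball 0 1" by (simp add: norm_power power_less_one_iff)
  qed
  then have "compact S" using \<open>closed S\<close> bounded_subset[OF bounded_ball SB] compact_eq_bounded_closed by blast
  then have "compact (h ` S)"
    using continuous_on_subset[OF holomorphic_on_imp_continuous_on[OF M(6)] SB] compact_continuous_image by blast
  moreover have "{z \<in> immediate_basin. ftan l z \<in> K} = h ` S"
  proof
    have sq: "x\<^sup>2 \<in> ball 0 1" if "x \<in> ball 0 1" for x :: complex
      using that by (simp add: norm_power power_less_one_iff)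
    show "h ` S \<subseteq> {z \<in> immediate_basin. ftan l z \<in> K}"
    proof clarify
      fix x assume x: "x \<in> S"
      then have xB: "x \<in> ball 0 1" using SB by blast
      obtain w where w: "w \<in> K" "x\<^sup>2 = \<phi> w" using x by (auto simp: S_def)
      then have "ftan l (h x) = w" using M(10)[OF xB] M(4) K(2) by auto
      then show "h x \<in> immediate_basin \<and> ftan l (h x) \<in> K" using w(1) xB M(8) by blast
    qed
    show "{z \<in> immediate_basin. ftan l z \<in> K} \<subseteq> h ` S"
    proof clarify
      fix z assume z: "z \<in> immediate_basin" "ftan l z \<in> K"
      then obtain x where x: "x \<in> ball 0 1" "z = h x" using M(8) by blast
      have "x\<^sup>2 = \<phi> (ftan l z)" using M(5)[OF sq[OF x(1)]] M(10)[OF x(1)] x(2) by simp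
      then show "z \<in> h ` S" using z(2) x(2) by (auto simp: S_def)
    qed
  qed
  ultimately show ?thesis by simp
qed

text \<open>The model uses different coordinates in source and target. Changing the target
  coordinate to \<open>h\<close> introduces a disc automorphism, which is a Moebius map moving 0 to
  \<open>a\<close> composed with a rotation.\<close>

lemma immediate_basin_blaschke:
  obtains h a \<omega> where "h holomorphic_on ball 0 1" "inj_on h (ball 0 1)" "h ` ball 0 1 = immediate_basin"
    "cmod a < 1" "cmod \<omega> = 1"
    "\<And>\<zeta>. \<zeta> \<in> ball 0 1 \<Longrightarrow> blaschke2 a \<omega> \<zeta> \<in> ball 0 1 \<and> ftan l (h \<zeta>) = h (blaschke2 a \<omega> \<zeta>)"
proof -
  obtain R \<phi> h where "square_model R \<phi> h" using immediate_basin_model by blast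
  note M = square_modelD[OF this]
  obtain k where k: "k holomorphic_on h ` ball 0 1" "\<And>x. x \<in> ball 0 1 \<Longrightarrow> k (h x) = x"
    using holomorphic_inverse_exists[OF M(6) open_ball M(7)] by blast
  have khol: "k holomorphic_on immediate_basin" using k(1) by (simp only: M(8))
  have hB: "h x \<in> immediate_basin" if "x \<in> ball 0 1" for x using that M(8) by blast
  have kB: "k z \<in> ball 0 1" "h (k z) = z" if z: "z \<in> immediate_basin" for z
  proof -
    obtain x where "x \<in> ball 0 1" "z = h x" using z M(8) by blast
    then show "k z \<in> ball 0 1" "h (k z) = z" using k(2) by simp_all
  qed
  \<comment> \<open>\<open>a\<close> is the \<open>h\<close>-coordinate of the critical value. With
    \<open>m 0 = a\<close>, the map \<open>\<phi> \<circ> (h \<circ> m)\<close> fixes 0, so it is a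
    rotation by Schwarz.\<close>
  define a where "a = k (ftan l crit)"
  have v: "ftan l crit \<in> immediate_basin" using immediate_basin_step[OF crit(1)] .
  have a: "cmod a < 1" "h a = ftan l crit" using kB[OF v] by (simp_all add: a_def)
  define m where "m = Moebius_function 0 (- a)"
  define m' where "m' = Moebius_function 0 a"
  have am: "cmod (- a) < 1" using a by simp
  have mB: "m x \<in> ball 0 1" "m' x \<in> ball 0 1" if "x \<in> ball 0 1" for x
    using Moebius_function_norm_lt_1[OF am] Moebius_function_norm_lt_1[OF a(1)] that by (simp_all add: m_def m'_def)
  have m'm: "m' (m x) = x" if "x \<in> ball 0 1" for x
    unfolding m_def m'_def by (rule Moebius_function_compose) (use a that in auto)
  have mhol: "m holomorphic_on ball 0 1" "m' holomorphic_on ball 0 1"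
    unfolding m_def m'_def by (rule Moebius_function_holomorphic; use a in simp)+
  have m0: "m 0 = a" by (simp add: m_def Moebius_function_of_zero)
  have "\<exists>\<omega>. cmod \<omega> = 1 \<and> (\<forall>z\<in>ball 0 1. (\<phi> \<circ> (h \<circ> m)) z = \<omega> * z)"
  proof (rule disc_automorphism_fixing_0[of "\<phi> \<circ> (h \<circ> m)" "m' \<circ> (k \<circ> R)"])
    have hm: "h \<circ> m holomorphic_on ball 0 1"
      by (rule holomorphic_on_compose[OF mhol(1) holomorphic_on_subset[OF M(6)]]) (use mB in auto)
    show "\<phi> \<circ> (h \<circ> m) holomorphic_on ball 0 1"
      by (rule holomorphic_on_compose[OF hm holomorphic_on_subset[OF M(2)]]) (use mB hB in auto)
    have kR: "k \<circ> R holomorphic_on ball 0 1"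
      by (rule holomorphic_on_compose[OF M(1) holomorphic_on_subset[OF khol]]) (use M(5) in auto)
    show "m' \<circ> (k \<circ> R) holomorphic_on ball 0 1"
      by (rule holomorphic_on_compose[OF kR holomorphic_on_subset[OF mhol(2)]]) (use M(5) kB in auto)
    show "(\<phi> \<circ> (h \<circ> m)) z \<in> ball 0 1" if "z \<in> ball 0 1" for z
      using M(4)[OF hB[OF mB(1)[OF that]]] by simp
    show "(\<phi> \<circ> (h \<circ> m)) 0 = 0" using M(5)[of 0] M(3) by (simp add: m0 a(2))
    show "(m' \<circ> (k \<circ> R)) z \<in> ball 0 1" if "z \<in> ball 0 1" for z
      using mB(2)[OF kB(1)] M(5)[OF that] by auto
    show "(m' \<circ> (k \<circ> R)) ((\<phi> \<circ> (h \<circ> m)) z) = z" if "z \<in> ball 0 1" for z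
      using M(4)[OF hB[OF mB(1)[OF that]]] k(2)[OF mB(1)[OF that]] m'm[OF that] by simp
  qed
  then obtain \<omega> where \<omega>: "cmod \<omega> = 1" "\<And>z. z \<in> ball 0 1 \<Longrightarrow> (\<phi> \<circ> (h \<circ> m)) z = \<omega> * z" by blast
  show ?thesis
  \<comment> \<open>The rotation expresses \<open>\<phi>\<close> through \<open>h\<close>; the
    Blaschke product needs its inverse, hence the conjugate.\<close>
  proof (rule that[OF M(6,7,8) a(1), of "cnj \<omega>"])
    show "cmod (cnj \<omega>) = 1" using \<omega>(1) by simp
    fix \<zeta> :: complex assume z: "\<zeta> \<in> ball 0 1"
    define X where "X = cnj \<omega> * \<zeta>\<^sup>2"
    have z2: "cmod (\<zeta>\<^sup>2) < 1" using z by (simp add: norm_power power_less_one_iff)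
    then have X: "X \<in> ball 0 1" using \<omega>(1) by (simp add: X_def norm_mult)
    have ww: "\<omega> * cnj \<omega> = 1" unfolding complex_norm_square[symmetric] using \<omega>(1) by simp
    have "\<phi> (h (m X)) = (\<omega> * cnj \<omega>) * \<zeta>\<^sup>2" using \<omega>(2)[OF X] by (simp add: X_def mult.assoc)
    then have "\<phi> (h (m X)) = \<zeta>\<^sup>2" by (simp only: ww mult_1_left)
    then have "h (m X) = R (\<zeta>\<^sup>2)" using M(4)[OF hB[OF mB(1)[OF X]]] by simp
    then have "ftan l (h \<zeta>) = h (m X)" using M(10)[OF z] by simp
    moreover have "blaschke2 a (cnj \<omega>) \<zeta> = m X"
      by (simp add: blaschke2_def m_def X_def Moebius_function_simple)
    ultimately show "blaschke2 a (cnj \<omega>) \<zeta> \<in> ball 0 1 \<and> ftan l (h \<zeta>) = h (blaschke2 a (cnj \<omega>) \<zeta>)"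
      using mB(1)[OF X] by simp
  qed
qed

text \<open>Approach the boundary fixed point of the Blaschke product radially: if the domain were bounded,
  the displacement \<open>f z - z = l + tan z\<close> would tend to 0 there, but its zeros are interior points.\<close>
lemma unbounded_immediate_basin: "\<not> bounded immediate_basin"
proof
  assume bd: "bounded immediate_basin"
  obtain h a \<omega> where h: "h holomorphic_on ball 0 1" "inj_on h (ball 0 1)" "h ` ball 0 1 = immediate_basin"
    and a: "cmod a < 1" "cmod \<omega> = 1"
    and b: "\<And>\<zeta>. \<zeta> \<in> ball 0 1 \<Longrightarrow> blaschke2 a \<omega> \<zeta> \<in> ball 0 1 \<and> ftan l (h \<zeta>) = h (blaschke2 a \<omega> \<zeta>)"
    using immediate_basin_blaschke by metis
  obtain \<xi> where \<xi>: "cmod \<xi> = 1" "blaschke2 a \<omega> \<xi> = \<xi>" using blaschke2_fixed_point[OF a] by blast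
  obtain C c where Cc: "0 < C" "0 < c" "c \<le> 1"
    "\<And>r. 0 < r \<Longrightarrow> r < 1 \<Longrightarrow> cmod (blaschke2 a \<omega> (of_real r * \<xi>) - of_real r * \<xi>) \<le> C * (1 - r)"
    "\<And>r. 0 < r \<Longrightarrow> r < 1 \<Longrightarrow> c * (1 - r) \<le> 1 - cmod (blaschke2 a \<omega> (of_real r * \<xi>))"
    using blaschke2_near_boundary[OF a \<xi>] by metis
  have bdh: "bounded (h ` ball 0 1)" using bd h(3) by simp
  define r where "r = (\<lambda>n. 1 - inverse (real (Suc (Suc n))))"
  have r: "0 < r n" "r n < 1" for n
  proof -
    have "inverse (real (Suc (Suc n))) < inverse 1" by (rule less_imp_inverse_less) auto
    then show "0 < r n" by (simp add: r_def)
  qed (simp add: r_def)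
  have rlim: "(\<lambda>n. 1 - r n) \<longlonglongrightarrow> 0"
    using LIMSEQ_Suc[OF LIMSEQ_inverse_real_of_nat] by (simp add: r_def)
  define \<zeta> where "\<zeta> = (\<lambda>n. of_real (r n) * \<xi>)"
  have n\<zeta>: "cmod (\<zeta> n) = r n" for n using r(1)[of n] \<xi>(1) by (simp add: \<zeta>_def norm_mult)
  have \<zeta>B: "\<zeta> n \<in> ball 0 1" for n using n\<zeta> r(2) by simp
  define z where "z = (\<lambda>n. h (\<zeta> n))"
  have zW: "z n \<in> immediate_basin" for n using h(3) \<zeta>B by (auto simp: z_def)
  have small: "\<forall>\<^sub>F n in sequentially. cmod (ftan l (z n) - z n) \<le> e" if e: "e > 0" for e
  proof -
    \<comment> \<open>Chosen so that the derivative bound \<open>e' / (c * (1 - r))\<close> times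
      the segment length \<open>C * (1 - r)\<close> is exactly \<open>e\<close>.\<close>
    define e' where "e' = e * c / C"
    have e': "e' > 0" using e Cc by (simp add: e'_def)
    obtain \<rho> where \<rho>: "\<rho> < 1" "\<And>\<eta>. \<rho> < cmod \<eta> \<Longrightarrow> cmod \<eta> < 1 \<Longrightarrow> (1 - cmod \<eta>) * cmod (deriv h \<eta>) \<le> e'"
      using bounded_univalent_little_bloch[OF h(1,2) bdh e'] by blast
    \<comment> \<open>Points of the segment have
      \<open>1 - cmod \<eta> <= (C + 1) * (1 - r n)\<close>, so eventually the whole segment lies
      where the estimate with \<open>\<rho>\<close> is valid.\<close>
    have "(\<lambda>n. (C + 1) * (1 - r n)) \<longlonglongrightarrow> (C + 1) * 0" by (intro tendsto_intros rlim)
    then have "\<forall>\<^sub>F n in sequentially. (C + 1) * (1 - r n) < 1 - \<rho>"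
      using \<rho>(1) by (intro order_tendstoD(2)) auto
    then show ?thesis
    proof (rule eventually_mono)
      fix n assume n: "(C + 1) * (1 - r n) < 1 - \<rho>"
      define \<beta> where "\<beta> = blaschke2 a \<omega> (\<zeta> n)"
      have dist: "cmod (\<beta> - \<zeta> n) \<le> C * (1 - r n)" unfolding \<beta>_def \<zeta>_def by (rule Cc(4)[OF r])
      have gap: "c * (1 - r n) \<le> 1 - cmod \<beta>" unfolding \<beta>_def \<zeta>_def by (rule Cc(5)[OF r])
      have \<beta>B: "\<beta> \<in> ball 0 1" "ftan l (h (\<zeta> n)) = h \<beta>" using b[OF \<zeta>B[of n]] by (auto simp: \<beta>_def)
      have d0: "0 < 1 - r n" using r(2)[of n] by simp
      have seg: "\<rho> < cmod \<eta>" "cmod \<eta> < 1" "c * (1 - r n) \<le> 1 - cmod \<eta>"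
        if \<eta>: "\<eta> \<in> closed_segment (\<zeta> n) \<beta>" for \<eta>
      proof -
        have "closed_segment (\<zeta> n) \<beta> \<subseteq> cball 0 (1 - c * (1 - r n))"
        proof (rule closed_segment_subset)
          have "c * (1 - r n) \<le> 1 * (1 - r n)" using Cc(3) d0 by (intro mult_right_mono) auto
          then show "\<zeta> n \<in> cball 0 (1 - c * (1 - r n))" using n\<zeta>[of n] by simp
          show "\<beta> \<in> cball 0 (1 - c * (1 - r n))" using gap by simp
        qed simp
        then have "cmod \<eta> \<le> 1 - c * (1 - r n)" using \<eta> by auto
        then show g: "c * (1 - r n) \<le> 1 - cmod \<eta>" by linarith
        have "0 < c * (1 - r n)" using Cc(2) d0 by simp
        then show "cmod \<eta> < 1" using g by linarith
        have "cmod (\<eta> - \<zeta> n) \<le> cmod (\<beta> - \<zeta> n)"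
          using segment_bound(1)[OF \<eta>] by simp
        then have "r n - cmod \<eta> \<le> C * (1 - r n)"
          using norm_triangle_ineq2[of "\<zeta> n" \<eta>] dist n\<zeta>[of n] by (simp add: norm_minus_commute)
        then show "\<rho> < cmod \<eta>" using n by (simp add: algebra_simps)
      qed
      have db: "cmod (deriv h \<eta>) \<le> e' / (c * (1 - r n))" if \<eta>: "\<eta> \<in> closed_segment (\<zeta> n) \<beta>" for \<eta>
      proof -
        have "c * (1 - r n) * cmod (deriv h \<eta>) \<le> (1 - cmod \<eta>) * cmod (deriv h \<eta>)"
          by (intro mult_right_mono seg(3)[OF \<eta>]) simp
        also have "\<dots> \<le> e'" by (rule \<rho>(2)[OF seg(1,2)[OF \<eta>]])
        finally show ?thesis using Cc(2) d0 by (simp add: pos_le_divide_eq mult.commute)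
      qed
      have "cmod (h \<beta> - h (\<zeta> n)) \<le> e' / (c * (1 - r n)) * cmod (\<beta> - \<zeta> n)"
      proof (rule field_differentiable_bound[of "closed_segment (\<zeta> n) \<beta>" h "deriv h"])
        fix \<eta> assume \<eta>: "\<eta> \<in> closed_segment (\<zeta> n) \<beta>"
        have "\<eta> \<in> ball 0 1" using seg(2)[OF \<eta>] by simp
        then show "(h has_field_derivative deriv h \<eta>) (at \<eta> within closed_segment (\<zeta> n) \<beta>)"
          using holomorphic_derivI[OF h(1) open_ball] by blast
        show "cmod (deriv h \<eta>) \<le> e' / (c * (1 - r n))" by (rule db[OF \<eta>])
      qed auto
      also have "\<dots> \<le> e' / (c * (1 - r n)) * (C * (1 - r n))"
        using e' Cc(2) d0 by (intro mult_left_mono dist) auto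
      also have "\<dots> = e" using Cc(1,2) d0 by (simp add: e'_def)
      finally show "cmod (ftan l (z n) - z n) \<le> e" by (simp add: z_def \<beta>B(2))
    qed
  qed
  have "bounded (range z)" using zW by (intro bounded_subset[OF bd]) blast
  then obtain w s where s: "strict_mono s" "(z \<circ> s) \<longlonglongrightarrow> w"
    using bounded_imp_convergent_subsequence by blast
  obtain B where B: "\<And>x. x \<in> immediate_basin \<Longrightarrow> cmod x \<le> B" using bd by (auto simp: bounded_iff)
  have wd: "w \<in> tan_domain"
  proof (rule tan_domain_limit_bounded[OF s(2)])
    show "(z \<circ> s) n \<in> tan_domain" for n using zW immediate_basin_dom by auto
    show "cmod (ftan l ((z \<circ> s) n)) \<le> B" for n using B zW immediate_basin_step by simp
  qed
  have "(\<lambda>n. ftan l (z n) - z n) \<longlonglongrightarrow> 0"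
  proof (rule tendstoI)
    fix e :: real assume "e > 0"
    then have "\<forall>\<^sub>F n in sequentially. cmod (ftan l (z n) - z n) \<le> e / 2" using small[of "e/2"] by simp
    then show "\<forall>\<^sub>F n in sequentially. dist (ftan l (z n) - z n) 0 < e"
      using \<open>e > 0\<close> by (elim eventually_mono) simp
  qed
  then have lim1: "(\<lambda>n. ftan l ((z \<circ> s) n) - (z \<circ> s) n) \<longlonglongrightarrow> 0"
    using LIMSEQ_subseq_LIMSEQ[OF _ s(1)] by (fastforce simp: o_def)
  have "isCont (ftan l) w"
    using continuous_on_ftan open_tan_domain wd continuous_on_eq_continuous_at by blast
  then have "(\<lambda>n. ftan l ((z \<circ> s) n)) \<longlonglongrightarrow> ftan l w" using s(2) by (rule isCont_tendsto_compose)
  from tendsto_diff[OF this s(2)] have "ftan l w - w = 0" using lim1 LIMSEQ_unique by blast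
  moreover have "ftan l w - w = l + tan w" by (simp add: ftan_def)
  ultimately have "l + tan w = 0" by simp
  then have "tan w = - l" by (simp only: add_eq_0_iff)
  then obtain k :: int where k: "w = z0 + of_int k * of_real pi" using ftan_fixed_points[OF wd] by blast
  \<comment> \<open>The limit is an attracting fixed point with open basin, which must have index 0
    as the sequence stays in \<open>basin 0\<close>. So \<open>w\<close> is an interior point; its
    disc coordinate would be a limit of the \<open>\<zeta> (s n)\<close>, whose moduli tend to
    1.\<close>
  have "\<forall>\<^sub>F n in sequentially. (z \<circ> s) n \<in> basin k"
    using topological_tendstoD[OF s(2) open_basin] z0_basin[of k] k by blast
  then obtain n where "(z \<circ> s) n \<in> basin k" using eventually_happens'[OF sequentially_bot] by blast
  then have "z (s n) \<in> basin k" by simp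
  moreover have "z (s n) \<in> basin 0" using zW[of "s n"] immediate_basin_subset by blast
  ultimately have "k = 0" using basin_disjoint[of k 0] by blast
  then have wW: "w \<in> immediate_basin" using k z0_immediate_basin by simp
  obtain g where g: "g holomorphic_on h ` ball 0 1" "\<And>x. x \<in> ball 0 1 \<Longrightarrow> g (h x) = x"
    using holomorphic_inverse_exists[OF h(1) open_ball h(2)] by blast
  have "continuous_on immediate_basin g" using g(1) unfolding h(3) by (rule holomorphic_on_imp_continuous_on)
  then have "isCont g w" using wW open_immediate_basin continuous_on_eq_continuous_at by blast
  then have "(\<lambda>n. g ((z \<circ> s) n)) \<longlonglongrightarrow> g w" using s(2) by (rule isCont_tendsto_compose)
  then have "(\<lambda>n. \<zeta> (s n)) \<longlonglongrightarrow> g w" using g(2)[OF \<zeta>B] by (simp add: z_def)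
  then have "(\<lambda>n. cmod (\<zeta> (s n))) \<longlonglongrightarrow> cmod (g w)" by (rule tendsto_norm)
  then have lim2: "(\<lambda>n. 1 - r (s n)) \<longlonglongrightarrow> 1 - cmod (g w)" unfolding n\<zeta> by (intro tendsto_intros)
  have "(\<lambda>n. 1 - r (s n)) \<longlonglongrightarrow> 0" using LIMSEQ_subseq_LIMSEQ[OF rlim s(1)] by (simp add: o_def)
  then have "1 - cmod (g w) = 0" by (rule LIMSEQ_unique[OF lim2])
  then have "cmod (g w) = 1" by simp
  moreover have "g w \<in> ball 0 1" using wW g(2) unfolding h(3)[symmetric] by auto
  ultimately show False by simp
qed

end

section \<open>Wandering domains\<close>

text \<open>Critical points are simple: with \<open>(tan z)^2 = - 2\<close> the second derivative
  \<open>2 * tan z * (1 + (tan z)^2)\<close> equals \<open>- 2 * tan z\<close> and does not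
  vanish.\<close>

lemma zorder_ftan_diff:
  assumes z: "z \<in> tan_domain" and w: "ftan \<mu> z = w"
  shows "zorder (\<lambda>x. ftan \<mu> x - w) z = (if 2 + (tan z)\<^sup>2 = 0 then 2 else 1)"
proof -
  define g where "g = (\<lambda>x. ftan \<mu> x - w)"
  have holg: "g holomorphic_on tan_domain" unfolding g_def by (intro holomorphic_intros holomorphic_ftan)
  have g0: "g z = 0" using w by (simp add: g_def)
  have dg: "deriv g x = 2 + (tan x)\<^sup>2" if "x \<in> tan_domain" for x
  proof -
    have "(g has_field_derivative (2 + (tan x)\<^sup>2 - 0)) (at x)"
      unfolding g_def by (intro DERIV_diff has_field_derivative_ftan that DERIV_const)
    then show ?thesis using DERIV_imp_deriv by fastforce
  qed
  have "\<forall>\<^sub>F x in nhds z. deriv g x = deriv (ftan \<mu>) x"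
    using eventually_nhds_in_open[OF open_tan_domain z] by (rule eventually_mono) (simp add: dg deriv_ftan)
  then have "deriv (deriv g) z = deriv (deriv (ftan \<mu>)) z" by (intro deriv_cong_ev) auto
  then have ddg: "deriv (deriv g) z = 2 * tan z * (1 + (tan z)\<^sup>2)" by (simp add: deriv_deriv_ftan[OF z])
  have "zorder g z = (if 2 + (tan z)\<^sup>2 = 0 then 2 else 1)"
  proof (cases "2 + (tan z)\<^sup>2 = 0")
    case True
    then have t2: "(tan z)\<^sup>2 = - 2" by (simp add: add_eq_0_iff)
    then have "tan z \<noteq> 0" by auto
    then have dd: "deriv (deriv g) z \<noteq> 0" unfolding ddg t2 by simp
    have "zorder g z = 2"
    proof (rule zorder_zero_eqI[OF holg open_tan_domain z])
      show "(deriv ^^ i) g z = 0" if "i < nat 2" for i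
      proof -
        have "i = 0 \<or> i = 1" using that by auto
        then show ?thesis using g0 dg[OF z] True by auto
      qed
      show "(deriv ^^ nat 2) g z \<noteq> 0" using dd by (simp add: numeral_2_eq_2)
    qed simp
    then show ?thesis using True by simp
  next
    case False
    have "zorder g z = 1"
      by (rule zorder_zero_eqI[OF holg open_tan_domain z]) (use g0 dg[OF z] False in auto)
    then show ?thesis using False by simp
  qed
  then show ?thesis by (simp add: g_def)
qed

context attracting_tan
begin

lemma immediate_eq_image: "immediate k = (\<lambda>z. z + of_int k * of_real pi) ` immediate_basin"
proof
  show "immediate k \<subseteq> (\<lambda>z. z + of_int k * of_real pi) ` immediate_basin"
  proof
    fix z assume "z \<in> immediate k"
    then have "z - of_int k * of_real pi \<in> immediate_basin" by (simp add: immediate_iff)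
    moreover have "z = (z - of_int k * of_real pi) + of_int k * of_real pi" by simp
    ultimately show "z \<in> (\<lambda>z. z + of_int k * of_real pi) ` immediate_basin" by blast
  qed
  show "(\<lambda>z. z + of_int k * of_real pi) ` immediate_basin \<subseteq> immediate k"
    by (auto simp: immediate_iff)
qed

lemma unbounded_immediate: "\<not> bounded (immediate k)"
proof
  assume "bounded (immediate k)"
  then have "bounded ((\<lambda>z. - (of_int k * of_real pi) + z) ` immediate k)" by (rule bounded_translation)
  moreover have "(\<lambda>z. - (of_int k * of_real pi) + z) ` immediate k = immediate_basin"
    unfolding immediate_eq_image image_image by simp
  ultimately show False using unbounded_immediate_basin by simp
qed

lemma trapping_ball:
  obtains r where "0 < r" "\<And>k. ball (z0 + of_int k * of_real pi) r \<subseteq> immediate k"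
proof -
  obtain r where r: "0 < r" "\<And>k z. z \<in> ball (z0 + of_int k * of_real pi) r \<Longrightarrow> z \<in> basin k"
    using trap by metis
  have "ball (z0 + of_int k * of_real pi) r \<subseteq> immediate k" for k
    unfolding immediate_def using r by (intro connected_component_maximal) auto
  then show ?thesis using r(1) that by blast
qed

lemma eventually_immediate:
  assumes z: "z \<in> basin k"
  obtains N where "\<And>n. n \<ge> N \<Longrightarrow> (ftan l ^^ n) z \<in> immediate k"
proof -
  have "(\<lambda>n. (ftan l ^^ n) z) \<longlonglongrightarrow> z0 + of_int k * of_real pi" using z by (simp add: basin_def)
  then have "\<forall>\<^sub>F n in sequentially. (ftan l ^^ n) z \<in> immediate k"
    using topological_tendstoD open_immediate fixed_point_immediate by blast
  then show ?thesis using that by (auto simp: eventually_sequentially)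
qed

end

section \<open>The shifted map: components, grand orbits, degrees\<close>

locale drifting_tan = attracting_tan +
  fixes m :: int
  assumes m_nonzero: "m \<noteq> 0"
begin

abbreviation f :: "complex \<Rightarrow> complex" where "f \<equiv> ftan (l + of_int m * of_real pi)"

lemma comp_of_eq: "comp_of f tan_domain w = connected_component_set all_basins w"
  unfolding comp_of_def fatou_set_eq_basins[OF m_nonzero] ..

lemma primary_component_eq: "primary_component (l + of_int m * of_real pi) = upper_basin l"
proof -
  have "\<i> \<in> upper_basin l" using upper_halfplane_subset_upper_basin[of l] by auto
  then show ?thesis unfolding primary_component_def comp_of_eq by (rule all_basins_component_upper)
qed

lemma funpow_f: "(f ^^ n) z = (ftan l ^^ n) z + of_int (int n * m) * of_real pi"
  by (rule funpow_ftan_param_add_int_pi)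

lemma f_eq: "f z = ftan l z + of_int m * of_real pi"
  by (rule ftan_param_add)

lemma funpow_f_basin: "z \<in> basin k \<Longrightarrow> (f ^^ n) z \<in> basin (k + int n * m)"
  unfolding funpow_f using funpow_basin basin_subset basin_add_int_pi by blast

lemma comp_of_basin: "z \<in> basin k \<Longrightarrow> comp_of f tan_domain z = basin_component k z"
  unfolding comp_of_eq by (rule all_basins_component)

lemma comp_of_iterate:
  "z \<in> basin k \<Longrightarrow> comp_of f tan_domain ((f ^^ n) z) = basin_component (k + int n * m) ((f ^^ n) z)"
  by (intro comp_of_basin funpow_f_basin)

lemma comp_of_iterate_mem:
  assumes "z \<in> basin k"
  shows "(f ^^ n) z \<in> comp_of f tan_domain ((f ^^ n) z)"
    and "comp_of f tan_domain ((f ^^ n) z) \<subseteq> basin (k + int n * m)"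
  unfolding comp_of_iterate[OF assms] using funpow_f_basin[OF assms] connected_component_subset by auto

text \<open>Each application of \<open>f\<close> raises the basin index by \<open>m\<close>, and
  basins are disjoint. Hence a common component forces equal indices, which yields both the
  wandering property and the separation of grand orbits.\<close>

lemma comp_of_iterates_eq_imp:
  assumes "z \<in> basin k" "w \<in> basin k'"
    and "comp_of f tan_domain ((f ^^ a) z) = comp_of f tan_domain ((f ^^ b) w)"
  shows "k + int a * m = k' + int b * m"
proof (rule ccontr)
  assume "k + int a * m \<noteq> k' + int b * m"
  note dis = basin_disjoint[OF this]
  have "(f ^^ a) z \<in> basin (k + int a * m)" by (rule funpow_f_basin[OF assms(1)])
  moreover have "(f ^^ a) z \<in> comp_of f tan_domain ((f ^^ b) w)"
    using comp_of_iterate_mem(1)[OF assms(1), of a] unfolding assms(3) .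
  then have "(f ^^ a) z \<in> basin (k' + int b * m)"
    using comp_of_iterate_mem(2)[OF assms(2)] by (rule subsetD[rotated])
  ultimately show False using dis by (metis IntI empty_iff)
qed

lemma fatou_component_cases:
  assumes "fatou_component f tan_domain Y"
  obtains "Y = upper_basin l" | k z where "z \<in> basin k" "Y = basin_component k z"
proof -
  obtain z where z: "z \<in> all_basins" "Y = connected_component_set all_basins z"
    using assms unfolding fatou_component_def fatou_set_eq_basins[OF m_nonzero] by blast
  show ?thesis
  proof (cases "z \<in> upper_basin l")
    case True
    then show ?thesis using that(1) z(2) all_basins_component_upper by simp
  next
    case False
    then obtain k where "z \<in> basin k" using z(1) by (auto simp: all_basins_def)
    then show ?thesis using that(2) z(2) all_basins_component by blast
  qed
qed

lemma basin_component_is_fatou_component: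
  assumes "z \<in> basin k" shows "fatou_component f tan_domain (basin_component k z)"
proof -
  have "z \<in> all_basins" using assms by (auto simp: all_basins_def)
  then show ?thesis
    unfolding fatou_component_def fatou_set_eq_basins[OF m_nonzero]
    using all_basins_component[OF assms] by blast
qed

lemma wandering_basin_component:
  assumes z: "z \<in> basin k" shows "wandering f tan_domain (basin_component k z)"
  unfolding wandering_def
proof (intro conjI allI impI ballI)
  show "fatou_component f tan_domain (basin_component k z)" by (rule basin_component_is_fatou_component[OF z])
  fix a b :: nat and x y
  assume ab: "a \<noteq> b" and xy: "x \<in> basin_component k z" "y \<in> basin_component k z"
  have "x \<in> basin k" "y \<in> basin k" using xy connected_component_subset by blast+
  then show "comp_of f tan_domain ((f ^^ a) x) \<noteq> comp_of f tan_domain ((f ^^ b) y)"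
    using comp_of_iterates_eq_imp[of x k y k a b] ab m_nonzero by auto
qed

lemma upper_basin_not_wandering: "\<not> wandering f tan_domain (upper_basin l)"
proof
  assume w: "wandering f tan_domain (upper_basin l)"
  have iU: "\<i> \<in> upper_basin l" using upper_halfplane_subset_upper_basin[of l] by auto
  have "Im (f \<i>) > 0" using Im_ftan_ge[of \<i> l] Im_pos by (simp add: f_eq)
  then have "f \<i> \<in> upper_basin l" using upper_halfplane_subset_upper_basin[of l] by auto
  then have "comp_of f tan_domain ((f ^^ 0) \<i>) = comp_of f tan_domain ((f ^^ 1) \<i>)"
    using iU all_basins_component_upper by (simp add: comp_of_eq)
  moreover have "comp_of f tan_domain ((f ^^ 0) \<i>) \<noteq> comp_of f tan_domain ((f ^^ 1) \<i>)"
    using w iU zero_neq_one unfolding wandering_def by blast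
  ultimately show False by blast
qed

lemma wandering_cases:
  assumes "wandering f tan_domain W"
  obtains k z where "z \<in> basin k" "W = basin_component k z"
proof -
  have "fatou_component f tan_domain W" using assms by (simp add: wandering_def)
  then show ?thesis
  proof (cases rule: fatou_component_cases)
    case 1
    then show ?thesis using assms upper_basin_not_wandering by blast
  next
    case (2 k z)
    then show ?thesis by (rule that)
  qed
qed

lemma iterate_immediate:
  assumes "(ftan l ^^ n) z \<in> immediate k"
  shows "(f ^^ n) z \<in> immediate (k + int n * m)"
  unfolding funpow_f using assms immediate_add_iff by blast

lemma comp_of_immediate:
  assumes "z \<in> immediate k" shows "comp_of f tan_domain z = immediate k"
  using comp_of_basin[of z k] immediate_subset[of k] immediate_eq_component[OF assms] assms by blast

text \<open>Grand orbits are residue classes of basin indices. For the converse, both orbits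
  eventually enter immediate basins, so it suffices to choose the numbers of iterations
  \<open>a\<close> and \<open>b\<close> with \<open>b - a = t\<close>.\<close>

lemma grand_orbit_iff:
  assumes z: "z \<in> basin k" and z': "z' \<in> basin k'"
  shows "basin_component k' z' \<in> grand_orbit f tan_domain (basin_component k z) \<longleftrightarrow> (\<exists>t. k' = k + t * m)"
proof
  assume "basin_component k' z' \<in> grand_orbit f tan_domain (basin_component k z)"
  then obtain a b x y where xy: "x \<in> basin_component k' z'" "y \<in> basin_component k z"
    "comp_of f tan_domain ((f ^^ a) x) = comp_of f tan_domain ((f ^^ b) y)"
    unfolding grand_orbit_def by blast
  have "x \<in> basin k'" "y \<in> basin k" using xy connected_component_subset by blast+
  from comp_of_iterates_eq_imp[OF this xy(3)] have "k' = k + (int b - int a) * m"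
    by (simp add: algebra_simps)
  then show "\<exists>t. k' = k + t * m" by blast
next
  assume "\<exists>t. k' = k + t * m"
  then obtain t where t: "k' = k + t * m" by blast
  obtain N where N: "\<And>n. n \<ge> N \<Longrightarrow> (ftan l ^^ n) z \<in> immediate k" using eventually_immediate[OF z] by blast
  obtain N' where N': "\<And>n. n \<ge> N' \<Longrightarrow> (ftan l ^^ n) z' \<in> immediate k'" using eventually_immediate[OF z'] by blast
  \<comment> \<open>The summand \<open>nat \<bar>t\<bar>\<close> makes \<open>int a + t\<close> at
    least \<open>N\<close>, also for negative \<open>t\<close>, so that \<open>nat\<close> loses
    nothing in \<open>b\<close>.\<close>
  define a where "a = N + N' + nat \<bar>t\<bar>"
  define b where "b = nat (int a + t)"
  have ab: "a \<ge> N'" "b \<ge> N" "int b = int a + t" by (auto simp: a_def b_def)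
  have "comp_of f tan_domain ((f ^^ a) z') = immediate (k' + int a * m)"
    by (rule comp_of_immediate[OF iterate_immediate[OF N'[OF ab(1)]]])
  moreover have "comp_of f tan_domain ((f ^^ b) z) = immediate (k + int b * m)"
    by (rule comp_of_immediate[OF iterate_immediate[OF N[OF ab(2)]]])
  moreover have "k' + int a * m = k + int b * m" unfolding t ab(3) by (simp add: algebra_simps)
  ultimately have eq: "comp_of f tan_domain ((f ^^ a) z') = comp_of f tan_domain ((f ^^ b) z)" by simp
  have "z' \<in> basin_component k' z'" "z \<in> basin_component k z" using z z' by simp_all
  then show "basin_component k' z' \<in> grand_orbit f tan_domain (basin_component k z)"
    unfolding grand_orbit_def using eq basin_component_is_fatou_component[OF z'] by blast
qed

lemma escaping_basin_component:
  assumes z: "z \<in> basin k" shows "escaping f (basin_component k z)"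
  unfolding escaping_def
proof
  fix x assume "x \<in> basin_component k z"
  then have "x \<in> basin k" using connected_component_subset by blast
  then have lim: "(\<lambda>n. (ftan l ^^ n) x) \<longlonglongrightarrow> z0 + of_int k * of_real pi" by (simp add: basin_def)
  have "(of_int m * of_real pi :: complex) \<noteq> 0" using m_nonzero by simp
  then have "filterlim (\<lambda>n. (of_int m * of_real pi) * (of_nat n :: complex)) at_infinity sequentially"
    by (rule tendsto_mult_filterlim_at_infinity[OF tendsto_const _ tendsto_of_nat])
  then have "filterlim (\<lambda>n. (ftan l ^^ n) x + (of_int m * of_real pi) * of_nat n) at_infinity sequentially"
    by (rule tendsto_add_filterlim_at_infinity[OF lim])
  moreover have "(f ^^ n) x = (ftan l ^^ n) x + (of_int m * of_real pi) * of_nat n" for n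
    unfolding funpow_f by simp
  ultimately show "filterlim (\<lambda>n. (f ^^ n) x) at_infinity sequentially" by simp
qed

text \<open>Conjugation by translations moves questions about \<open>f\<close> between two immediate
  basins to \<open>ftan l\<close> on the one at \<open>z0\<close>; stated for sets \<open>K\<close>,
  it serves both properness and degree.\<close>

lemma immediate_fibre:
  "{x \<in> immediate k. f x \<in> K} =
    (\<lambda>z. z + of_int k * of_real pi) ` {z \<in> immediate_basin. ftan l z \<in> (\<lambda>w. - (of_int (k + m) * of_real pi) + w) ` K}"
proof -
  have f_shift: "f (z + of_int k * of_real pi) = ftan l z + of_int (k + m) * of_real pi" for z
    unfolding f_eq ftan_add_int_pi by (simp add: algebra_simps)
  have mem: "ftan l z \<in> (\<lambda>w. - (of_int (k + m) * of_real pi) + w) ` K \<longleftrightarrow> f (z + of_int k * of_real pi) \<in> K" for z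
  proof -
    have "ftan l z \<in> (\<lambda>w. - (of_int (k + m) * of_real pi) + w) ` K \<longleftrightarrow>
        ftan l z + of_int (k + m) * of_real pi \<in> K"
    proof
      assume "ftan l z + of_int (k + m) * of_real pi \<in> K"
      then show "ftan l z \<in> (\<lambda>w. - (of_int (k + m) * of_real pi) + w) ` K"
        by (rule rev_image_eqI) (simp del: of_int_add)
    qed (auto simp del: of_int_add)
    then show ?thesis by (simp only: f_shift)
  qed
  show ?thesis unfolding immediate_eq_image mem by blast
qed

lemma proper_immediate: "proper_cmap f (immediate k) (immediate (k + m))"
  unfolding proper_cmap_def
proof (intro conjI allI impI)
  show "f ` immediate k \<subseteq> immediate (k + m)"
  proof clarify
    fix z assume "z \<in> immediate k"
    then have "ftan l (z - of_int k * of_real pi) \<in> immediate_basin"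
      using immediate_basin_step by (simp add: immediate_iff)
    moreover have "ftan l z = ftan l (z - of_int k * of_real pi) + of_int k * of_real pi"
      using ftan_add_int_pi[of l "z - of_int k * of_real pi" k] by simp
    ultimately have "ftan l z \<in> immediate k" by (simp add: immediate_iff)
    then show "f z \<in> immediate (k + m)" unfolding f_eq by (simp only: immediate_add_iff)
  qed
  fix K assume K: "compact K \<and> K \<subseteq> immediate (k + m)"
  have "compact {z \<in> immediate_basin. ftan l z \<in> (\<lambda>w. - (of_int (k + m) * of_real pi) + w) ` K}"
  proof (rule immediate_basin_proper)
    show "compact ((\<lambda>w. - (of_int (k + m) * of_real pi) + w) ` K)"
      using K by (intro compact_translation) simp
    show "(\<lambda>w. - (of_int (k + m) * of_real pi) + w) ` K \<subseteq> immediate_basin"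
    proof clarify
      fix w assume "w \<in> K"
      then have "w - of_int (k + m) * of_real pi \<in> immediate_basin" using K immediate_iff by blast
      then show "- (of_int (k + m) * of_real pi) + w \<in> immediate_basin" by (simp only: diff_conv_add_uminus add.commute)
    qed
  qed
  then show "compact {z \<in> immediate k. f z \<in> K}"
    unfolding immediate_fibre by (intro compact_continuous_image continuous_intros)
qed

text \<open>The fibre is either the translate of \<open>crit\<close> alone, with order 2, or two
  points of order 1.\<close>

lemma degree_immediate: "map_degree f (immediate k) (immediate (k + m)) 2"
  unfolding map_degree_def
proof
  fix w assume w: "w \<in> immediate (k + m)"
  define w' where "w' = w - of_int (k + m) * of_real pi"
  have w': "w' \<in> immediate_basin" using w immediate_iff unfolding w'_def by blast
  define S where "S = {z \<in> immediate_basin. ftan l z = w'}"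
  define T where "T = {z \<in> immediate k. f z = w}"
  have T_eq: "T = (\<lambda>z. z + of_int k * of_real pi) ` S"
    using immediate_fibre[of k "{w}"] unfolding T_def S_def w'_def by simp
  have inj: "inj_on (\<lambda>z. z + of_int k * of_real pi) S" by (rule inj_onI) simp
  have ord: "nat (zorder (\<lambda>x. f x - w) (z + of_int k * of_real pi)) = (if z = crit then 2 else 1)" if z: "z \<in> S" for z
  proof -
    have zI: "z \<in> immediate_basin" using z by (simp add: S_def)
    have "z + of_int k * of_real pi \<in> T" using z T_eq by blast
    then have fz: "f (z + of_int k * of_real pi) = w" by (simp add: T_def)
    have "z + of_int k * of_real pi \<in> tan_domain"
      unfolding tan_domain_add_int_pi using zI immediate_basin_dom by blast
    from zorder_ftan_diff[OF this fz]
    have "zorder (\<lambda>x. f x - w) (z + of_int k * of_real pi) = (if 2 + (tan z)\<^sup>2 = 0 then 2 else 1)"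
      unfolding tan_add_int_pi .
    moreover have "2 + (tan z)\<^sup>2 = 0 \<longleftrightarrow> z = crit"
    proof
      assume "2 + (tan z)\<^sup>2 = 0"
      then have "z = crit + of_int 0 * of_real pi"
        using critical_point_in_component[of z 0] zI immediate_basin_subset by blast
      then show "z = crit" by simp
    qed (simp add: crit(2))
    ultimately show ?thesis by simp
  qed
  have sum_eq: "(\<Sum>z\<in>T. nat (zorder (\<lambda>x. f x - w) z)) = (\<Sum>z\<in>S. if z = crit then 2 else 1)"
    unfolding T_eq sum.reindex[OF inj] o_def by (intro sum.cong refl ord)
  consider "S = {crit}" | "card S = 2" "crit \<notin> S"
    using immediate_basin_fibre[OF w'] unfolding S_def by blast
  then have "finite S \<and> (\<Sum>z\<in>S. if z = crit then 2 else 1) = (2::nat)"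
  proof cases
    case 2
    have "(\<Sum>z\<in>S. if z = crit then 2 else 1) = (\<Sum>z\<in>S. (1::nat))"
      using 2(2) by (intro sum.cong) auto
    then show ?thesis using 2(1) card.infinite by fastforce
  qed simp
  then have "finite T \<and> (\<Sum>z\<in>T. nat (zorder (\<lambda>x. f x - w) z)) = 2"
    unfolding sum_eq using T_eq by simp
  then show "finite {z \<in> immediate k. f z = w} \<and>
      (\<Sum>z\<in>{z \<in> immediate k. f z = w}. nat (zorder (\<lambda>x. f x - w) z)) = 2"
    by (simp only: T_def)
qed

text \<open>After subtracting the drift the orbit converges to a fixed point, around which every
  immediate basin contains a ball of one common radius \<open>r\<close>; so eventually the distance
  is at least \<open>r / 2\<close>.\<close>

lemma liminf_infdist_pos:
  assumes z: "z \<in> basin k"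
  shows "0 < liminf (\<lambda>n. ereal (infdist ((f ^^ n) z) (frontier (comp_of f tan_domain ((f ^^ n) z)))))"
proof -
  obtain r where r: "0 < r" "\<And>k. ball (z0 + of_int k * of_real pi) r \<subseteq> immediate k"
    using trapping_ball by metis
  have "(\<lambda>n. (ftan l ^^ n) z) \<longlonglongrightarrow> z0 + of_int k * of_real pi" using z by (simp add: basin_def)
  then have ev: "\<forall>\<^sub>F n in sequentially. dist ((ftan l ^^ n) z) (z0 + of_int k * of_real pi) < r / 2"
    using r(1) by (intro tendstoD) auto
  have "\<forall>\<^sub>F n in sequentially. ereal (r / 2) \<le>
      ereal (infdist ((f ^^ n) z) (frontier (comp_of f tan_domain ((f ^^ n) z))))"
  proof (rule eventually_mono[OF ev])
    fix n assume n: "dist ((ftan l ^^ n) z) (z0 + of_int k * of_real pi) < r / 2"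
    define a where "a = z0 + of_int (k + int n * m) * of_real pi"
    define x where "x = (f ^^ n) z"
    have "x - a = (ftan l ^^ n) z - (z0 + of_int k * of_real pi)"
      unfolding x_def a_def funpow_f by (simp add: algebra_simps)
    then have xa: "dist x a < r / 2" using n by (simp add: dist_norm)
    then have "x \<in> ball a r" using r(1) by (simp add: dist_commute)
    then have xI: "x \<in> immediate (k + int n * m)" using r(2) unfolding a_def by blast
    have comp: "comp_of f tan_domain x = immediate (k + int n * m)" by (rule comp_of_immediate[OF xI])
    \<comment> \<open>\<open>infdist\<close> to the empty set is 0, so the frontier has to be shown
      nonempty; the point \<open>\<i>\<close> shows that the component is not the whole
      plane.\<close>
    have "\<i> \<notin> immediate (k + int n * m)" using immediate_subset Im_basin[of \<i> "k + int n * m"] by auto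
    then have ne: "frontier (immediate (k + int n * m)) \<noteq> {}"
      using xI frontier_eq_empty[of "immediate (k + int n * m)"] by blast
    have "r / 2 \<le> dist x y" if y: "y \<in> frontier (immediate (k + int n * m))" for y
    proof -
      have "y \<notin> immediate (k + int n * m)"
        using y open_immediate[of "k + int n * m"] by (simp add: frontier_def interior_open)
      then have "y \<notin> ball a r" using r(2)[of "k + int n * m"] unfolding a_def by blast
      then have "r \<le> dist a y" by simp
      then show ?thesis using xa dist_triangle[of a y x] by (simp add: dist_commute)
    qed
    then have "r / 2 \<le> infdist x (frontier (immediate (k + int n * m)))"
      unfolding infdist_notempty[OF ne] using ne by (intro cINF_greatest)
    then show "ereal (r / 2) \<le> ereal (infdist ((f ^^ n) z) (frontier (comp_of f tan_domain ((f ^^ n) z))))"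
      using comp by (simp add: x_def)
  qed
  then have "ereal (r / 2) \<le> liminf (\<lambda>n. ereal (infdist ((f ^^ n) z) (frontier (comp_of f tan_domain ((f ^^ n) z)))))"
    by (rule Liminf_bounded)
  moreover have "0 < ereal (r / 2)" using r(1) by simp
  ultimately show ?thesis by (rule less_le_trans[rotated])
qed

lemma wandering_immediate: "wandering f tan_domain (immediate k)"
  unfolding immediate_def by (rule wandering_basin_component[OF z0_basin])

lemma immediate_grand_orbit_iff:
  "immediate k' \<in> grand_orbit f tan_domain (immediate k) \<longleftrightarrow> (\<exists>t. k' = k + t * m)"
  unfolding immediate_def by (rule grand_orbit_iff[OF z0_basin z0_basin])

lemma wandering_properties:
  assumes W: "wandering f tan_domain W"
  shows "escaping f W" (is ?esc)
    and "\<exists>Wn :: int \<Rightarrow> complex set.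
      (\<forall>n. wandering f tan_domain (Wn n) \<and> Wn n \<in> grand_orbit f tan_domain W
           \<and> \<not> bounded (Wn n)
           \<and> proper_cmap f (Wn n) (Wn (n + 1)) \<and> map_degree f (Wn n) (Wn (n + 1)) 2)
      \<and> (\<forall>W'. wandering f tan_domain W' \<and> W' \<in> grand_orbit f tan_domain W
               \<and> W' \<notin> range Wn \<longrightarrow> inj_on f W')" (is "\<exists>Wn. ?P Wn")
    and "\<forall>z\<in>W. liminf (\<lambda>n. ereal (infdist ((f ^^ n) z)
            (frontier (comp_of f tan_domain ((f ^^ n) z))))) > 0" (is ?lim)
proof -
  obtain k z where z: "z \<in> basin k" "W = basin_component k z" using wandering_cases[OF W] by blast
  show ?esc unfolding z(2) by (rule escaping_basin_component[OF z(1)])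
  have "W \<subseteq> basin k" unfolding z(2) by (rule connected_component_subset)
  then show ?lim using liminf_infdist_pos by blast
  \<comment> \<open>The two-sided sequence runs through the immediate basins whose index is
    congruent to \<open>k\<close> modulo \<open>m\<close>; all other components in the grand orbit
    are free of critical points.\<close>
  have "?P (\<lambda>n. immediate (k + n * m))"
  proof (intro conjI allI impI)
    fix n :: int
    show "wandering f tan_domain (immediate (k + n * m))" by (rule wandering_immediate)
    show "immediate (k + n * m) \<in> grand_orbit f tan_domain W"
      unfolding z(2) immediate_def grand_orbit_iff[OF z(1) z0_basin] by blast
    show "\<not> bounded (immediate (k + n * m))" by (rule unbounded_immediate)
    have e: "k + (n + 1) * m = (k + n * m) + m" by (simp add: algebra_simps)
    show "proper_cmap f (immediate (k + n * m)) (immediate (k + (n + 1) * m))"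
      unfolding e by (rule proper_immediate)
    show "map_degree f (immediate (k + n * m)) (immediate (k + (n + 1) * m)) 2"
      unfolding e by (rule degree_immediate)
  next
    fix W' assume W': "wandering f tan_domain W' \<and> W' \<in> grand_orbit f tan_domain W \<and> W' \<notin> range (\<lambda>n. immediate (k + n * m))"
    obtain k' z' where z': "z' \<in> basin k'" "W' = basin_component k' z'" using wandering_cases W' by blast
    obtain t where t: "k' = k + t * m" using W' grand_orbit_iff[OF z(1) z'(1)] z(2) z'(2) by auto
    have "W' \<noteq> immediate k'" using W' t by blast
    then have "inj_on (ftan l) W'" using ftan_inj_on_nonimmediate[OF z'(1)] z'(2) by simp
    then show "inj_on f W'" unfolding f_eq[abs_def] inj_on_def by simp
  qed
  then show "\<exists>Wn. ?P Wn" by (rule exI[where x = "\<lambda>n. immediate (k + n * m)"])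
qed

text \<open>One immediate basin for each residue class modulo \<open>\<bar>m\<bar>\<close>, which by
  \<open>immediate_grand_orbit_iff\<close> means one for each grand orbit.\<close>

definition representatives :: "complex set set" where
  "representatives = immediate ` {0..<\<bar>m\<bar>}"

lemma card_representatives: "finite representatives" "card representatives = nat \<bar>m\<bar>"
proof -
  show "finite representatives" by (simp add: representatives_def)
  have "inj_on immediate {0..<\<bar>m\<bar>}" by (rule inj_onI) (simp add: immediate_eq_iff)
  then show "card representatives = nat \<bar>m\<bar>" by (simp add: representatives_def card_image)
qed

lemma representatives_distinct:
  assumes "W \<in> representatives" "W' \<in> representatives" "W \<noteq> W'"
  shows "W' \<notin> grand_orbit f tan_domain W"
proof
  assume go: "W' \<in> grand_orbit f tan_domain W"
  obtain j where j: "W = immediate j" "0 \<le> j" "j < \<bar>m\<bar>" using assms(1) by (auto simp: representatives_def)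
  obtain j' where j': "W' = immediate j'" "0 \<le> j'" "j' < \<bar>m\<bar>" using assms(2) by (auto simp: representatives_def)
  obtain t where "j' = j + t * m" using go immediate_grand_orbit_iff j(1) j'(1) by blast
  then have "m dvd j' - j" by simp
  then have "\<bar>m\<bar> dvd j' - j" by simp
  then have "j' mod \<bar>m\<bar> = j mod \<bar>m\<bar>" by (simp add: mod_eq_dvd_iff)
  then have "j' = j" using j j' by simp
  then show False using assms(3) j(1) j'(1) by simp
qed

lemma fatou_set_eq_grand_orbits:
  "fatou_set f tan_domain = primary_component (l + of_int m * of_real pi)
    \<union> (\<Union>W\<in>representatives. \<Union>(grand_orbit f tan_domain W))"
proof -
  have "z \<in> (\<Union>W\<in>representatives. \<Union>(grand_orbit f tan_domain W))" if z: "z \<in> basin k" for z k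
  proof -
    define j where "j = k mod \<bar>m\<bar>"
    have j: "0 \<le> j" "j < \<bar>m\<bar>" using m_nonzero by (auto simp: j_def)
    \<comment> \<open>Division is by \<open>\<bar>m\<bar>\<close> whereas the index moves by
      \<open>m\<close>; \<open>sgn m\<close> converts one into the other.\<close>
    have "k = j + (k div \<bar>m\<bar> * sgn m) * m"
      unfolding j_def using mod_mult_div_eq[of k "\<bar>m\<bar>"] by (simp add: mult.assoc mult.commute abs_sgn)
    then have "\<exists>t. k = j + t * m" by blast
    then have "basin_component k z \<in> grand_orbit f tan_domain (immediate j)"
      unfolding immediate_def grand_orbit_iff[OF z0_basin z] .
    moreover have "immediate j \<in> representatives" using j by (simp add: representatives_def)
    moreover have "z \<in> basin_component k z" using z by simp
    ultimately show ?thesis by blast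
  qed
  moreover have "\<Union>(grand_orbit f tan_domain W) \<subseteq> all_basins" for W
  proof -
    have "Y \<subseteq> all_basins" if "Y \<in> grand_orbit f tan_domain W" for Y
      using that connected_component_subset
      unfolding grand_orbit_def fatou_component_def fatou_set_eq_basins[OF m_nonzero] by blast
    then show ?thesis by blast
  qed
  then have "(\<Union>W\<in>representatives. \<Union>(grand_orbit f tan_domain W)) \<subseteq> all_basins" by (rule UN_least)
  ultimately show ?thesis
    unfolding fatou_set_eq_basins[OF m_nonzero] primary_component_eq
    by (intro equalityI Un_least) (auto simp: all_basins_def)
qed

end

theorem theorem1p1:
  fixes lam :: complex and m :: int
  assumes "Im lam > 0" and "cmod (2 + lam\<^sup>2) < 1" and "m \<noteq> 0"
  defines "f \<equiv> ftan (lam + of_int m * of_real pi)"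
  shows "\<exists>Ws. finite Ws \<and> card Ws = nat \<bar>m\<bar>
      \<and> (\<forall>W\<in>Ws. wandering f tan_domain W)
      \<and> (\<forall>W\<in>Ws. \<forall>W'\<in>Ws. W \<noteq> W' \<longrightarrow> W' \<notin> grand_orbit f tan_domain W)
      \<and> fatou_set f tan_domain
          = primary_component (lam + of_int m * of_real pi) \<union> (\<Union>W\<in>Ws. \<Union>(grand_orbit f tan_domain W))
      \<and> (\<forall>W. wandering f tan_domain W \<longrightarrow>
            escaping f W
          \<and> (\<exists>Wn :: int \<Rightarrow> complex set.
                (\<forall>n. wandering f tan_domain (Wn n) \<and> Wn n \<in> grand_orbit f tan_domain W
                     \<and> \<not> bounded (Wn n)
                     \<and> proper_cmap f (Wn n) (Wn (n + 1)) \<and> map_degree f (Wn n) (Wn (n + 1)) 2)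
              \<and> (\<forall>W'. wandering f tan_domain W' \<and> W' \<in> grand_orbit f tan_domain W
                       \<and> W' \<notin> range Wn \<longrightarrow> inj_on f W'))
          \<and> (\<forall>z\<in>W. liminf (\<lambda>n. ereal (infdist ((f ^^ n) z)
                         (frontier (comp_of f tan_domain ((f ^^ n) z))))) > 0))"
proof -
  interpret drifting_tan lam m
    by unfold_locales (use assms in auto)
  note props = wandering_properties[folded f_def]
  show ?thesis
  proof (rule exI[of _ representatives], intro conjI)
    show "finite representatives" "card representatives = nat \<bar>m\<bar>" by (rule card_representatives)+
    show "\<forall>W\<in>representatives. wandering f tan_domain W"
      using wandering_immediate unfolding f_def representatives_def by blast
    show "\<forall>W\<in>representatives. \<forall>W'\<in>representatives. W \<noteq> W' \<longrightarrow> W' \<notin> grand_orbit f tan_domain W"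
      using representatives_distinct unfolding f_def by blast
    show "fatou_set f tan_domain = primary_component (lam + of_int m * of_real pi) \<union>
        (\<Union>W\<in>representatives. \<Union>(grand_orbit f tan_domain W))"
      unfolding f_def by (rule fatou_set_eq_grand_orbits)
  next
    show "\<forall>W. wandering f tan_domain W \<longrightarrow>
            escaping f W
          \<and> (\<exists>Wn :: int \<Rightarrow> complex set.
                (\<forall>n. wandering f tan_domain (Wn n) \<and> Wn n \<in> grand_orbit f tan_domain W
                     \<and> \<not> bounded (Wn n)
                     \<and> proper_cmap f (Wn n) (Wn (n + 1)) \<and> map_degree f (Wn n) (Wn (n + 1)) 2)
              \<and> (\<forall>W'. wandering f tan_domain W' \<and> W' \<in> grand_orbit f tan_domain W
                       \<and> W' \<notin> range Wn \<longrightarrow> inj_on f W'))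
          \<and> (\<forall>z\<in>W. liminf (\<lambda>n. ereal (infdist ((f ^^ n) z)
                         (frontier (comp_of f tan_domain ((f ^^ n) z))))) > 0)"
      by (intro allI impI conjI props)
  qed
qed

end
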